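(* Consider the two-hidden-layer network trained by stochastic gradient descent described in the context, with time-scaled output $g^{N_1,N_2}_t(x)=g^{N_1,N_2}_{\theta_{\lfloor N_1 t\rfloor}}(x)$. Then for any $t\in[0,1]$ and $x\in\mathcal X$, $$\lim_{N_2\to\infty}\lim_{N_1\to\infty} g_t^{N_1,N_2}(x)=g_t(x)$$ in probability, i.e. for all $\epsilon>0$, $\lim_{N_2\to\infty}\lim_{N_1\to\infty}\mathbb P\big[|g_t^{N_1,N_2}(x)-g_t(x)|>\epsilon\big]=0$, where $$g_t(x)=\int_{\mathcal C}\tilde C_t^{c}\,\tilde H_t^{2,c}(x)\,\mu_c(dc)$$ and, for $c\in\mathcal C$, $w\in\mathcal W^1$, $u\in\mathcal W^2$, $x\in\mathcal X$, $t\in[0,1]$, $$d\tilde C_t^{c}=\int_{\mathcal X\times\mathcal Y}(y-g_t(x))\tilde H_t^{2,c}(x)\,\pi(dx,dy)\,dt,\quad \tilde C_0^c=c,$$ $$d\tilde W_t^{1,w}=\int_{\mathcal X\times\mathcal Y}(y-g_t(x))V_t^{w}(x)\,\sigma'(\tilde W_t^{1,w}\cdot x)\,x\,\pi(dx,dy)\,dt,\quad \tilde W_0^{1,w}=w,$$ $$d\tilde W_t^{2,c,w,u}=\int_{\mathcal X\times\mathcal Y}(y-g_t(x))\tilde C_t^{c}\,\sigma'(\tilde Z_t^{c}(x))\,\tilde H_t^{1,w}(x)\,\pi(dx,dy)\,dt,\quad \tilde W_0^{2,c,w,u}=u,$$ $$\tilde H_t^{1,w}(x)=\sigma(\tilde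 W_t^{1,w}\cdot x),\qquad \tilde Z_t^{c}(x)=\int_{\mathcal W^1}\int_{\mathcal W^2}\tilde W_t^{2,c,w,u}\tilde H_t^{1,w}(x)\,\mu_{W^2}(du)\,\mu_{W^1}(dw),$$ $$\tilde H_t^{2,c}(x)=\sigma(\tilde Z_t^{c}(x)),\qquad V_t^{w}(x)=\int_{\mathcal C}\tilde C_t^{c}\,\sigma'(\tilde Z_t^{c}(x))\Big(\int_{\mathcal W^2}\tilde W_t^{2,c,w,u}\mu_{W^2}(du)\Big)\mu_c(dc).$$ This system has a unique solution. In addition, with $g_t^{N_2}(x)$ the first-layer limit output defined in the context, there is a constant $K<\infty$ such that for all $t\in[0,1]$ and all $N_2\in\mathbb N$, $$\sup_{x\in\mathcal X}\mathbb E\big[|g_t^{N_2}(x)-g_t(x)|\big]\le K N_2^{-1/2}.$$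
   Context: Network. Let $d\ge1$, $\sigma:\mathbb R\to\mathbb R$. For $N_1,N_2\in\mathbb N$ and parameters $\theta=(C^i,W^{2,i,j},W^{1,j})_{1\le i\le N_2,1\le j\le N_1}$ with $C^i,W^{2,i,j}\in\mathbb R$, $W^{1,j}\in\mathbb R^d$, set $$H^{1,j}(x)=\sigma(W^{1,j}\cdot x),\quad Z^{2,i}(x)=\tfrac1{N_1}\sum_{j=1}^{N_1}W^{2,i,j}H^{1,j}(x),\quad H^{2,i}(x)=\sigma(Z^{2,i}(x)),\quad g_\theta^{N_1,N_2}(x)=\tfrac1{N_2}\sum_{i=1}^{N_2}C^iH^{2,i}(x).$$ Training. Stochastic gradient descent with learning rates $\alpha_C=N_2/N_1$, $\alpha_{W,1}=1$, $\alpha_{W,2}=N_2$: for $k=0,1,2,\dots$, $$C^i_{k+1}=C^i_k+\tfrac{\alpha_C}{N_2}(y_k-g^{N_1,N_2}_{\theta_k}(x_k))H^{2,i}_k(x_k),$$ $$W^{1,j}_{k+1}=W^{1,j}_k+\tfrac{\alpha_{W,1}}{N_1}(y_k-g^{N_1,N_2}_{\theta_k}(x_k))\Big(\tfrac1{N_2}\sum_{i=1}^{N_2}C^i_k\sigma'(Z^{2,i}_k(x_k))W^{2,i,j}_k\Big)\sigma'(W^{1,j}_k\cdot x_k)x_k,$$ $$W^{2,i,j}_{k+1}=W^{2,i,j}_k+\tfrac{\alpha_{W,2}}{N_1N_2}(y_k-g^{N_1,N_2}_{\theta_k}(x_k))C^i_k\sigma'(Z^{2,i}_k(x_k))H^{1,j}_k(x_k),$$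 where the subscript $k$ on $H^{1,j},Z^{2,i},H^{2,i}$ means they are computed with $\theta_k$, and $(x_k,y_k)$ are i.i.d. samples from a probability distribution $\pi(dx,dy)$, independent of the initialization. Initial parameters are $C^i_\circ,W^{2,i,j}_\circ,W^{1,j}_\circ$. Standing assumptions. (i) $\sigma\in C^2_b$, i.e. twice continuously differentiable and bounded. (ii) $\pi$ has compact support: $(x_k,y_k)$ takes values in a compact set $\mathcal X\times\mathcal Y\subset\mathbb R^d\times\mathbb R$. (iii) The families $\{C^i_\circ\}_i$, $\{W^{2,i,j}_\circ\}_{i,j}$, $\{W^{1,j}_\circ\}_j$ are each i.i.d. and independent of one another, with values in compact sets $\mathcal C\subset\mathbb R$, $\mathcal W^2\subset\mathbb R$, $\mathcal W^1\subset\mathbb R^d$ and laws $\mu_c,\mu_{W^2},\mu_{W^1}$ respectively. (iv) These laws admit continuous probability density functions. First-layer limit output $g^{N_2}_t$. Write $\langle f,\gamma\rangle=\int f\,d\gamma$. For fixed $N_2$, let $\gamma^{N_2}=(\gamma^{N_2}_t)_{0\le t\le1}$ be the (random, measure-valued) process, with values in measures on $\mathbb R^{d+2N_2}\ni(w^1,w^{2,1},\dots,w^{2,N_2},c_1,\dots,c_{N_2})$, that is the limit in distribution as $N_1\to\infty$ of $\gamma^{N_1,N_2}_t=\frac1{N_1}\sum_{j=1}^{N_1}\delta_{(W^{1,j}_k,W^{2,1,j}_k,\dots,W^{2,N_2,j}_k,C^1_k,\dots,C^{N_2}_k)}\big|_{k=\lfloor N_1t\rfloor}$; it solves, for every $f\in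 C^2_b(\mathbb R^{d+2N_2})$, $$\langle f,\gamma^{N_2}_t\rangle-\langle f,\gamma^{N_2}_0\rangle=\int_0^t\int(y-g^{N_2}_s(x))\langle H^{N_2}_s(x)\cdot\nabla_cf,\gamma^{N_2}_s\rangle\pi(dx,dy)ds$$ $$+\int_0^t\int(y-g^{N_2}_s(x))\langle\sigma(w^1\cdot x)(\sigma'(Z_s(x))\odot c)\cdot\nabla_{w^2}f,\gamma^{N_2}_s\rangle\pi(dx,dy)ds$$ $$+\int_0^t\int(y-g^{N_2}_s(x))\tfrac1{N_2}\sum_{i=1}^{N_2}\langle c_i\sigma'(Z^{i,N_2}_s(x))w^{2,i}\sigma'(w^1\cdot x)x\cdot\nabla_{w^1}f,\gamma^{N_2}_s\rangle\pi(dx,dy)ds,$$ where $Z^{i,N_2}_s(x)=\langle w^{2,i}\sigma(w^1\cdot x),\gamma^{N_2}_s\rangle$, $H^{i,N_2}_s=\sigma(Z^{i,N_2}_s)$, $H^{N_2}_s=(H^{i,N_2}_s)_{i}$, $Z_s=(Z^{i,N_2}_s)_i$, $\odot$ is the componentwise product, and the first-layer limit output is $g^{N_2}_s(x)=\frac1{N_2}\sum_{i=1}^{N_2}\langle c_i,\gamma^{N_2}_s\rangle H^{i,N_2}_s(x)$. The initial value is $\gamma^{N_2}_0=\mu_{W^1}(dw^1)\times\prod_{i=1}^{N_2}\mu_{W^2}(dw^{2,i})\times\prod_{i=1}^{N_2}\delta_{C^i_\circ}(dc_i)$.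
   Formalization: The inner limit over N_1 of P[|g_t^{N_1,N_2}(x)-g_t(x)|>ε] need not exist when |g_t^{N_2}(x)-g_t(x)|=ε has positive probability, so it is replaced by a limsup for every ε>0; the inner limit is shown to exist for all other ε. *)

theory Defs
  imports "HOL-Probability.Probability"
begin

text \<open>Neurons are numbered from 0, so the index ranges are \<open>i < N2\<close> and \<open>j < N1\<close>. Parameters are
  stored as total functions; values outside these ranges never enter the network.\<close>

record 'a params =
  pC :: "nat \<Rightarrow> real"
  pW2 :: "nat \<Rightarrow> nat \<Rightarrow> real"
  pW1 :: "nat \<Rightarrow> 'a"

text \<open>\<open>C2b\<close> is the usual space of twice continuously differentiable functions that are bounded
  together with their first two derivatives.\<close>

definition C2b :: "(real \<Rightarrow> real) \<Rightarrow> bool" where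
  "C2b \<sigma> \<longleftrightarrow>
     (\<forall>z. \<sigma> differentiable at z) \<and> (\<forall>z. deriv \<sigma> differentiable at z) \<and>
     continuous_on UNIV (deriv (deriv \<sigma>)) \<and>
     bounded (range \<sigma>) \<and> bounded (range (deriv \<sigma>)) \<and> bounded (range (deriv (deriv \<sigma>)))"

definition H1 :: "(real \<Rightarrow> real) \<Rightarrow> 'a::euclidean_space params \<Rightarrow> nat \<Rightarrow> 'a \<Rightarrow> real" where
  "H1 \<sigma> \<theta> j x = \<sigma> (pW1 \<theta> j \<bullet> x)"

definition Z2 :: "(real \<Rightarrow> real) \<Rightarrow> nat \<Rightarrow> 'a::euclidean_space params \<Rightarrow> nat \<Rightarrow> 'a \<Rightarrow> real" where
  "Z2 \<sigma> N1 \<theta> i x = 1 / real N1 * (\<Sum>j<N1. pW2 \<theta> i j * H1 \<sigma> \<theta> j x)"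

definition H2 :: "(real \<Rightarrow> real) \<Rightarrow> nat \<Rightarrow> 'a::euclidean_space params \<Rightarrow> nat \<Rightarrow> 'a \<Rightarrow> real" where
  "H2 \<sigma> N1 \<theta> i x = \<sigma> (Z2 \<sigma> N1 \<theta> i x)"

definition net :: "(real \<Rightarrow> real) \<Rightarrow> nat \<Rightarrow> nat \<Rightarrow> 'a::euclidean_space params \<Rightarrow> 'a \<Rightarrow> real" where
  "net \<sigma> N1 N2 \<theta> x = 1 / real N2 * (\<Sum>i<N2. pC \<theta> i * H2 \<sigma> N1 \<theta> i x)"

definition rate_C :: "nat \<Rightarrow> nat \<Rightarrow> real" where
  "rate_C N1 N2 = real N2 / real N1"

definition rate_W1 :: "nat \<Rightarrow> nat \<Rightarrow> real" where
  "rate_W1 N1 N2 = 1"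

definition rate_W2 :: "nat \<Rightarrow> nat \<Rightarrow> real" where
  "rate_W2 N1 N2 = real N2"

definition sgd_step ::
  "(real \<Rightarrow> real) \<Rightarrow> nat \<Rightarrow> nat \<Rightarrow> 'a::euclidean_space \<times> real \<Rightarrow> 'a params \<Rightarrow> 'a params" where
  "sgd_step \<sigma> N1 N2 = (\<lambda>(x, y) \<theta>.
     \<lparr> pC = (\<lambda>i. pC \<theta> i + rate_C N1 N2 / real N2 * (y - net \<sigma> N1 N2 \<theta> x) * H2 \<sigma> N1 \<theta> i x),
       pW2 = (\<lambda>i j. pW2 \<theta> i j + rate_W2 N1 N2 / (real N1 * real N2) * (y - net \<sigma> N1 N2 \<theta> x)
                * pC \<theta> i * deriv \<sigma> (Z2 \<sigma> N1 \<theta> i x) * H1 \<sigma> \<theta> j x),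
       pW1 = (\<lambda>j. pW1 \<theta> j + (rate_W1 N1 N2 / real N1 * (y - net \<sigma> N1 N2 \<theta> x)
                * (1 / real N2 * (\<Sum>i<N2. pC \<theta> i * deriv \<sigma> (Z2 \<sigma> N1 \<theta> i x) * pW2 \<theta> i j))
                * deriv \<sigma> (pW1 \<theta> j \<bullet> x)) *\<^sub>R x) \<rparr>)"

primrec sgd ::
  "(real \<Rightarrow> real) \<Rightarrow> nat \<Rightarrow> nat \<Rightarrow> 'a::euclidean_space params \<Rightarrow> (nat \<Rightarrow> 'a \<times> real) \<Rightarrow> nat \<Rightarrow> 'a params"
where
  "sgd \<sigma> N1 N2 \<theta>0 xy 0 = \<theta>0"
| "sgd \<sigma> N1 N2 \<theta>0 xy (Suc k) = sgd_step \<sigma> N1 N2 (xy k) (sgd \<sigma> N1 N2 \<theta>0 xy k)"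

definition sgd_at ::
  "(real \<Rightarrow> real) \<Rightarrow> (nat \<Rightarrow> 'w \<Rightarrow> real) \<Rightarrow> (nat \<Rightarrow> nat \<Rightarrow> 'w \<Rightarrow> real) \<Rightarrow>
   (nat \<Rightarrow> 'w \<Rightarrow> 'a::euclidean_space) \<Rightarrow> (nat \<Rightarrow> 'w \<Rightarrow> 'a \<times> real) \<Rightarrow>
   nat \<Rightarrow> nat \<Rightarrow> real \<Rightarrow> 'w \<Rightarrow> 'a params" where
  "sgd_at \<sigma> C0 W20 W10 XY N1 N2 t \<omega> =
     sgd \<sigma> N1 N2
       \<lparr> pC = (\<lambda>i. C0 i \<omega>), pW2 = (\<lambda>i j. W20 i j \<omega>), pW1 = (\<lambda>j. W10 j \<omega>) \<rparr>
       (\<lambda>k. XY k \<omega>) (nat \<lfloor>real N1 * t\<rfloor>)"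

datatype source = Src_C nat | Src_W2 nat nat | Src_W1 nat | Src_data nat

text \<open>Mutual independence of all initial parameters and all samples. The variables have different
  codomains, so the library's \<open>indep_vars\<close> is unfolded to \<open>indep_sets\<close> of the generated
  sigma-algebras.\<close>

definition events_of :: "'w measure \<Rightarrow> ('w \<Rightarrow> 'b::topological_space) \<Rightarrow> 'w set set" where
  "events_of M X = {X -` A \<inter> space M |A. A \<in> sets borel}"

definition independent_sources ::
  "'w measure \<Rightarrow> (nat \<Rightarrow> 'w \<Rightarrow> real) \<Rightarrow> (nat \<Rightarrow> nat \<Rightarrow> 'w \<Rightarrow> real) \<Rightarrow>
   (nat \<Rightarrow> 'w \<Rightarrow> 'a::euclidean_space) \<Rightarrow> (nat \<Rightarrow> 'w \<Rightarrow> 'a \<times> real) \<Rightarrow> bool" where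
  "independent_sources M C0 W20 W10 XY \<longleftrightarrow>
     (\<forall>i. C0 i \<in> borel_measurable M) \<and> (\<forall>i j. W20 i j \<in> borel_measurable M) \<and>
     (\<forall>j. W10 j \<in> borel_measurable M) \<and> (\<forall>k. XY k \<in> borel_measurable M) \<and>
     prob_space.indep_sets M
       (\<lambda>s. case s of Src_C i \<Rightarrow> events_of M (C0 i) | Src_W2 i j \<Rightarrow> events_of M (W20 i j)
                    | Src_W1 j \<Rightarrow> events_of M (W10 j) | Src_data k \<Rightarrow> events_of M (XY k)) UNIV"

definition has_continuous_density :: "'b::euclidean_space measure \<Rightarrow> bool" where
  "has_continuous_density \<mu> \<longleftrightarrow>
     (\<exists>p. continuous_on UNIV p \<and> (\<forall>z. 0 \<le> p z) \<and> \<mu> = density lborel (\<lambda>z. ennreal (p z)))"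

text \<open>Below, \<open>C\<close>, \<open>W1\<close> and \<open>W2\<close> in the first four definitions are the values at a fixed time of
  the families indexed by \<open>c\<close>, by \<open>w\<close> and by \<open>(c, w, u)\<close>. Integrals are over the whole laws, which
  are concentrated on the compact parameter and data sets.\<close>

definition mf_Z ::
  "(real \<Rightarrow> real) \<Rightarrow> 'a::euclidean_space measure \<Rightarrow> real measure \<Rightarrow>
   ('a \<Rightarrow> 'a) \<Rightarrow> (real \<Rightarrow> 'a \<Rightarrow> real \<Rightarrow> real) \<Rightarrow> real \<Rightarrow> 'a \<Rightarrow> real" where
  "mf_Z \<sigma> mu_W1 mu_W2 W1 W2 c x =
     (\<integral>w. (\<integral>u. W2 c w u * \<sigma> (W1 w \<bullet> x) \<partial>mu_W2) \<partial>mu_W1)"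

definition mf_H2 ::
  "(real \<Rightarrow> real) \<Rightarrow> 'a::euclidean_space measure \<Rightarrow> real measure \<Rightarrow>
   ('a \<Rightarrow> 'a) \<Rightarrow> (real \<Rightarrow> 'a \<Rightarrow> real \<Rightarrow> real) \<Rightarrow> real \<Rightarrow> 'a \<Rightarrow> real" where
  "mf_H2 \<sigma> mu_W1 mu_W2 W1 W2 c x = \<sigma> (mf_Z \<sigma> mu_W1 mu_W2 W1 W2 c x)"

definition mf_g ::
  "(real \<Rightarrow> real) \<Rightarrow> real measure \<Rightarrow> 'a::euclidean_space measure \<Rightarrow> real measure \<Rightarrow>
   (real \<Rightarrow> real) \<Rightarrow> ('a \<Rightarrow> 'a) \<Rightarrow> (real \<Rightarrow> 'a \<Rightarrow> real \<Rightarrow> real) \<Rightarrow> 'a \<Rightarrow> real" where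
  "mf_g \<sigma> mu_c mu_W1 mu_W2 C W1 W2 x = (\<integral>c. C c * mf_H2 \<sigma> mu_W1 mu_W2 W1 W2 c x \<partial>mu_c)"

definition mf_V ::
  "(real \<Rightarrow> real) \<Rightarrow> real measure \<Rightarrow> 'a::euclidean_space measure \<Rightarrow> real measure \<Rightarrow>
   (real \<Rightarrow> real) \<Rightarrow> ('a \<Rightarrow> 'a) \<Rightarrow> (real \<Rightarrow> 'a \<Rightarrow> real \<Rightarrow> real) \<Rightarrow> 'a \<Rightarrow> 'a \<Rightarrow> real" where
  "mf_V \<sigma> mu_c mu_W1 mu_W2 C W1 W2 w x =
     (\<integral>c. C c * deriv \<sigma> (mf_Z \<sigma> mu_W1 mu_W2 W1 W2 c x) * (\<integral>u. W2 c w u \<partial>mu_W2) \<partial>mu_c)"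

text \<open>Boundedness and measurability in the labels are what gives the integrals a meaning; they
  delimit the class in which the solution is unique. Values at labels outside the parameter sets
  are unconstrained.\<close>

definition mf_solution ::
  "(real \<Rightarrow> real) \<Rightarrow> ('a::euclidean_space \<times> real) measure \<Rightarrow>
   real measure \<Rightarrow> 'a measure \<Rightarrow> real measure \<Rightarrow> real set \<Rightarrow> 'a set \<Rightarrow> real set \<Rightarrow>
   (real \<Rightarrow> real \<Rightarrow> real) \<Rightarrow> (real \<Rightarrow> 'a \<Rightarrow> 'a) \<Rightarrow> (real \<Rightarrow> real \<Rightarrow> 'a \<Rightarrow> real \<Rightarrow> real) \<Rightarrow> bool" where
  "mf_solution \<sigma> \<pi> mu_c mu_W1 mu_W2 CC WW1 WW2 C W1 W2 \<longleftrightarrow>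
     (\<forall>t\<in>{0..1}. C t \<in> borel_measurable borel \<and> W1 t \<in> borel_measurable borel \<and>
        (\<lambda>(c, w, u). W2 t c w u) \<in> borel_measurable borel) \<and>
     (\<exists>B. \<forall>t\<in>{0..1}. \<forall>c\<in>CC. \<forall>w\<in>WW1. \<forall>u\<in>WW2.
        \<bar>C t c\<bar> \<le> B \<and> norm (W1 t w) \<le> B \<and> \<bar>W2 t c w u\<bar> \<le> B) \<and>
     (\<forall>c\<in>CC. C 0 c = c \<and>
        (\<forall>t\<in>{0..1}. ((\<lambda>s. C s c) has_real_derivative
           (\<integral>(x, y). (y - mf_g \<sigma> mu_c mu_W1 mu_W2 (C t) (W1 t) (W2 t) x)
              * mf_H2 \<sigma> mu_W1 mu_W2 (W1 t) (W2 t) c x \<partial>\<pi>)) (at t within {0..1}))) \<and>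
     (\<forall>w\<in>WW1. W1 0 w = w \<and>
        (\<forall>t\<in>{0..1}. ((\<lambda>s. W1 s w) has_vector_derivative
           (\<integral>(x, y). ((y - mf_g \<sigma> mu_c mu_W1 mu_W2 (C t) (W1 t) (W2 t) x)
              * mf_V \<sigma> mu_c mu_W1 mu_W2 (C t) (W1 t) (W2 t) w x
              * deriv \<sigma> (W1 t w \<bullet> x)) *\<^sub>R x \<partial>\<pi>)) (at t within {0..1}))) \<and>
     (\<forall>c\<in>CC. \<forall>w\<in>WW1. \<forall>u\<in>WW2. W2 0 c w u = u \<and>
        (\<forall>t\<in>{0..1}. ((\<lambda>s. W2 s c w u) has_real_derivative
           (\<integral>(x, y). (y - mf_g \<sigma> mu_c mu_W1 mu_W2 (C t) (W1 t) (W2 t) x)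
              * C t c * deriv \<sigma> (mf_Z \<sigma> mu_W1 mu_W2 (W1 t) (W2 t) c x)
              * \<sigma> (W1 t w \<bullet> x) \<partial>\<pi>)) (at t within {0..1})))"

text \<open>Points of the space of dimension \<open>d + 2 * N2\<close> are triples of the first-layer weight, the \<open>N2\<close> second-layer weights and the
  \<open>N2\<close> output weights. Since \<open>N2\<close> varies, the last two
  components are extensional functions on \<open>{..<N2}\<close>, topologized as a subspace of the product
  topology on \<open>nat \<Rightarrow> real\<close>.\<close>

type_synonym 'a point = "'a \<times> (nat \<Rightarrow> real) \<times> (nat \<Rightarrow> real)"

definition phase :: "nat \<Rightarrow> 'a::euclidean_space point measure" where
  "phase N2 = borel \<Otimes>\<^sub>M (PiM {..<N2} (\<lambda>_. borel) \<Otimes>\<^sub>M PiM {..<N2} (\<lambda>_. borel))"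

definition bounded_continuous :: "nat \<Rightarrow> ('a::euclidean_space point \<Rightarrow> real) \<Rightarrow> bool" where
  "bounded_continuous N2 f \<longleftrightarrow>
     continuous_on (space (phase N2)) f \<and> bounded (f ` space (phase N2))"

datatype 'a dir = Dir_w1 'a | Dir_w2 nat | Dir_c nat

fun move :: "'a::euclidean_space dir \<Rightarrow> real \<Rightarrow> 'a point \<Rightarrow> 'a point" where
  "move (Dir_w1 b) s (w, v, c) = (w + s *\<^sub>R b, v, c)"
| "move (Dir_w2 i) s (w, v, c) = (w, v(i := v i + s), c)"
| "move (Dir_c i) s (w, v, c) = (w, v, c(i := c i + s))"

definition pderiv :: "'a::euclidean_space dir \<Rightarrow> ('a point \<Rightarrow> real) \<Rightarrow> 'a point \<Rightarrow> real" where
  "pderiv e f p = deriv (\<lambda>s. f (move e s p)) 0"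

definition coord_dirs :: "nat \<Rightarrow> 'a::euclidean_space dir set" where
  "coord_dirs N2 = Dir_w1 ` Basis \<union> Dir_w2 ` {..<N2} \<union> Dir_c ` {..<N2}"

text \<open>\<open>Ckb N2 k\<close>: all partial derivatives up to order \<open>k\<close> exist and are bounded and continuous on
  the phase space.\<close>

fun Ckb :: "nat \<Rightarrow> nat \<Rightarrow> ('a::euclidean_space point \<Rightarrow> real) \<Rightarrow> bool" where
  "Ckb N2 0 f \<longleftrightarrow> bounded_continuous N2 f"
| "Ckb N2 (Suc k) f \<longleftrightarrow> bounded_continuous N2 f \<and>
     (\<forall>e\<in>coord_dirs N2.
        (\<forall>p\<in>space (phase N2). (\<lambda>s. f (move e s p)) differentiable at 0) \<and> Ckb N2 k (pderiv e f))"

definition grad_w1 :: "('a::euclidean_space point \<Rightarrow> real) \<Rightarrow> 'a point \<Rightarrow> 'a" where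
  "grad_w1 f p = (\<Sum>b\<in>Basis. pderiv (Dir_w1 b) f p *\<^sub>R b)"

definition empirical ::
  "nat \<Rightarrow> nat \<Rightarrow> 'a::euclidean_space params \<Rightarrow> 'a point measure" where
  "empirical N1 N2 \<theta> =
     distr (uniform_count_measure {..<N1}) (phase N2)
       (\<lambda>j. (pW1 \<theta> j, restrict (\<lambda>i. pW2 \<theta> i j) {..<N2}, restrict (pC \<theta>) {..<N2}))"

definition fl_Z :: "(real \<Rightarrow> real) \<Rightarrow> 'a::euclidean_space point measure \<Rightarrow> nat \<Rightarrow> 'a \<Rightarrow> real" where
  "fl_Z \<sigma> \<nu> i x = (\<integral>(w, v, c). v i * \<sigma> (w \<bullet> x) \<partial>\<nu>)"

definition fl_g :: "(real \<Rightarrow> real) \<Rightarrow> nat \<Rightarrow> 'a::euclidean_space point measure \<Rightarrow> 'a \<Rightarrow> real" where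
  "fl_g \<sigma> N2 \<nu> x =
     1 / real N2 * (\<Sum>i<N2. (\<integral>(w, v, c). c i \<partial>\<nu>) * \<sigma> (fl_Z \<sigma> \<nu> i x))"

definition fl_equation ::
  "(real \<Rightarrow> real) \<Rightarrow> ('a::euclidean_space \<times> real) measure \<Rightarrow> nat \<Rightarrow>
   (real \<Rightarrow> 'a point measure) \<Rightarrow> ('a point \<Rightarrow> real) \<Rightarrow> real \<Rightarrow> bool" where
  "fl_equation \<sigma> \<pi> N2 \<nu> f t \<longleftrightarrow>
     (\<integral>p. f p \<partial>\<nu> t) - (\<integral>p. f p \<partial>\<nu> 0) =
       (LINT s:{0..t}|lborel. \<integral>(x, y). (y - fl_g \<sigma> N2 (\<nu> s) x) *
          (\<integral>p. (\<Sum>i<N2. \<sigma> (fl_Z \<sigma> (\<nu> s) i x) * pderiv (Dir_c i) f p) \<partial>\<nu> s) \<partial>\<pi>) +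
       (LINT s:{0..t}|lborel. \<integral>(x, y). (y - fl_g \<sigma> N2 (\<nu> s) x) *
          (\<integral>(w, v, c). \<sigma> (w \<bullet> x) * (\<Sum>i<N2. (deriv \<sigma> (fl_Z \<sigma> (\<nu> s) i x) * c i)
              * pderiv (Dir_w2 i) f (w, v, c)) \<partial>\<nu> s) \<partial>\<pi>) +
       (LINT s:{0..t}|lborel. \<integral>(x, y). (y - fl_g \<sigma> N2 (\<nu> s) x) *
          (1 / real N2 * (\<Sum>i<N2. \<integral>(w, v, c). c i * deriv \<sigma> (fl_Z \<sigma> (\<nu> s) i x) * v i
              * deriv \<sigma> (w \<bullet> x) * (x \<bullet> grad_w1 f (w, v, c)) \<partial>\<nu> s)) \<partial>\<pi>)"

definition weakly_converges ::
  "nat \<Rightarrow> (nat \<Rightarrow> 'a::euclidean_space point measure) \<Rightarrow> 'a point measure \<Rightarrow> bool" where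
  "weakly_converges N2 \<nu>s \<nu> \<longleftrightarrow>
     (\<forall>f. bounded_continuous N2 f \<longrightarrow> (\<lambda>n. \<integral>p. f p \<partial>\<nu>s n) \<longlonglongrightarrow> (\<integral>p. f p \<partial>\<nu>))"

text \<open>Real functionals of a path of probability measures that depend (continuously, for weak
  convergence) only on the values at the times in \<open>T\<close>. The topology of weak convergence is
  metrizable here, so sequential continuity is continuity.\<close>

definition continuous_functional ::
  "nat \<Rightarrow> real set \<Rightarrow> ((real \<Rightarrow> 'a::euclidean_space point measure) \<Rightarrow> real) \<Rightarrow> bool" where
  "continuous_functional N2 T F \<longleftrightarrow>
     (\<forall>ps p. (\<forall>t\<in>T. (\<forall>n. ps n t \<in> space (prob_algebra (phase N2))) \<and>
                p t \<in> space (prob_algebra (phase N2)) \<and> weakly_converges N2 (\<lambda>n. ps n t) (p t))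
        \<longrightarrow> (\<lambda>n. F (ps n)) \<longlonglongrightarrow> F p)"

text \<open>Convergence in distribution of measure-valued processes on \<open>[0,1]\<close>, in the sense of all
  finite-dimensional distributions. For limits with weakly continuous paths this is implied by
  convergence in the Skorokhod space.\<close>

definition process_converges_in_distribution ::
  "'w measure \<Rightarrow> nat \<Rightarrow> (nat \<Rightarrow> real \<Rightarrow> 'w \<Rightarrow> 'a::euclidean_space point measure) \<Rightarrow>
   (real \<Rightarrow> 'w \<Rightarrow> 'a point measure) \<Rightarrow> bool" where
  "process_converges_in_distribution M N2 \<Gamma> \<gamma> \<longleftrightarrow>
     (\<forall>T F. finite T \<and> T \<subseteq> {0..1} \<and> continuous_functional N2 T F \<and> bounded (range F) \<longrightarrow>
        (\<lambda>N1. \<integral>\<omega>. F (\<lambda>t. \<Gamma> N1 t \<omega>) \<partial>M) \<longlonglongrightarrow> (\<integral>\<omega>. F (\<lambda>t. \<gamma> t \<omega>) \<partial>M))"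

definition first_layer_limit ::
  "'w measure \<Rightarrow> (real \<Rightarrow> real) \<Rightarrow> ('a::euclidean_space \<times> real) measure \<Rightarrow> 'a measure \<Rightarrow> real measure \<Rightarrow>
   (nat \<Rightarrow> 'w \<Rightarrow> real) \<Rightarrow> (nat \<Rightarrow> nat \<Rightarrow> 'w \<Rightarrow> real) \<Rightarrow> (nat \<Rightarrow> 'w \<Rightarrow> 'a) \<Rightarrow>
   (nat \<Rightarrow> 'w \<Rightarrow> 'a \<times> real) \<Rightarrow> nat \<Rightarrow> (real \<Rightarrow> 'w \<Rightarrow> 'a point measure) \<Rightarrow> bool" where
  "first_layer_limit M \<sigma> \<pi> mu_W1 mu_W2 C0 W20 W10 XY N2 \<gamma> \<longleftrightarrow>
     (\<forall>t\<in>{0..1}. \<gamma> t \<in> measurable M (prob_algebra (phase N2))) \<and>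
     process_converges_in_distribution M N2
       (\<lambda>N1 t \<omega>. empirical N1 N2 (sgd_at \<sigma> C0 W20 W10 XY N1 N2 t \<omega>)) \<gamma> \<and>
     (\<forall>f. Ckb N2 2 f \<longrightarrow>
        (AE \<omega> in M. \<forall>t\<in>{0..1}. fl_equation \<sigma> \<pi> N2 (\<lambda>s. \<gamma> s \<omega>) f t)) \<and>
     (AE \<omega> in M. \<gamma> 0 \<omega> =
        mu_W1 \<Otimes>\<^sub>M (PiM {..<N2} (\<lambda>_. mu_W2) \<Otimes>\<^sub>M PiM {..<N2} (\<lambda>i. return borel (C0 i \<omega>))))"

end

theory Submission
  imports Defs
begin

text \<open>Stochastic gradient descent at step \<open>k\<close> is coupled directly with the mean-field
  system at time \<open>k / N1\<close>, started from the same initial parameters. One step multiplies the mean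
  parameter error by \<open>1 + O(1 / N1)\<close> and adds, besides \<open>O(1 / N1^2)\<close> from the time
  discretization, two kinds of errors: fluctuations of averages over neurons, and the difference between a
  sample and its \<open>\<pi>\<close>-mean. Both are evaluated at the mean-field parameters, which depend on
  each neuron's own labels only, so they are centered sums of conditionally independent terms and cost
  \<open>O(N1 powr (-1/2) + N2 powr (-1/2))\<close> after summation over the steps. A discrete Gronwall
  inequality gives \<open>E \<bar>g^{N1,N2} - g\<bar> \<le> K (N1 powr (-1/2) + N2 powr (-1/2))\<close>. The
  finite network output is a bounded continuous functional of the empirical measure, because all parameters
  stay in a fixed compact set; so every first-layer limit inherits the bound as \<open>N1\<close> tends to
  infinity. The mean-field system itself is solved by Banach's fixed point theorem in an exponentially
  weighted sup norm over time and all labels.\<close>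

section \<open>Lipschitz calculus of the mean-field functionals\<close>

text \<open>A bound and a Lipschitz estimate travel together, since the Lipschitz constant of a product
  involves the bounds of its factors.\<close>

definition lip :: "real \<Rightarrow> real \<Rightarrow> real \<Rightarrow> 'b::real_normed_vector \<Rightarrow> 'b \<Rightarrow> bool" where
  "lip \<delta> A \<alpha> a a' \<longleftrightarrow> norm a \<le> A \<and> norm a' \<le> A \<and> norm (a - a') \<le> \<alpha> * \<delta>"

lemma norm_scaleR_diff_le:
  fixes a a' :: real and b b' :: "'b::real_normed_vector"
  assumes "\<bar>a\<bar> \<le> A" "norm b' \<le> B"
  shows "norm (a *\<^sub>R b - a' *\<^sub>R b') \<le> A * norm (b - b') + B * \<bar>a - a'\<bar>"
proof -
  have "a *\<^sub>R b - a' *\<^sub>R b' = a *\<^sub>R (b - b') + (a - a') *\<^sub>R b'"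
    by (simp add: algebra_simps)
  also have "norm \<dots> \<le> \<bar>a\<bar> * norm (b - b') + \<bar>a - a'\<bar> * norm b'"
    by (rule norm_triangle_le) simp
  also have "\<dots> \<le> A * norm (b - b') + \<bar>a - a'\<bar> * B"
    using assms by (intro add_mono mult_mono) auto
  finally show ?thesis by (simp add: mult.commute)
qed

lemma abs_mult_diff_le:
  fixes a a' b b' :: real
  assumes "\<bar>a\<bar> \<le> A" "\<bar>b'\<bar> \<le> B"
  shows "\<bar>a * b - a' * b'\<bar> \<le> A * \<bar>b - b'\<bar> + B * \<bar>a - a'\<bar>"
  using norm_scaleR_diff_le[of a A b' B b a'] assms by simp

lemma lip_scaleR:
  assumes a: "lip \<delta> A \<alpha> a a'" and b: "lip \<delta> B \<beta> b b'"
  shows "lip \<delta> (A * B) (A * \<beta> + B * \<alpha>) (a *\<^sub>R b) (a' *\<^sub>R b')"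
proof -
  have nonneg: "0 \<le> A" "0 \<le> B"
    using a b norm_ge_zero[of a] norm_ge_zero[of b] unfolding lip_def by linarith+
  have "norm (a *\<^sub>R b - a' *\<^sub>R b') \<le> A * norm (b - b') + B * \<bar>a - a'\<bar>"
    using a b by (intro norm_scaleR_diff_le) (auto simp: lip_def)
  also have "\<dots> \<le> A * (\<beta> * \<delta>) + B * (\<alpha> * \<delta>)"
    using a b nonneg by (intro add_mono mult_left_mono) (auto simp: lip_def)
  finally have "norm (a *\<^sub>R b - a' *\<^sub>R b') \<le> (A * \<beta> + B * \<alpha>) * \<delta>"
    by (simp add: algebra_simps)
  moreover have "norm (a *\<^sub>R b) \<le> A * B" "norm (a' *\<^sub>R b') \<le> A * B"
    using a b nonneg by (auto simp: lip_def intro: mult_mono)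
  ultimately show ?thesis by (simp add: lip_def)
qed

lemma lip_mult:
  fixes a a' b b' :: real
  assumes "lip \<delta> A \<alpha> a a'" "lip \<delta> B \<beta> b b'"
  shows "lip \<delta> (A * B) (A * \<beta> + B * \<alpha>) (a * b) (a' * b')"
  using lip_scaleR[OF assms] by simp

lemma lip_diff:
  assumes "lip \<delta> A \<alpha> a a'" "lip \<delta> B \<beta> b b'"
  shows "lip \<delta> (A + B) (\<alpha> + \<beta>) (a - b) (a' - b')"
proof -
  have "norm ((a - b) - (a' - b')) \<le> norm (a - a') + norm (b - b')"
    using norm_triangle_ineq4[of "a - a'" "b - b'"] by (simp add: algebra_simps)
  then show ?thesis
    using assms norm_triangle_ineq4[of a b] norm_triangle_ineq4[of a' b']
    by (auto simp: lip_def algebra_simps)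
qed

lemma lip_const: "norm a \<le> A \<Longrightarrow> lip \<delta> A 0 a a"
  by (simp add: lip_def)

lemma lip_integral:
  fixes f f' :: "'x \<Rightarrow> 'b::{banach, second_countable_topology}"
  assumes "prob_space \<mu>" and [measurable]: "f \<in> borel_measurable \<mu>" "f' \<in> borel_measurable \<mu>"
    and ae: "AE p in \<mu>. lip \<delta> A \<alpha> (f p) (f' p)"
  shows "lip \<delta> A \<alpha> (\<integral>p. f p \<partial>\<mu>) (\<integral>p. f' p \<partial>\<mu>)"
proof -
  interpret prob_space \<mu> by fact
  have bound: "norm (\<integral>p. h p \<partial>\<mu>) \<le> B"
    if [measurable]: "h \<in> borel_measurable \<mu>" and "AE p in \<mu>. norm (h p) \<le> B"
    for h :: "'x \<Rightarrow> 'b" and B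
  proof -
    have i: "integrable \<mu> h" using that by (intro integrable_const_bound)
    have "norm (\<integral>p. h p \<partial>\<mu>) \<le> (\<integral>p. norm (h p) \<partial>\<mu>)" by (rule integral_norm_bound)
    also have "\<dots> \<le> (\<integral>p. B \<partial>\<mu>)"
      using i that by (intro integral_mono_AE) auto
    finally show ?thesis by (simp add: prob_space)
  qed
  have "integrable \<mu> f" "integrable \<mu> f'"
    using ae by (auto intro!: integrable_const_bound[where B = A] simp: lip_def)
  then have "norm ((\<integral>p. f p \<partial>\<mu>) - (\<integral>p. f' p \<partial>\<mu>)) \<le> \<alpha> * \<delta>"
    using bound[of "\<lambda>p. f p - f' p" "\<alpha> * \<delta>"] ae by (auto simp: lip_def)
  then show ?thesis
    using ae by (auto simp: lip_def intro!: bound)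
qed

definition mf_rhs_C where
  "mf_rhs_C \<sigma> \<pi> mu_c mu_W1 mu_W2 C W1 W2 c =
     (\<integral>(x, y). (y - mf_g \<sigma> mu_c mu_W1 mu_W2 C W1 W2 x) * mf_H2 \<sigma> mu_W1 mu_W2 W1 W2 c x \<partial>\<pi>)"

definition mf_rhs_W1 where
  "mf_rhs_W1 \<sigma> \<pi> mu_c mu_W1 mu_W2 C W1 W2 w =
     (\<integral>(x, y). ((y - mf_g \<sigma> mu_c mu_W1 mu_W2 C W1 W2 x) * mf_V \<sigma> mu_c mu_W1 mu_W2 C W1 W2 w x
        * deriv \<sigma> (W1 w \<bullet> x)) *\<^sub>R x \<partial>\<pi>)"

definition mf_rhs_W2 where
  "mf_rhs_W2 \<sigma> \<pi> mu_c mu_W1 mu_W2 C W1 W2 c w =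
     (\<integral>(x, y). (y - mf_g \<sigma> mu_c mu_W1 mu_W2 C W1 W2 x) * C c * deriv \<sigma> (mf_Z \<sigma> mu_W1 mu_W2 W1 W2 c x)
        * \<sigma> (W1 w \<bullet> x) \<partial>\<pi>)"

locale mf_data =
  fixes \<sigma> :: "real \<Rightarrow> real" and \<pi> :: "('a::euclidean_space \<times> real) measure"
    and mu_c :: "real measure" and mu_W1 :: "'a measure" and mu_W2 :: "real measure"
    and S Q :: real and CC :: "real set" and WW1 :: "'a set" and WW2 :: "real set"
  assumes prob: "prob_space \<pi>" "prob_space mu_c" "prob_space mu_W1" "prob_space mu_W2"
    and sets_pi: "sets \<pi> = sets borel"
    and sets_mu [measurable_cong]: "sets mu_c = sets borel"
      "sets mu_W1 = sets borel" "sets mu_W2 = sets borel"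
    and labels: "AE c in mu_c. c \<in> CC" "AE w in mu_W1. w \<in> WW1" "AE u in mu_W2. u \<in> WW2"
    and samples: "AE (x, y) in \<pi>. norm x \<le> Q \<and> \<bar>y\<bar> \<le> Q"
    and sigma_bound: "\<bar>\<sigma> z\<bar> \<le> S" "\<bar>deriv \<sigma> z\<bar> \<le> S"
    and sigma_lip: "\<bar>\<sigma> z - \<sigma> z'\<bar> \<le> S * \<bar>z - z'\<bar>" "\<bar>deriv \<sigma> z - deriv \<sigma> z'\<bar> \<le> S * \<bar>z - z'\<bar>"
    and Q_nonneg: "0 \<le> Q"
begin

sublocale P: prob_space \<pi> by (rule prob)
sublocale PC: prob_space mu_c by (rule prob)
sublocale PW1: prob_space mu_W1 by (rule prob)
sublocale PW2: prob_space mu_W2 by (rule prob)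

lemma sets_pi_pair [measurable_cong]: "sets \<pi> = sets (borel \<Otimes>\<^sub>M borel)"
  by (metis borel_prod sets_pi)

lemma S_nonneg: "0 \<le> S"
  using sigma_bound(1)[of 0] by linarith

lemma sigma_continuous: "continuous_on A \<sigma>" "continuous_on A (deriv \<sigma>)"
  using sigma_lip S_nonneg
  by (auto intro!: Lipschitz.lipschitz_on_continuous_on[of S] lipschitz_onI simp: dist_real_def)

lemma sigma_measurable [measurable]: "\<sigma> \<in> borel_measurable borel" "deriv \<sigma> \<in> borel_measurable borel"
  by (auto intro!: borel_measurable_continuous_onI sigma_continuous)

lemma lip_sigma:
  assumes "lip \<delta> A \<alpha> z z'"
  shows "lip \<delta> S (S * \<alpha>) (\<sigma> z) (\<sigma> z')" "lip \<delta> S (S * \<alpha>) (deriv \<sigma> z) (deriv \<sigma> z')"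
proof -
  have "S * \<bar>z - z'\<bar> \<le> S * \<alpha> * \<delta>"
    using assms S_nonneg by (auto simp: lip_def mult.assoc intro: mult_left_mono)
  then show "lip \<delta> S (S * \<alpha>) (\<sigma> z) (\<sigma> z')" "lip \<delta> S (S * \<alpha>) (deriv \<sigma> z) (deriv \<sigma> z')"
    using sigma_bound sigma_lip[of z z'] by (auto simp: lip_def)
qed

lemma sigma_inner_diff:
  assumes "norm x \<le> Q"
  shows "\<bar>\<sigma> (w \<bullet> x) - \<sigma> (w' \<bullet> x)\<bar> \<le> S * Q * norm (w - w')"
    "\<bar>deriv \<sigma> (w \<bullet> x) - deriv \<sigma> (w' \<bullet> x)\<bar> \<le> S * Q * norm (w - w')"
proof -
  have "\<bar>w \<bullet> x - w' \<bullet> x\<bar> \<le> norm (w - w') * norm x"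
    by (metis Cauchy_Schwarz_ineq2 inner_diff_left)
  also have "\<dots> \<le> norm (w - w') * Q" using assms by (intro mult_left_mono) auto
  finally have "S * \<bar>w \<bullet> x - w' \<bullet> x\<bar> \<le> S * Q * norm (w - w')"
    using S_nonneg by (metis mult.assoc mult.commute mult_left_mono)
  then show "\<bar>\<sigma> (w \<bullet> x) - \<sigma> (w' \<bullet> x)\<bar> \<le> S * Q * norm (w - w')"
    "\<bar>deriv \<sigma> (w \<bullet> x) - deriv \<sigma> (w' \<bullet> x)\<bar> \<le> S * Q * norm (w - w')"
    using sigma_lip[of "w \<bullet> x" "w' \<bullet> x"] by linarith+
qed

lemma lip_sigma_inner:
  assumes "norm x \<le> Q" "norm (w - w') \<le> \<delta>"
  shows "lip \<delta> S (S * Q) (\<sigma> (w \<bullet> x)) (\<sigma> (w' \<bullet> x))"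
    "lip \<delta> S (S * Q) (deriv \<sigma> (w \<bullet> x)) (deriv \<sigma> (w' \<bullet> x))"
proof -
  have "S * Q * norm (w - w') \<le> S * Q * \<delta>"
    using assms S_nonneg Q_nonneg by (intro mult_left_mono) auto
  then show "lip \<delta> S (S * Q) (\<sigma> (w \<bullet> x)) (\<sigma> (w' \<bullet> x))"
    "lip \<delta> S (S * Q) (deriv \<sigma> (w \<bullet> x)) (deriv \<sigma> (w' \<bullet> x))"
    using sigma_inner_diff[OF assms(1), of w w'] sigma_bound by (auto simp: lip_def)
qed

abbreviation "Zf \<equiv> mf_Z \<sigma> mu_W1 mu_W2"
abbreviation "Hf \<equiv> mf_H2 \<sigma> mu_W1 mu_W2"
abbreviation "gf \<equiv> mf_g \<sigma> mu_c mu_W1 mu_W2"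
abbreviation "Vf \<equiv> mf_V \<sigma> mu_c mu_W1 mu_W2"
abbreviation "rhsC \<equiv> mf_rhs_C \<sigma> \<pi> mu_c mu_W1 mu_W2"
abbreviation "rhsW1 \<equiv> mf_rhs_W1 \<sigma> \<pi> mu_c mu_W1 mu_W2"
abbreviation "rhsW2 \<equiv> mf_rhs_W2 \<sigma> \<pi> mu_c mu_W1 mu_W2"

definition family :: "real \<Rightarrow> (real \<Rightarrow> real) \<Rightarrow> ('a \<Rightarrow> 'a) \<Rightarrow> (real \<Rightarrow> 'a \<Rightarrow> real \<Rightarrow> real) \<Rightarrow> bool" where
  "family R C W1 W2 \<longleftrightarrow> C \<in> borel_measurable borel \<and> W1 \<in> borel_measurable borel \<and>
     (\<lambda>(c, w, u). W2 c w u) \<in> borel_measurable borel \<and>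
     (\<forall>c\<in>CC. \<bar>C c\<bar> \<le> R) \<and> (\<forall>c\<in>CC. \<forall>w\<in>WW1. \<forall>u\<in>WW2. \<bar>W2 c w u\<bar> \<le> R)"

definition close_fam where
  "close_fam \<delta> C W1 W2 C' W1' W2' \<longleftrightarrow>
    (\<forall>c\<in>CC. \<bar>C c - C' c\<bar> \<le> \<delta>) \<and> (\<forall>w\<in>WW1. norm (W1 w - W1' w) \<le> (\<delta>::real)) \<and>
    (\<forall>c\<in>CC. \<forall>w\<in>WW1. \<forall>u\<in>WW2. \<bar>W2 c w u - W2' c w u\<bar> \<le> \<delta>)"

context
  fixes C W1 W2 R assumes fam: "family R C W1 W2"
begin

lemma family_measurable:
  "C \<in> borel_measurable borel" "W1 \<in> borel_measurable borel"
  "\<lbrakk>f \<in> borel_measurable N; g \<in> borel_measurable N; h \<in> borel_measurable N\<rbrakk>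
     \<Longrightarrow> (\<lambda>p. W2 (f p) (g p) (h p)) \<in> borel_measurable N"
proof -
  show "(\<lambda>p. W2 (f p) (g p) (h p)) \<in> borel_measurable N"
    if [measurable]: "f \<in> borel_measurable N" "g \<in> borel_measurable N" "h \<in> borel_measurable N"
  proof -
    have "(\<lambda>(c, w, u). W2 c w u) \<in> borel_measurable (borel \<Otimes>\<^sub>M (borel \<Otimes>\<^sub>M borel))"
      using fam by (simp add: family_def borel_prod)
    from measurable_compose[OF _ this, of "\<lambda>p. (f p, g p, h p)" N] show ?thesis by simp
  qed
qed (use fam in \<open>auto simp: family_def\<close>)

lemma Zf_measurable:
  assumes [measurable]: "f \<in> borel_measurable N" "g \<in> borel_measurable N"
  shows "(\<lambda>p. Zf W1 W2 (f p) (g p)) \<in> borel_measurable N"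
  unfolding mf_Z_def using family_measurable[measurable] by measurable

lemma Hf_measurable:
  assumes [measurable]: "f \<in> borel_measurable N" "g \<in> borel_measurable N"
  shows "(\<lambda>p. Hf W1 W2 (f p) (g p)) \<in> borel_measurable N"
  unfolding mf_H2_def using Zf_measurable[measurable] by measurable

lemma gf_measurable:
  assumes [measurable]: "g \<in> borel_measurable N"
  shows "(\<lambda>p. gf C W1 W2 (g p)) \<in> borel_measurable N"
  unfolding mf_g_def using family_measurable[measurable] Hf_measurable[measurable] by measurable

lemma Vf_measurable:
  assumes [measurable]: "f \<in> borel_measurable N" "g \<in> borel_measurable N"
  shows "(\<lambda>p. Vf C W1 W2 (f p) (g p)) \<in> borel_measurable N"
  unfolding mf_V_def using family_measurable[measurable] Zf_measurable[measurable] by measurable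

end

definition "L_Z R = R * (S * Q) + S"
definition "L_g R = R * (S * L_Z R) + S"
definition "L_V R = (R * S) * 1 + R * (R * (S * L_Z R) + S)"
definition "L_W1 R =
  ((Q + R * S) * (R * S * R) * S) * 0 + Q * (((Q + R * S) * (R * S * R)) * (S * Q) +
     S * ((Q + R * S) * L_V R + (R * S * R) * (0 + L_g R)))"
definition "L_W2 R =
  ((Q + R * S) * R * S) * (S * Q) + S * (((Q + R * S) * R) * (S * L_Z R) +
     S * ((Q + R * S) * 1 + R * (0 + L_g R)))"
definition "L_C R = (Q + R * S) * (S * L_Z R) + S * (0 + L_g R)"
definition "L_rhs R = max (L_C R) (max (L_W1 R) (L_W2 R))"
definition "B_rhs R = max ((Q + R * S) * S) (max ((Q + R * S) * (R * S * R) * S * Q) ((Q + R * S) * R * S * S))"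

context
  fixes C W1 W2 C' W1' W2' R \<delta>
  assumes fam: "family R C W1 W2" and fam': "family R C' W1' W2'"
    and close: "close_fam \<delta> C W1 W2 C' W1' W2'"
begin

lemmas meas = family_measurable[OF fam] family_measurable[OF fam']
  Zf_measurable[OF fam] Zf_measurable[OF fam'] Hf_measurable[OF fam] Hf_measurable[OF fam']
  gf_measurable[OF fam] gf_measurable[OF fam'] Vf_measurable[OF fam] Vf_measurable[OF fam']

lemma lip_labels:
  "c \<in> CC \<Longrightarrow> lip \<delta> R 1 (C c) (C' c)"
  "c \<in> CC \<Longrightarrow> w \<in> WW1 \<Longrightarrow> u \<in> WW2 \<Longrightarrow> lip \<delta> R 1 (W2 c w u) (W2' c w u)"
  using fam fam' close by (auto simp: family_def close_fam_def lip_def)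

lemma norm_W1_diff: "w \<in> WW1 \<Longrightarrow> norm (W1 w - W1' w) \<le> \<delta>"
  using close by (auto simp: close_fam_def)

lemma lip_Z:
  assumes c: "c \<in> CC" and x: "norm x \<le> Q"
  shows "lip \<delta> (R * S) (L_Z R) (Zf W1 W2 c x) (Zf W1' W2' c x)"
  supply meas[measurable]
  unfolding mf_Z_def
proof (rule lip_integral[OF prob(3)], goal_cases)
  case 3
  show ?case using labels(2)
  proof eventually_elim
    case (elim w)
    have "AE u in mu_W2. lip \<delta> (R * S) (L_Z R) (W2 c w u * \<sigma> (W1 w \<bullet> x)) (W2' c w u * \<sigma> (W1' w \<bullet> x))"
      using labels(3)
    proof eventually_elim
      case (elim u)
      show ?case
        using lip_mult[OF lip_labels(2)[OF c \<open>w \<in> WW1\<close> elim] lip_sigma_inner(1)[OF x norm_W1_diff[OF \<open>w \<in> WW1\<close>]]]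
        by (simp add: L_Z_def)
    qed
    then show ?case by (intro lip_integral[OF prob(4)]) measurable
  qed
qed measurable

lemma lip_g:
  assumes x: "norm x \<le> Q"
  shows "lip \<delta> (R * S) (L_g R) (gf C W1 W2 x) (gf C' W1' W2' x)"
  supply meas[measurable]
  unfolding mf_g_def
proof (rule lip_integral[OF prob(2)], goal_cases)
  case 3
  show ?case using labels(1)
  proof eventually_elim
    case (elim c)
    then show ?case
      using lip_mult[OF lip_labels(1)[OF elim] lip_sigma(1)[OF lip_Z[OF elim x]]]
      by (simp add: L_g_def mf_H2_def)
  qed
qed measurable

lemma lip_V:
  assumes w: "w \<in> WW1" and x: "norm x \<le> Q"
  shows "lip \<delta> (R * S * R) (L_V R) (Vf C W1 W2 w x) (Vf C' W1' W2' w x)"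
  supply meas[measurable]
  unfolding mf_V_def
proof (rule lip_integral[OF prob(2)], goal_cases)
  case 3
  show ?case using labels(1)
  proof eventually_elim
    case (elim c)
    have "AE u in mu_W2. lip \<delta> R 1 (W2 c w u) (W2' c w u)"
      using labels(3) lip_labels(2)[OF elim w] by auto
    then have "lip \<delta> R 1 (\<integral>u. W2 c w u \<partial>mu_W2) (\<integral>u. W2' c w u \<partial>mu_W2)"
      by (intro lip_integral[OF prob(4)]) measurable
    from lip_mult[OF lip_mult[OF lip_labels(1)[OF elim] lip_sigma(2)[OF lip_Z[OF elim x]]] this]
    show ?case by (simp add: L_V_def)
  qed
qed measurable

lemma lip_residual:
  assumes "norm x \<le> Q" "\<bar>y\<bar> \<le> Q"
  shows "lip \<delta> (Q + R * S) (0 + L_g R) (y - gf C W1 W2 x) (y - gf C' W1' W2' x)"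
  using assms by (intro lip_diff lip_const lip_g) auto

lemma lip_rhs_C_integrand:
  assumes c: "c \<in> CC" and p: "norm x \<le> Q" "\<bar>y\<bar> \<le> Q"
  shows "lip \<delta> ((Q + R * S) * S) (L_C R)
    ((y - gf C W1 W2 x) * Hf W1 W2 c x) ((y - gf C' W1' W2' x) * Hf W1' W2' c x)"
  using lip_mult[OF lip_residual[OF p] lip_sigma(1)[OF lip_Z[OF c p(1)]]]
  by (simp add: L_C_def mf_H2_def)

lemma lip_rhs_W1_integrand:
  assumes w: "w \<in> WW1" and p: "norm x \<le> Q" "\<bar>y\<bar> \<le> Q"
  shows "lip \<delta> ((Q + R * S) * (R * S * R) * S * Q) (L_W1 R)
    (((y - gf C W1 W2 x) * Vf C W1 W2 w x * deriv \<sigma> (W1 w \<bullet> x)) *\<^sub>R x)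
    (((y - gf C' W1' W2' x) * Vf C' W1' W2' w x * deriv \<sigma> (W1' w \<bullet> x)) *\<^sub>R x)"
  unfolding L_W1_def
  by (intro lip_scaleR lip_mult lip_residual lip_V lip_sigma_inner lip_const norm_W1_diff w p)

lemma lip_rhs_W2_integrand:
  assumes c: "c \<in> CC" and w: "w \<in> WW1" and p: "norm x \<le> Q" "\<bar>y\<bar> \<le> Q"
  shows "lip \<delta> ((Q + R * S) * R * S * S) (L_W2 R)
    ((y - gf C W1 W2 x) * C c * deriv \<sigma> (Zf W1 W2 c x) * \<sigma> (W1 w \<bullet> x))
    ((y - gf C' W1' W2' x) * C' c * deriv \<sigma> (Zf W1' W2' c x) * \<sigma> (W1' w \<bullet> x))"
  unfolding L_W2_def
  by (intro lip_mult lip_residual lip_labels lip_sigma(2)[OF lip_Z[OF c p(1)]] lip_sigma_inner norm_W1_diff c w p)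

lemma lip_rhs:
  assumes "0 \<le> \<delta>"
  shows "c \<in> CC \<Longrightarrow> lip \<delta> (B_rhs R) (L_rhs R) (rhsC C W1 W2 c) (rhsC C' W1' W2' c)"
    "w \<in> WW1 \<Longrightarrow> lip \<delta> (B_rhs R) (L_rhs R) (rhsW1 C W1 W2 w) (rhsW1 C' W1' W2' w)"
    "c \<in> CC \<Longrightarrow> w \<in> WW1 \<Longrightarrow> lip \<delta> (B_rhs R) (L_rhs R) (rhsW2 C W1 W2 c w) (rhsW2 C' W1' W2' c w)"
proof -
  note meas [measurable]
  have weaken: "lip \<delta> (B_rhs R) (L_rhs R) z z'"
    if "lip \<delta> A \<alpha> z z'" "A \<le> B_rhs R" "\<alpha> \<le> L_rhs R" for A \<alpha> and z z' :: "'z::real_normed_vector"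
    using that mult_right_mono[OF that(3) assms] unfolding lip_def by linarith
  show "lip \<delta> (B_rhs R) (L_rhs R) (rhsC C W1 W2 c) (rhsC C' W1' W2' c)" if "c \<in> CC"
    unfolding mf_rhs_C_def
    by (rule weaken, rule lip_integral[OF prob(1)], measurable)
      (use samples lip_rhs_C_integrand[OF that] in \<open>auto simp: L_rhs_def B_rhs_def elim!: eventually_mono\<close>)
  show "lip \<delta> (B_rhs R) (L_rhs R) (rhsW1 C W1 W2 w) (rhsW1 C' W1' W2' w)" if "w \<in> WW1"
    unfolding mf_rhs_W1_def
    by (rule weaken, rule lip_integral[OF prob(1)], measurable)
      (use samples lip_rhs_W1_integrand[OF that] in \<open>auto simp: L_rhs_def B_rhs_def elim!: eventually_mono\<close>)
  show "lip \<delta> (B_rhs R) (L_rhs R) (rhsW2 C W1 W2 c w) (rhsW2 C' W1' W2' c w)" if "c \<in> CC" "w \<in> WW1"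
    unfolding mf_rhs_W2_def
    by (rule weaken, rule lip_integral[OF prob(1)], measurable)
      (use samples lip_rhs_W2_integrand[OF that] in \<open>auto simp: L_rhs_def B_rhs_def elim!: eventually_mono\<close>)
qed

end

lemma L_rhs_nonneg: "0 \<le> R \<Longrightarrow> 0 \<le> L_rhs R"
  using S_nonneg Q_nonneg by (auto simp: L_rhs_def L_C_def L_Z_def L_g_def le_max_iff_disj)

lemma B_rhs_nonneg: "0 \<le> R \<Longrightarrow> 0 \<le> B_rhs R"
  using S_nonneg Q_nonneg by (auto simp: B_rhs_def le_max_iff_disj)

lemma close_fam_refl: "0 \<le> \<delta> \<Longrightarrow> close_fam \<delta> C W1 W2 C W1 W2"
  by (simp add: close_fam_def)

end

section \<open>Uniqueness of the mean-field system\<close>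

lemma (in prob_space) norm_integral_le_const:
  fixes h :: "'a \<Rightarrow> 'b::{banach, second_countable_topology}"
  assumes "AE x in M. norm (h x) \<le> B"
  shows "norm (\<integral>x. h x \<partial>M) \<le> B"
proof (cases "integrable M h")
  case True
  have "norm (\<integral>x. h x \<partial>M) \<le> (\<integral>x. norm (h x) \<partial>M)" by (rule integral_norm_bound)
  also have "\<dots> \<le> (\<integral>x. B \<partial>M)" using True assms by (intro integral_mono_AE) auto
  finally show ?thesis by (simp add: prob_space)
next
  case False
  have "AE x in M. 0 \<le> B" using assms by eventually_elim (use norm_ge_zero order_trans in blast)
  then show ?thesis using False by (simp add: not_integrable_integral_eq)
qed

lemma norm_diff_le_of_derivative:
  fixes f :: "real \<Rightarrow> 'b::real_normed_vector"
  assumes f: "\<And>t. t \<in> {0..1} \<Longrightarrow> (f has_vector_derivative f' t) (at t within {0..1})"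
    and \<phi>: "\<And>t. t \<in> {0..1} \<Longrightarrow> (\<phi> has_real_derivative \<phi>' t) (at t within {0..1})"
    and le: "\<And>u. u \<in> {s..t} \<Longrightarrow> norm (f' u) \<le> \<phi>' u"
    and st: "0 \<le> s" "s \<le> t" "t \<le> 1"
  shows "norm (f t - f s) \<le> \<phi> t - \<phi> s"
proof (cases "s = t")
  case False
  have "continuous_on {0..1} f" "continuous_on {0..1} \<phi>"
    using f \<phi> unfolding continuous_on_eq_continuous_within
    by (metis has_vector_derivative_continuous, metis DERIV_continuous)
  then have c: "continuous_on {s..t} f" "continuous_on {s..t} \<phi>"
    using st by (auto intro: continuous_on_subset)
  have at: "at x within {0..1} = at x" if "s < x" "x < t" for x
    using that st by (intro at_within_Icc_at) auto
  show ?thesis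
  proof (rule differentiable_bound_general[OF _ c, where f' = f' and \<phi>' = \<phi>'])
    show "s < t" using False st by simp
    fix x assume x: "s < x" "x < t"
    then have x': "x \<in> {0..1}" using st by simp
    show "(f has_vector_derivative f' x) (at x)" using f[OF x'] at[OF x] by simp
    show "(\<phi> has_vector_derivative \<phi>' x) (at x)"
      using \<phi>[OF x'] at[OF x] by (simp add: has_real_derivative_iff_has_vector_derivative)
    show "norm (f' x) \<le> \<phi>' x" using le x by simp
  qed
qed simp

lemma continuous_on_integral_param:
  fixes f :: "'p::metric_space \<Rightarrow> 'x \<Rightarrow> 'b::{banach, second_countable_topology}"
  assumes "prob_space \<mu>" and [measurable]: "\<And>p. f p \<in> borel_measurable \<mu>"
    and bound: "\<And>p. AE x in \<mu>. norm (f p x) \<le> B"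
    and cont: "\<And>x. continuous_on UNIV (\<lambda>p. f p x)"
  shows "continuous_on UNIV (\<lambda>p. \<integral>x. f p x \<partial>\<mu>)"
proof -
  interpret prob_space \<mu> by fact
  show ?thesis
  proof (unfold continuous_on_sequentially, intro ballI allI impI, elim conjE)
    fix X a assume "(X::nat \<Rightarrow> 'p) \<longlonglongrightarrow> a"
    then have "(\<lambda>n. f (X n) x) \<longlonglongrightarrow> f a x" for x
      using cont[of x] by (auto simp: continuous_on_sequentially o_def)
    then have "(\<lambda>n. \<integral>x. f (X n) x \<partial>\<mu>) \<longlonglongrightarrow> (\<integral>x. f a x \<partial>\<mu>)"
      by (intro integral_dominated_convergence[where w = "\<lambda>_. B"] bound) auto
    then show "((\<lambda>p. \<integral>x. f p x \<partial>\<mu>) \<circ> X) \<longlonglongrightarrow> (\<integral>x. f a x \<partial>\<mu>)"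
      by (simp add: o_def)
  qed
qed

context mf_data begin

lemma mf_solution_iff:
  "mf_solution \<sigma> \<pi> mu_c mu_W1 mu_W2 CC WW1 WW2 C W1 W2 \<longleftrightarrow>
     (\<forall>t\<in>{0..1}. C t \<in> borel_measurable borel \<and> W1 t \<in> borel_measurable borel \<and>
        (\<lambda>(c, w, u). W2 t c w u) \<in> borel_measurable borel) \<and>
     (\<exists>B. \<forall>t\<in>{0..1}. \<forall>c\<in>CC. \<forall>w\<in>WW1. \<forall>u\<in>WW2.
        \<bar>C t c\<bar> \<le> B \<and> norm (W1 t w) \<le> B \<and> \<bar>W2 t c w u\<bar> \<le> B) \<and>
     (\<forall>c\<in>CC. C 0 c = c \<and> (\<forall>t\<in>{0..1}.
        ((\<lambda>s. C s c) has_vector_derivative rhsC (C t) (W1 t) (W2 t) c) (at t within {0..1}))) \<and>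
     (\<forall>w\<in>WW1. W1 0 w = w \<and> (\<forall>t\<in>{0..1}.
        ((\<lambda>s. W1 s w) has_vector_derivative rhsW1 (C t) (W1 t) (W2 t) w) (at t within {0..1}))) \<and>
     (\<forall>c\<in>CC. \<forall>w\<in>WW1. \<forall>u\<in>WW2. W2 0 c w u = u \<and> (\<forall>t\<in>{0..1}.
        ((\<lambda>s. W2 s c w u) has_vector_derivative rhsW2 (C t) (W1 t) (W2 t) c w) (at t within {0..1})))"
  unfolding mf_solution_def mf_rhs_C_def mf_rhs_W1_def mf_rhs_W2_def
    has_real_derivative_iff_has_vector_derivative ..

theorem mf_solution_unique:
  assumes sol: "mf_solution \<sigma> \<pi> mu_c mu_W1 mu_W2 CC WW1 WW2 C W1 W2"
    and sol': "mf_solution \<sigma> \<pi> mu_c mu_W1 mu_W2 CC WW1 WW2 C' W1' W2'"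
    and ne: "CC \<noteq> {}" "WW1 \<noteq> {}" "WW2 \<noteq> {}"
    and t: "t \<in> {0..1}"
  shows "close_fam 0 (C t) (W1 t) (W2 t) (C' t) (W1' t) (W2' t)"
proof -
  note s = sol[unfolded mf_solution_iff] and s' = sol'[unfolded mf_solution_iff]
  have d: "c \<in> CC \<Longrightarrow> ((\<lambda>s. C s c) has_vector_derivative rhsC (C t) (W1 t) (W2 t) c) (at t within {0..1})"
    "w \<in> WW1 \<Longrightarrow> ((\<lambda>s. W1 s w) has_vector_derivative rhsW1 (C t) (W1 t) (W2 t) w) (at t within {0..1})"
    "\<lbrakk>c \<in> CC; w \<in> WW1; u \<in> WW2\<rbrakk> \<Longrightarrow>
      ((\<lambda>s. W2 s c w u) has_vector_derivative rhsW2 (C t) (W1 t) (W2 t) c w) (at t within {0..1})"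
    "c \<in> CC \<Longrightarrow> ((\<lambda>s. C' s c) has_vector_derivative rhsC (C' t) (W1' t) (W2' t) c) (at t within {0..1})"
    "w \<in> WW1 \<Longrightarrow> ((\<lambda>s. W1' s w) has_vector_derivative rhsW1 (C' t) (W1' t) (W2' t) w) (at t within {0..1})"
    "\<lbrakk>c \<in> CC; w \<in> WW1; u \<in> WW2\<rbrakk> \<Longrightarrow>
      ((\<lambda>s. W2' s c w u) has_vector_derivative rhsW2 (C' t) (W1' t) (W2' t) c w) (at t within {0..1})"
    if "t \<in> {0..1}" for t c w u
    using s s' that by simp_all
  have init: "c \<in> CC \<Longrightarrow> C 0 c = C' 0 c" "w \<in> WW1 \<Longrightarrow> W1 0 w = W1' 0 w"
    "\<lbrakk>c \<in> CC; w \<in> WW1; u \<in> WW2\<rbrakk> \<Longrightarrow> W2 0 c w u = W2' 0 c w u" for c w u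
    using s s' by simp_all
  obtain B where B: "\<forall>t\<in>{0..1}. \<forall>c\<in>CC. \<forall>w\<in>WW1. \<forall>u\<in>WW2.
      \<bar>C t c\<bar> \<le> B \<and> norm (W1 t w) \<le> B \<and> \<bar>W2 t c w u\<bar> \<le> B"
    using s[THEN conjunct2, THEN conjunct1] by (rule exE)
  obtain B' where B': "\<forall>t\<in>{0..1}. \<forall>c\<in>CC. \<forall>w\<in>WW1. \<forall>u\<in>WW2.
      \<bar>C' t c\<bar> \<le> B' \<and> norm (W1' t w) \<le> B' \<and> \<bar>W2' t c w u\<bar> \<le> B'"
    using s'[THEN conjunct2, THEN conjunct1] by (rule exE)
  define R where "R = max 0 (max B B')"
  have R: "0 \<le> R" "B \<le> R" "B' \<le> R" by (auto simp: R_def)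
  from ne obtain c0 w0 u0 where ne': "c0 \<in> CC" "w0 \<in> WW1" "u0 \<in> WW2" by blast
  have bd: "\<bar>C t c\<bar> \<le> R" "\<bar>C' t c\<bar> \<le> R" "norm (W1 t w) \<le> R" "norm (W1' t w) \<le> R"
    "\<bar>W2 t c w u\<bar> \<le> R" "\<bar>W2' t c w u\<bar> \<le> R"
    if "t \<in> {0..1}" "c \<in> CC" "w \<in> WW1" "u \<in> WW2" for t c w u
    using B[rule_format, OF that] B'[rule_format, OF that] R by linarith+
  have fam: "family R (C t) (W1 t) (W2 t)" "family R (C' t) (W1' t) (W2' t)" if "t \<in> {0..1}" for t
  proof -
    have "\<forall>c\<in>CC. \<bar>C t c\<bar> \<le> R" "\<forall>c\<in>CC. \<bar>C' t c\<bar> \<le> R"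
      using bd(1,2)[OF that _ ne'(2,3)] by simp_all
    moreover have "\<forall>c\<in>CC. \<forall>w\<in>WW1. \<forall>u\<in>WW2. \<bar>W2 t c w u\<bar> \<le> R"
      "\<forall>c\<in>CC. \<forall>w\<in>WW1. \<forall>u\<in>WW2. \<bar>W2' t c w u\<bar> \<le> R"
      using bd(5,6)[OF that] by simp_all
    ultimately show "family R (C t) (W1 t) (W2 t)" "family R (C' t) (W1' t) (W2' t)"
      using s[THEN conjunct1, rule_format, OF that] s'[THEN conjunct1, rule_format, OF that]
      by (simp_all only: family_def simp_thms)
  qed
  define L where "L = L_rhs R"
  define \<delta> where "\<delta> n t = 2 * R * L ^ n / fact n * t ^ n" for n and t :: real
  have L: "0 \<le> L" using L_rhs_nonneg R by (simp add: L_def)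
  have \<delta>_nonneg: "0 \<le> \<delta> n t" if "t \<in> {0..1}" for n t
    using that L R by (auto simp: \<delta>_def)
  have \<delta>_deriv: "(\<delta> (Suc n) has_real_derivative L * \<delta> n t) (at t within X)" for n t X
  proof -
    have "2 * R * L ^ Suc n / fact (Suc n) * (real (Suc n) * t ^ n) =
        2 * R * L ^ Suc n * t ^ n * (real (Suc n) / fact (Suc n))"
      by (simp only: times_divide_eq_left times_divide_eq_right mult.assoc mult.commute)
    also have "real (Suc n) / fact (Suc n) = 1 / (fact n :: real)"
      by (simp add: fact_Suc del: of_nat_Suc)
    finally have "2 * R * L ^ Suc n / fact (Suc n) * (real (Suc n) * t ^ n) = L * \<delta> n t"
      by (simp add: \<delta>_def mult.assoc mult.left_commute)
    moreover have "((\<lambda>t. 2 * R * L ^ Suc n / fact (Suc n) * t ^ Suc n) has_real_derivative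
        2 * R * L ^ Suc n / fact (Suc n) * (real (Suc n) * t ^ n)) (at t within X)"
      by (rule DERIV_cmult) (use DERIV_pow[of "Suc n" t X] in \<open>simp only: diff_Suc_Suc diff_zero\<close>)
    ultimately show ?thesis unfolding \<delta>_def[of "Suc n"] by (simp only:)
  qed
  have \<delta>_0: "\<delta> (Suc n) 0 = 0" for n by (simp add: \<delta>_def)
  have close: "close_fam (\<delta> n t) (C t) (W1 t) (W2 t) (C' t) (W1' t) (W2' t)" if "t \<in> {0..1}" for n t
    using that
  proof (induction n arbitrary: t)
    case 0
    have "\<bar>C t c - C' t c\<bar> \<le> 2 * R" "norm (W1 t w - W1' t w) \<le> 2 * R" "\<bar>W2 t c w u - W2' t c w u\<bar> \<le> 2 * R"
      if "c \<in> CC" "w \<in> WW1" "u \<in> WW2" for c w u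
      using bd[OF 0 that] norm_triangle_ineq4[of "W1 t w" "W1' t w"] by linarith+
    then show ?case using ne' by (auto simp: close_fam_def \<delta>_def)
  next
    case (Suc n)
    have step: "norm (f t - f' t) \<le> \<delta> (Suc n) t"
      if F: "\<And>s. s \<in> {0..1} \<Longrightarrow> (f has_vector_derivative F s) (at s within {0..1})"
        "\<And>s. s \<in> {0..1} \<Longrightarrow> (f' has_vector_derivative F' s) (at s within {0..1})"
        and lip: "\<And>s. s \<in> {0..1} \<Longrightarrow> lip (\<delta> n s) A L (F s) (F' s)"
        and "f 0 = f' 0"
      for f f' F F' :: "real \<Rightarrow> 'z::real_normed_vector" and A
    proof -
      have "norm ((f t - f' t) - (f 0 - f' 0)) \<le> \<delta> (Suc n) t - \<delta> (Suc n) 0"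
        by (rule norm_diff_le_of_derivative[where f = "\<lambda>t. f t - f' t" and f' = "\<lambda>t. F t - F' t"
              and \<phi>' = "\<lambda>t. L * \<delta> n t", OF has_vector_derivative_diff[OF F] \<delta>_deriv])
          (use lip Suc.prems in \<open>auto simp: lip_def\<close>)
      then show ?thesis using that \<delta>_0 by simp
    qed
    have lips: "c \<in> CC \<Longrightarrow> lip (\<delta> n s) (B_rhs R) L (rhsC (C s) (W1 s) (W2 s) c) (rhsC (C' s) (W1' s) (W2' s) c)"
      "w \<in> WW1 \<Longrightarrow> lip (\<delta> n s) (B_rhs R) L (rhsW1 (C s) (W1 s) (W2 s) w) (rhsW1 (C' s) (W1' s) (W2' s) w)"
      "c \<in> CC \<Longrightarrow> w \<in> WW1 \<Longrightarrow> lip (\<delta> n s) (B_rhs R) L (rhsW2 (C s) (W1 s) (W2 s) c w) (rhsW2 (C' s) (W1' s) (W2' s) c w)"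
      if "s \<in> {0..1}" for s c w
      unfolding L_def by (rule lip_rhs[OF fam[OF that] Suc.IH[OF that] \<delta>_nonneg[OF that]]; assumption)+
    show ?case unfolding close_fam_def
    proof (intro conjI ballI)
      fix c assume c: "c \<in> CC"
      show "\<bar>C t c - C' t c\<bar> \<le> \<delta> (Suc n) t"
        using step[OF d(1)[OF _ c] d(4)[OF _ c] lips(1)[OF _ c] init(1)[OF c]] by simp
    next
      fix w assume w: "w \<in> WW1"
      show "norm (W1 t w - W1' t w) \<le> \<delta> (Suc n) t"
        using step[OF d(2)[OF _ w] d(5)[OF _ w] lips(2)[OF _ w] init(2)[OF w]] .
    next
      fix c w u assume c: "c \<in> CC" "w \<in> WW1" "u \<in> WW2"
      show "\<bar>W2 t c w u - W2' t c w u\<bar> \<le> \<delta> (Suc n) t"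
        using step[OF d(3)[OF _ c] d(6)[OF _ c] lips(3)[OF _ c(1,2)] init(3)[OF c]] by simp
    qed
  qed
  have "(\<lambda>n. inverse (fact n) * (L * t) ^ n) \<longlonglongrightarrow> 0"
    by (rule summable_LIMSEQ_zero[OF summable_exp])
  then have "(\<lambda>n. 2 * R * (inverse (fact n) * (L * t) ^ n)) \<longlonglongrightarrow> 2 * R * 0"
    by (intro tendsto_intros)
  then have lim: "(\<lambda>n. \<delta> n t) \<longlonglongrightarrow> 0"
    by (simp add: \<delta>_def divide_inverse power_mult_distrib mult_ac)
  have le_0: "a \<le> 0" if "\<And>n. a \<le> \<delta> n t" for a
    using that by (intro LIMSEQ_le_const[OF lim]) auto
  note close' = close[OF t, unfolded close_fam_def]
  show ?thesis unfolding close_fam_def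
  proof (intro conjI ballI le_0)
    fix c n assume "c \<in> CC"
    then show "\<bar>C t c - C' t c\<bar> \<le> \<delta> n t" using close'[of n] by blast
  next
    fix w n assume "w \<in> WW1"
    then show "norm (W1 t w - W1' t w) \<le> \<delta> n t" using close'[of n] by blast
  next
    fix c w u n assume "c \<in> CC" "w \<in> WW1" "u \<in> WW2"
    then show "\<bar>W2 t c w u - W2' t c w u\<bar> \<le> \<delta> n t" using close'[of n] by blast
  qed
qed

end

locale mf_data_total = mf_data \<sigma> \<pi> mu_c mu_W1 mu_W2 S Q UNIV UNIV UNIV
  for \<sigma> :: "real \<Rightarrow> real" and \<pi> :: "('a::euclidean_space \<times> real) measure"
    and mu_c mu_W1 mu_W2 S Q
begin

lemma abs_gf_le:
  assumes "\<And>c. \<bar>C c\<bar> \<le> r"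
  shows "\<bar>gf C W1 W2 x\<bar> \<le> r * S"
proof -
  have "norm (C c * Hf W1 W2 c x) \<le> r * S" for c
    using assms[of c] sigma_bound(1) by (auto simp: mf_H2_def abs_mult intro!: mult_mono)
  then show ?thesis unfolding mf_g_def
    using PC.norm_integral_le_const[of "\<lambda>c. C c * Hf W1 W2 c x" "r * S"] by simp
qed

lemma rhs_le:
  assumes "\<And>c. \<bar>C c\<bar> \<le> r"
  shows "\<bar>rhsC C W1 W2 c\<bar> \<le> (Q + r * S) * S" "\<bar>rhsW2 C W1 W2 c w\<bar> \<le> (Q + r * S) * r * S * S"
proof -
  have r: "0 \<le> r" using assms[of 0] by linarith
  have 1: "\<bar>y - gf C W1 W2 x\<bar> \<le> Q + r * S" if "\<bar>y\<bar> \<le> Q" for x y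
    using abs_gf_le[of C r W1 W2 x, OF assms] that by linarith
  have "norm (case p of (x, y) \<Rightarrow> (y - gf C W1 W2 x) * Hf W1 W2 c x) \<le> (Q + r * S) * S"
    if "case p of (x, y) \<Rightarrow> norm x \<le> Q \<and> \<bar>y\<bar> \<le> Q" for p
    using that 1 sigma_bound S_nonneg Q_nonneg r
    by (auto simp: abs_mult mf_H2_def split: prod.splits intro!: mult_mono)
  then have "AE p in \<pi>. norm (case p of (x, y) \<Rightarrow> (y - gf C W1 W2 x) * Hf W1 W2 c x) \<le> (Q + r * S) * S"
    using samples by (auto elim: eventually_mono)
  from P.norm_integral_le_const[OF this] show "\<bar>rhsC C W1 W2 c\<bar> \<le> (Q + r * S) * S"
    unfolding mf_rhs_C_def by simp
  have "norm (case p of (x, y) \<Rightarrow> (y - gf C W1 W2 x) * C c * deriv \<sigma> (Zf W1 W2 c x) * \<sigma> (W1 w \<bullet> x))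
      \<le> (Q + r * S) * r * S * S"
    if "case p of (x, y) \<Rightarrow> norm x \<le> Q \<and> \<bar>y\<bar> \<le> Q" for p
    using that 1 sigma_bound S_nonneg Q_nonneg r assms
    by (auto simp: abs_mult split: prod.splits intro!: mult_mono)
  then have "AE p in \<pi>. norm (case p of (x, y) \<Rightarrow> (y - gf C W1 W2 x) * C c * deriv \<sigma> (Zf W1 W2 c x) * \<sigma> (W1 w \<bullet> x))
      \<le> (Q + r * S) * r * S * S"
    using samples by (auto elim: eventually_mono)
  from P.norm_integral_le_const[OF this] show "\<bar>rhsW2 C W1 W2 c w\<bar> \<le> (Q + r * S) * r * S * S"
    unfolding mf_rhs_W2_def by simp
qed

context
  fixes C :: "real \<Rightarrow> real \<Rightarrow> real" and W1 :: "real \<Rightarrow> 'a \<Rightarrow> 'a" and W2 :: "real \<Rightarrow> real \<Rightarrow> 'a \<Rightarrow> real \<Rightarrow> real"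
    and R :: real
  assumes C_cont: "continuous_on UNIV (\<lambda>(t, c). C t c)"
    and W1_cont: "continuous_on UNIV (\<lambda>(t, w). W1 t w)"
    and W2_cont: "continuous_on UNIV (\<lambda>(t, c, w, u). W2 t c w u)"
    and bounds: "\<bar>C t c\<bar> \<le> R" "\<bar>W2 t c w u\<bar> \<le> R"
begin

lemma C_cont':
  assumes "continuous_on UNIV f" "continuous_on UNIV g"
  shows "continuous_on UNIV (\<lambda>p. C (f p) (g p))"
  using continuous_on_compose2[OF C_cont continuous_on_Pair[OF assms]] by simp

lemma W1_cont':
  assumes "continuous_on UNIV f" "continuous_on UNIV g"
  shows "continuous_on UNIV (\<lambda>p. W1 (f p) (g p))"
  using continuous_on_compose2[OF W1_cont continuous_on_Pair[OF assms]] by simp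

lemma W2_cont':
  assumes "continuous_on UNIV f" "continuous_on UNIV g" "continuous_on UNIV h" "continuous_on UNIV k"
  shows "continuous_on UNIV (\<lambda>p. W2 (f p) (g p) (h p) (k p))"
  using continuous_on_compose2[OF W2_cont continuous_on_Pair[OF assms(1)
    continuous_on_Pair[OF assms(2) continuous_on_Pair[OF assms(3,4)]]]] by simp

lemma family_slice: "family R (C t) (W1 t) (W2 t)"
proof -
  have "continuous_on UNIV (C t)" "continuous_on UNIV (W1 t)"
    "continuous_on UNIV (\<lambda>p. W2 t (fst p) (fst (snd p)) (snd (snd p)))"
    using C_cont'[of "\<lambda>_. t" "\<lambda>c. c"] W1_cont'[of "\<lambda>_. t" "\<lambda>c. c"]
    by (auto intro!: W2_cont' continuous_intros)
  then show ?thesis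
    using bounds by (auto simp: family_def split_beta' intro!: borel_measurable_continuous_onI)
qed

lemma sigma_cont':
  "continuous_on UNIV f \<Longrightarrow> continuous_on UNIV (\<lambda>p. \<sigma> (f p))"
  "continuous_on UNIV f \<Longrightarrow> continuous_on UNIV (\<lambda>p. deriv \<sigma> (f p))"
  by (auto intro: continuous_on_compose2[OF sigma_continuous(1)] continuous_on_compose2[OF sigma_continuous(2)])

lemma R_nonneg: "0 \<le> R" using bounds(1)[of 0 0] by linarith

lemmas slice_meas = family_measurable[OF family_slice] Zf_measurable[OF family_slice]
  Hf_measurable[OF family_slice] gf_measurable[OF family_slice] Vf_measurable[OF family_slice]

lemma Z_cont:
  fixes f g :: "'p::metric_space \<Rightarrow> _"
  assumes f: "continuous_on UNIV f" and g: "continuous_on UNIV g" and h: "continuous_on UNIV h"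
  shows "continuous_on UNIV (\<lambda>p. Zf (W1 (f p)) (W2 (f p)) (g p) (h p))"
proof -
  note slice_meas [measurable]
  have le: "norm (W2 t c w u * \<sigma> z) \<le> R * S" for t c w u z
    using bounds(2)[of t c w u] sigma_bound(1)[of z] R_nonneg by (auto simp: abs_mult intro!: mult_mono)
  have "continuous_on UNIV (\<lambda>p. \<integral>u. W2 (f p) (g p) w u * \<sigma> (W1 (f p) w \<bullet> h p) \<partial>mu_W2)" for w
    by (rule continuous_on_integral_param[OF prob(4), where B = "R * S"])
      (auto intro!: continuous_intros W2_cont' W1_cont' sigma_cont' f g h le[simplified])
  moreover have "norm (\<integral>u. W2 (f p) (g p) w u * \<sigma> (W1 (f p) w \<bullet> h p) \<partial>mu_W2) \<le> R * S" for p w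
    by (rule PW2.norm_integral_le_const) (use le in simp)
  ultimately show ?thesis unfolding mf_Z_def
    by (intro continuous_on_integral_param[OF prob(3), where B = "R * S"]) auto
qed

lemma H_cont:
  fixes f g :: "'p::metric_space \<Rightarrow> _"
  assumes "continuous_on UNIV f" "continuous_on UNIV g" "continuous_on UNIV h"
  shows "continuous_on UNIV (\<lambda>p. Hf (W1 (f p)) (W2 (f p)) (g p) (h p))"
  unfolding mf_H2_def by (intro sigma_cont' Z_cont assms)

lemma g_cont:
  fixes f :: "'p::metric_space \<Rightarrow> _"
  assumes f: "continuous_on UNIV f" and h: "continuous_on UNIV h"
  shows "continuous_on UNIV (\<lambda>p. gf (C (f p)) (W1 (f p)) (W2 (f p)) (h p))"
proof -
  note slice_meas [measurable]
  have "norm (C t c * Hf (W1 t) (W2 t) c x) \<le> R * S" for t c x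
    using bounds(1)[of t c] sigma_bound(1) R_nonneg by (auto simp: abs_mult mf_H2_def intro!: mult_mono)
  then show ?thesis unfolding mf_g_def
    by (intro continuous_on_integral_param[OF prob(2), where B = "R * S"])
      (auto intro!: continuous_intros C_cont' H_cont f h)
qed

lemma mean_W2_le: "norm (\<integral>u. W2 t c w u \<partial>mu_W2) \<le> R"
  using PW2.norm_integral_le_const[of "W2 t c w" R] bounds(2) by simp

lemma V_integrand_le: "norm (C t c * deriv \<sigma> z * (\<integral>u. W2 t' c' w u \<partial>mu_W2)) \<le> R * S * R"
  using bounds(1)[of t c] sigma_bound(2) R_nonneg mean_W2_le[of t' c' w] S_nonneg
  by (auto simp: abs_mult intro!: mult_mono)

lemma V_cont:
  fixes f :: "'p::metric_space \<Rightarrow> _"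
  assumes f: "continuous_on UNIV f" and g: "continuous_on UNIV g" and h: "continuous_on UNIV h"
  shows "continuous_on UNIV (\<lambda>p. Vf (C (f p)) (W1 (f p)) (W2 (f p)) (g p) (h p))"
proof -
  note slice_meas [measurable]
  have "continuous_on UNIV (\<lambda>p. \<integral>u. W2 (f p) c (g p) u \<partial>mu_W2)" for c
    by (rule continuous_on_integral_param[OF prob(4), where B = R])
      (use bounds(2) in \<open>auto intro!: continuous_intros W2_cont' f g\<close>)
  then show ?thesis unfolding mf_V_def using V_integrand_le
    by (intro continuous_on_integral_param[OF prob(2), where B = "R * S * R"])
      (auto intro!: continuous_intros C_cont' sigma_cont' Z_cont f h)
qed

lemma rhs_cont:
  fixes f :: "'p::metric_space \<Rightarrow> _"
  assumes f: "continuous_on UNIV f" and g: "continuous_on UNIV g" and h: "continuous_on UNIV h"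
  shows "continuous_on UNIV (\<lambda>p. rhsC (C (f p)) (W1 (f p)) (W2 (f p)) (g p))" (is ?C)
    "continuous_on UNIV (\<lambda>p. rhsW1 (C (f p)) (W1 (f p)) (W2 (f p)) (h p))" (is ?W1)
    "continuous_on UNIV (\<lambda>p. rhsW2 (C (f p)) (W1 (f p)) (W2 (f p)) (g p) (h p))" (is ?W2)
proof -
  note slice_meas [measurable]
  have lip: "family R (C t) (W1 t) (W2 t)" "close_fam 0 (C t) (W1 t) (W2 t) (C t) (W1 t) (W2 t)" for t
    by (rule family_slice, rule close_fam_refl) simp
  note lips = lip_rhs_C_integrand[OF lip(1,1,2)] lip_rhs_W1_integrand[OF lip(1,1,2)]
    lip_rhs_W2_integrand[OF lip(1,1,2)]
  have "AE p in \<pi>. norm (case p of (x, y) \<Rightarrow> (y - gf (C t) (W1 t) (W2 t) x) * Hf (W1 t) (W2 t) c x)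
      \<le> (Q + R * S) * S" for t c
    using samples by eventually_elim (use lips(1) in \<open>auto simp: lip_def\<close>)
  then show ?C unfolding mf_rhs_C_def
    by (intro continuous_on_integral_param[OF prob(1), where B = "(Q + R * S) * S"])
      (auto simp: split_beta intro!: continuous_intros g_cont H_cont f g)
  have "AE p in \<pi>. norm (case p of (x, y) \<Rightarrow> ((y - gf (C t) (W1 t) (W2 t) x) * Vf (C t) (W1 t) (W2 t) w x
      * deriv \<sigma> (W1 t w \<bullet> x)) *\<^sub>R x) \<le> (Q + R * S) * (R * S * R) * S * Q" for t w
    using samples by eventually_elim (use lips(2) in \<open>auto simp: lip_def\<close>)
  then show ?W1 unfolding mf_rhs_W1_def
    by (intro continuous_on_integral_param[OF prob(1), where B = "(Q + R * S) * (R * S * R) * S * Q"])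
      (auto simp: split_beta intro!: continuous_intros g_cont V_cont W1_cont' sigma_cont' f h)
  have "AE p in \<pi>. norm (case p of (x, y) \<Rightarrow> (y - gf (C t) (W1 t) (W2 t) x) * C t c
      * deriv \<sigma> (Zf (W1 t) (W2 t) c x) * \<sigma> (W1 t w \<bullet> x)) \<le> (Q + R * S) * R * S * S" for t c w
    using samples by eventually_elim (use lips(3) in \<open>auto simp: lip_def\<close>)
  then show ?W2 unfolding mf_rhs_W2_def
    by (intro continuous_on_integral_param[OF prob(1), where B = "(Q + R * S) * R * S * S"])
      (auto simp: split_beta intro!: continuous_intros g_cont Z_cont C_cont' W1_cont' sigma_cont' f g h)
qed

end

end

section \<open>Existence of the mean-field system\<close>

lemma integral_upto_stretch:
  fixes g :: "real \<Rightarrow> 'b::banach"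
  assumes "continuous_on {0..T} g" "0 \<le> T"
  shows "integral {0..T} g = T *\<^sub>R integral {0..1} (\<lambda>r. g (T * r))"
proof (cases "T = 0")
  case False
  then have T: "0 < T" using assms by simp
  have "(g has_integral integral {0..T} g) {0..T}"
    using assms by (intro integrable_integral integrable_continuous_real)
  from has_integral_stretch_real[OF this, of T]
  have "((\<lambda>r. g (T * r)) has_integral (1 / T) *\<^sub>R integral {0..T} g) ((\<lambda>x. x / T) ` {0..T})"
    using T by simp
  moreover have "(\<lambda>x. x / T) ` {0..T} = {0..1}"
    using T by (auto simp: image_iff intro!: bexI[where x = "T * _"])
  ultimately have "integral {0..1} (\<lambda>r. g (T * r)) = (1 / T) *\<^sub>R integral {0..T} g"
    by (simp add: integral_unique)
  then show ?thesis using T by simp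
qed simp

lemma continuous_on_integral_upto:
  fixes G :: "real \<Rightarrow> 'l::topological_space \<Rightarrow> 'b::banach" and T :: "'p::topological_space \<Rightarrow> real"
  assumes G: "continuous_on UNIV (\<lambda>(t, l). G t l)"
    and T: "continuous_on UNIV T" "\<And>p. 0 \<le> T p" and l: "continuous_on UNIV l"
  shows "continuous_on UNIV (\<lambda>p. integral {0..T p} (\<lambda>s. G s (l p)))"
proof -
  have G': "continuous_on A (\<lambda>p. G (f p) (g p))"
    if "continuous_on A f" "continuous_on A g" for A f and g :: "'z::topological_space \<Rightarrow> 'l"
    using continuous_on_compose2[OF G continuous_on_Pair[OF that]] by simp
  have "continuous_on UNIV (\<lambda>p. integral (cbox 0 1) (\<lambda>r. G (T p * r) (l p)))"
    by (rule integral_continuous_on_param, unfold split_beta', rule G')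
      (auto intro!: continuous_intros continuous_on_compose2[OF T(1)] continuous_on_compose2[OF l])
  then have "continuous_on UNIV (\<lambda>p. T p *\<^sub>R integral {0..1} (\<lambda>r. G (T p * r) (l p)))"
    by (auto intro!: continuous_intros T)
  moreover have "continuous_on {0..T p} (\<lambda>s. G s (l p))" for p
    by (intro G' continuous_intros)
  ultimately show ?thesis using T(2) by (simp add: integral_upto_stretch)
qed

lemma norm_integral_upto_le:
  fixes h :: "real \<Rightarrow> 'b::banach"
  assumes h: "continuous_on {0..T} h" and T: "0 \<le> T"
    and \<phi>: "\<And>s. s \<in> {0..T} \<Longrightarrow> (\<phi> has_real_derivative \<phi>' s) (at s within {0..T})"
    and le: "\<And>s. s \<in> {0..T} \<Longrightarrow> norm (h s) \<le> \<phi>' s"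
  shows "norm (integral {0..T} h) \<le> \<phi> T - \<phi> 0"
proof -
  have i: "(\<phi>' has_integral \<phi> T - \<phi> 0) {0..T}"
    using T \<phi> by (intro fundamental_theorem_of_calculus)
      (auto simp: has_real_derivative_iff_has_vector_derivative)
  then have "norm (integral {0..T} h) \<le> integral {0..T} \<phi>'"
    using le by (rule integral_norm_bound_integral[OF integrable_continuous_real[OF h] has_integral_integrable])
  with i show ?thesis by (simp add: integral_unique)
qed

lemma norm_triple_le: "norm (a, b, c) \<le> norm a + norm b + norm c"
  using norm_Pair_le[of a "(b, c)"] norm_Pair_le[of b c] by linarith

lemma norm_component_le:
  "norm (fst p) \<le> norm p" "norm (fst (snd p)) \<le> norm p" "norm (snd (snd p)) \<le> norm p"
proof -
  obtain a b c where p: "p = (a, b, c)" by (cases p)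
  show "norm (fst p) \<le> norm p" "norm (fst (snd p)) \<le> norm p" "norm (snd (snd p)) \<le> norm p"
    using norm_fst_le[of a "(b, c)"] norm_snd_le[of "(b, c)" a] norm_fst_le[of b c] norm_snd_le[of c b]
    by (auto simp: p)
qed

context mf_data_total begin

text \<open>The initial data are bounded functions of the labels, to be instantiated with retractions
  onto balls containing the label sets. This makes the solution bounded and continuous in all labels.\<close>

theorem total_solution_exists:
  fixes \<iota>c :: "real \<Rightarrow> real" and \<iota>w :: "'a \<Rightarrow> 'a" and \<iota>u :: "real \<Rightarrow> real"
  assumes \<iota>c: "continuous_on UNIV \<iota>c" "\<And>c. \<bar>\<iota>c c\<bar> \<le> m"
    and \<iota>w: "continuous_on UNIV \<iota>w" "\<And>w. norm (\<iota>w w) \<le> m"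
    and \<iota>u: "continuous_on UNIV \<iota>u" "\<And>u. \<bar>\<iota>u u\<bar> \<le> m"
  obtains C W1 D R where
    "continuous_on UNIV (\<lambda>(t, c). C t c)" "continuous_on UNIV (\<lambda>(t, w). W1 t w)"
    "continuous_on UNIV (\<lambda>(t, c, w). D t c w)"
    "\<And>t c. \<bar>C t c\<bar> \<le> R" "\<And>t w. norm (W1 t w) \<le> R" "\<And>t c w u. \<bar>\<iota>u u + D t c w\<bar> \<le> R"
    "\<And>c. C 0 c = \<iota>c c" "\<And>w. W1 0 w = \<iota>w w" "\<And>c w. D 0 c w = 0"
    "\<And>t c. t \<in> {0..1} \<Longrightarrow> ((\<lambda>s. C s c) has_vector_derivative
       rhsC (C t) (W1 t) (\<lambda>c w u. \<iota>u u + D t c w) c) (at t within {0..1})"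
    "\<And>t w. t \<in> {0..1} \<Longrightarrow> ((\<lambda>s. W1 s w) has_vector_derivative
       rhsW1 (C t) (W1 t) (\<lambda>c w u. \<iota>u u + D t c w) w) (at t within {0..1})"
    "\<And>t c w. t \<in> {0..1} \<Longrightarrow> ((\<lambda>s. D s c w) has_vector_derivative
       rhsW2 (C t) (W1 t) (\<lambda>c w u. \<iota>u u + D t c w) c w) (at t within {0..1})"
proof -
  have m: "0 \<le> m" using \<iota>c(2)[of 0] by linarith
  define \<kappa> :: "real \<Rightarrow> real" where "\<kappa> t = max 0 (min 1 t)" for t
  have \<kappa>: "0 \<le> \<kappa> t" "\<kappa> t \<le> 1" "continuous_on UNIV \<kappa>" and \<kappa>_id: "t \<in> {0..1} \<Longrightarrow> \<kappa> t = t" for t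
    by (auto simp: \<kappa>_def[abs_def] intro!: continuous_intros)
  \<comment> \<open>\<open>\<rho>\<close> dominates the output weights along Picard iterates, since \<open>S (Q + \<rho> S) \<le> \<rho>'\<close>; \<open>e\<close> is the
    weight that makes the Picard map \<open>\<Gamma>\<close> a contraction.\<close>
  define \<rho> where "\<rho> t = (m + 1) * exp ((S * (Q + S)) * t)" for t
  define r where "r = \<rho> 1"
  define R2 where "R2 = (Q + r * S) * r * S * S"
  define R where "R = max r (m + R2)"
  define B where "B = B_rhs R"
  define L where "L = L_rhs R"
  define \<mu> where "\<mu> = 6 * L + 1"
  define e where "e t = exp (\<mu> * \<kappa> t)" for t
  have \<rho>_mono: "1 \<le> \<rho> s" "\<rho> s \<le> \<rho> t" "m + 1 \<le> \<rho> s" if "0 \<le> s" "s \<le> t" for s t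
  proof -
    have k: "0 \<le> S * (Q + S)" using S_nonneg Q_nonneg by simp
    then have "1 \<le> exp (S * (Q + S) * s)" using that by simp
    then show "m + 1 \<le> \<rho> s" unfolding \<rho>_def using m
      by (metis add_nonneg_nonneg mult.right_neutral mult_left_mono zero_le_one)
    with m show "1 \<le> \<rho> s" by simp
    show "\<rho> s \<le> \<rho> t" unfolding \<rho>_def using m k that
      by (intro mult_left_mono) (auto intro: mult_left_mono)
  qed
  have r: "1 \<le> r" "\<rho> (\<kappa> t) \<le> r" for t
    using \<rho>_mono(1)[of 1 1] \<rho>_mono(2)[of "\<kappa> t" 1] \<kappa>(1,2)[of t] by (simp_all add: r_def)
  have R2: "0 \<le> R2" using r S_nonneg Q_nonneg by (auto simp: R2_def)
  have R: "r \<le> R" "m + R2 \<le> R" "0 \<le> R" using r by (auto simp: R_def)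
  have B: "0 \<le> B" and L: "0 \<le> L" using B_rhs_nonneg L_rhs_nonneg R by (auto simp: B_def L_def)
  have \<mu>: "1 \<le> \<mu>" using L by (simp add: \<mu>_def)
  have e: "1 \<le> e t" "0 < e t" "continuous_on UNIV e" for t
    using \<kappa> \<mu> by (auto simp: e_def[abs_def] intro!: continuous_intros)

  define cC :: "((real \<times> real \<times> 'a) \<Rightarrow>\<^sub>C (real \<times> 'a \<times> real)) \<Rightarrow> real \<Rightarrow> real \<Rightarrow> real"
    where "cC U t c = e t * fst (apply_bcontfun U (t, c, 0))" for U t c
  define cW :: "((real \<times> real \<times> 'a) \<Rightarrow>\<^sub>C (real \<times> 'a \<times> real)) \<Rightarrow> real \<Rightarrow> 'a \<Rightarrow> 'a"
    where "cW U t w = e t *\<^sub>R fst (snd (apply_bcontfun U (t, 0, w)))" for U t w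
  define cD :: "((real \<times> real \<times> 'a) \<Rightarrow>\<^sub>C (real \<times> 'a \<times> real)) \<Rightarrow> real \<Rightarrow> real \<Rightarrow> 'a \<Rightarrow> real"
    where "cD U t c w = e t * snd (snd (apply_bcontfun U (t, c, w)))" for U t c w
  define c2 where "c2 U t c w u = \<iota>u u + cD U t c w" for U t c w u
  define G where "G U t l = (rhsC (cC U t) (cW U t) (c2 U t) (fst l), rhsW1 (cC U t) (cW U t) (c2 U t) (snd l),
    rhsW2 (cC U t) (cW U t) (c2 U t) (fst l) (snd l))" for U t and l :: "real \<times> 'a"
  define good where "good U \<longleftrightarrow> (\<forall>t c w. \<bar>cC U t c\<bar> \<le> \<rho> (\<kappa> t) \<and> \<bar>cD U t c w\<bar> \<le> R2)" for U
  define I where "I U p = (\<iota>c (fst (snd p)), \<iota>w (snd (snd p)), 0::real) +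
    integral {0..\<kappa> (fst p)} (\<lambda>s. G U s (snd p))" for U and p :: "real \<times> real \<times> 'a"
  define \<Gamma> where "\<Gamma> U = Bcontfun (\<lambda>p. inverse (e (fst p)) *\<^sub>R I U p)" for U

  have ap: "continuous_on A (\<lambda>p. apply_bcontfun U (f p))" if "continuous_on A f"
    for U :: "(real \<times> real \<times> 'a) \<Rightarrow>\<^sub>C (real \<times> 'a \<times> real)" and A and f :: "'z::topological_space \<Rightarrow> _"
    using continuous_on_compose2[OF continuous_on_apply_bcontfun[of UNIV U] that] by simp
  have conts: "continuous_on UNIV (\<lambda>(t, c). cC U t c)" "continuous_on UNIV (\<lambda>(t, w). cW U t w)"
      "continuous_on UNIV (\<lambda>(t, c, w). cD U t c w)" "continuous_on UNIV (\<lambda>(t, c, w, u). c2 U t c w u)" for U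
    unfolding cC_def cW_def cD_def c2_def split_beta'
    by (auto intro!: continuous_intros ap continuous_on_compose2[OF e(3)] continuous_on_compose2[OF \<iota>u(1)])
  have bd: "\<bar>cC U t c\<bar> \<le> R" "\<bar>c2 U t c w u\<bar> \<le> R" if "good U" for U t c w u
  proof -
    have "\<bar>cC U t c\<bar> \<le> \<rho> (\<kappa> t)" "\<bar>cD U t c w\<bar> \<le> R2" using that by (auto simp: good_def)
    then show "\<bar>cC U t c\<bar> \<le> R" "\<bar>c2 U t c w u\<bar> \<le> R"
      using r(2)[of t] R \<iota>u(2)[of u] by (auto simp: c2_def)
  qed
  have fam: "family R (cC U t) (cW U t) (c2 U t)" if "good U" for U t
    by (rule family_slice[OF conts(1,2,4) bd[OF that]])
  have G_cont: "continuous_on UNIV (\<lambda>(t, l). G U t l)" if "good U" for U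
    unfolding G_def split_beta'
    by (intro continuous_intros rhs_cont(1)[OF conts(1,2,4) bd[OF that], where h = "\<lambda>_. 0"]
      rhs_cont(2)[OF conts(1,2,4) bd[OF that], where g = "\<lambda>_. 0"] rhs_cont(3)[OF conts(1,2,4) bd[OF that]])
  have G_le: "norm (G U t l) \<le> 3 * B" if "good U" for U t l
  proof -
    note lips = lip_rhs[OF fam[OF that, of t] fam[OF that, of t] close_fam_refl[OF order_refl] order_refl]
    have "norm (G U t l) \<le> B + B + B"
      unfolding G_def B_def using lips(1)[of "fst l"] lips(2)[of "snd l"] lips(3)[of "fst l" "snd l"]
      by (intro norm_triple_le[THEN order_trans] add_mono) (auto simp: lip_def)
    then show ?thesis by simp
  qed
  have G_diff: "norm (G U t l - G V t l) \<le> 3 * L * (e t * dist U V)" if "good U" "good V" for U V t l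
  proof -
    have le: "norm (apply_bcontfun U p - apply_bcontfun V p) \<le> dist U V" for p
      using dist_bounded[of U p V] by (simp add: dist_norm)
    have le': "\<bar>fst (apply_bcontfun U p) - fst (apply_bcontfun V p)\<bar> \<le> dist U V"
      "norm (fst (snd (apply_bcontfun U p)) - fst (snd (apply_bcontfun V p))) \<le> dist U V"
      "\<bar>snd (snd (apply_bcontfun U p)) - snd (snd (apply_bcontfun V p))\<bar> \<le> dist U V" for p
      using norm_component_le[of "apply_bcontfun U p - apply_bcontfun V p"] le[of p] by auto
    have close: "close_fam (e t * dist U V) (cC U t) (cW U t) (c2 U t) (cC V t) (cW V t) (c2 V t)"
      using le' e(2)[of t] unfolding close_fam_def cC_def cW_def c2_def cD_def
      by (auto simp: abs_mult simp flip: right_diff_distrib scaleR_right_diff_distrib intro!: mult_left_mono)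
    have nn: "0 \<le> e t * dist U V" using e(2)[of t] by simp
    have "norm (G U t l - G V t l) \<le> L * (e t * dist U V) + L * (e t * dist U V) + L * (e t * dist U V)"
      unfolding G_def minus_prod_def fst_conv snd_conv
      using lip_rhs[OF fam[OF that(1)] fam[OF that(2)] close nn]
      by (intro norm_triple_le[THEN order_trans] add_mono) (auto simp: lip_def L_def)
    then show ?thesis by simp
  qed
  have G_cont1: "continuous_on A (\<lambda>s. G U s l)" if "good U" for U A l
    using continuous_on_compose2[OF G_cont[OF that] continuous_on_Pair[OF continuous_on_id continuous_on_const], of l A]
    by simp
  have int_le: "norm (integral {0..\<kappa> t} (\<lambda>s. G U s l)) \<le> 3 * B" if "good U" for U t l
  proof -
    have "norm (integral {0..\<kappa> t} (\<lambda>s. G U s l)) \<le> 3 * B * \<kappa> t - 3 * B * 0"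
      using \<kappa>(1)[of t] G_le that
      by (intro norm_integral_upto_le[where \<phi>' = "\<lambda>_. 3 * B"] G_cont1) (auto intro!: derivative_eq_intros)
    also have "\<dots> \<le> 3 * B * 1" using \<kappa>(2)[of t] B by (simp add: mult_left_le)
    finally show ?thesis by simp
  qed
  have I_cont: "continuous_on UNIV (I U)" if "good U" for U
    unfolding I_def
    by (intro continuous_intros continuous_on_integral_upto[OF G_cont[OF that]]
      continuous_on_compose2[OF \<iota>c(1)] continuous_on_compose2[OF \<iota>w(1)] continuous_on_compose2[OF \<kappa>(3)])
      (auto simp: \<kappa>)
  have I_le: "norm (I U p) \<le> 2 * m + 3 * B" if "good U" for U p
    using norm_triangle_ineq[of "(\<iota>c (fst (snd p)), \<iota>w (snd (snd p)), 0::real)" "integral {0..\<kappa> (fst p)} (\<lambda>s. G U s (snd p))"]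
      norm_triple_le[of "\<iota>c (fst (snd p))" "\<iota>w (snd (snd p))" "0::real"] int_le[OF that, of "fst p" "snd p"]
      \<iota>c(2)[of "fst (snd p)"] \<iota>w(2)[of "snd (snd p)"]
    unfolding I_def by simp
  have \<Gamma>_apply: "apply_bcontfun (\<Gamma> U) p = inverse (e (fst p)) *\<^sub>R I U p" if "good U" for U p
  proof -
    have "(\<lambda>p. inverse (e (fst p)) *\<^sub>R I U p) \<in> bcontfun"
    proof (rule bcontfun_normI)
      show "continuous_on UNIV (\<lambda>p. inverse (e (fst p)) *\<^sub>R I U p)"
        using e(2) by (intro continuous_intros I_cont that continuous_on_compose2[OF e(3)])
          (auto simp: less_imp_neq[symmetric])
      fix p
      have "norm (inverse (e (fst p)) *\<^sub>R I U p) \<le> 1 * norm (I U p)"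
        using e(1,2)[of "fst p"] mult_right_mono[of "inverse (e (fst p))" 1 "norm (I U p)"]
        by (simp add: inverse_le_1_iff)
      then show "norm (inverse (e (fst p)) *\<^sub>R I U p) \<le> 2 * m + 3 * B" using I_le[OF that, of p] by linarith
    qed
    then show ?thesis by (simp add: \<Gamma>_def Bcontfun_inverse)
  qed
  have comp: "fst (I U (t, c, w)) = \<iota>c c + integral {0..\<kappa> t} (\<lambda>s. rhsC (cC U s) (cW U s) (c2 U s) c)"
    "fst (snd (I U (t, c, w))) = \<iota>w w + integral {0..\<kappa> t} (\<lambda>s. rhsW1 (cC U s) (cW U s) (c2 U s) w)"
    "snd (snd (I U (t, c, w))) = integral {0..\<kappa> t} (\<lambda>s. rhsW2 (cC U s) (cW U s) (c2 U s) c w)"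
    if "good U" for U t c w
  proof -
    have i: "(\<lambda>s. G U s (c, w)) integrable_on {0..\<kappa> t}"
      by (intro integrable_continuous_real G_cont1 that)
    have "fst (integral {0..\<kappa> t} (\<lambda>s. G U s (c, w))) = integral {0..\<kappa> t} (\<lambda>s. rhsC (cC U s) (cW U s) (c2 U s) c)"
      "fst (snd (integral {0..\<kappa> t} (\<lambda>s. G U s (c, w)))) = integral {0..\<kappa> t} (\<lambda>s. rhsW1 (cC U s) (cW U s) (c2 U s) w)"
      "snd (snd (integral {0..\<kappa> t} (\<lambda>s. G U s (c, w)))) = integral {0..\<kappa> t} (\<lambda>s. rhsW2 (cC U s) (cW U s) (c2 U s) c w)"
      using integral_linear[OF i bounded_linear_fst]
        integral_linear[OF i bounded_linear_compose[OF bounded_linear_fst bounded_linear_snd]]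
        integral_linear[OF i bounded_linear_compose[OF bounded_linear_snd bounded_linear_snd]]
      by (simp_all add: o_def G_def)
    then show "fst (I U (t, c, w)) = \<iota>c c + integral {0..\<kappa> t} (\<lambda>s. rhsC (cC U s) (cW U s) (c2 U s) c)"
      "fst (snd (I U (t, c, w))) = \<iota>w w + integral {0..\<kappa> t} (\<lambda>s. rhsW1 (cC U s) (cW U s) (c2 U s) w)"
      "snd (snd (I U (t, c, w))) = integral {0..\<kappa> t} (\<lambda>s. rhsW2 (cC U s) (cW U s) (c2 U s) c w)"
      by (simp_all add: I_def)
  qed
  have unweight: "cC (\<Gamma> U) t c = fst (I U (t, c, 0))" "cW (\<Gamma> U) t w = fst (snd (I U (t, 0, w)))"
    "cD (\<Gamma> U) t c w = snd (snd (I U (t, c, w)))" if "good U" for U t c w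
    using e(2)[of t] by (simp_all add: cC_def cW_def cD_def \<Gamma>_apply[OF that])
  have good_\<Gamma>: "good (\<Gamma> U)" if U: "good U" for U
    unfolding good_def
  proof (intro allI conjI)
    fix t c w
    have cont: "continuous_on A (\<lambda>s. rhsC (cC U s) (cW U s) (c2 U s) c)"
      "continuous_on A (\<lambda>s. rhsW2 (cC U s) (cW U s) (c2 U s) c w)" for A
      using rhs_cont(1,3)[OF conts(1,2,4) bd[OF U], of "\<lambda>s. s" "\<lambda>_. c" "\<lambda>_. w"]
      by (auto intro: continuous_on_subset)
    have cC_le: "\<bar>cC U s c\<bar> \<le> \<rho> (\<kappa> s)" "\<bar>cC U s c\<bar> \<le> r" for s c
      using U r(2)[of s] by (auto simp: good_def intro: order_trans)
    have "norm (integral {0..\<kappa> t} (\<lambda>s. rhsC (cC U s) (cW U s) (c2 U s) c)) \<le> \<rho> (\<kappa> t) - \<rho> 0"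
    proof (rule norm_integral_upto_le[OF cont(1) \<kappa>(1)])
      show "(\<rho> has_real_derivative S * (Q + S) * \<rho> s) (at s within {0..\<kappa> t})" for s
        unfolding \<rho>_def[abs_def] by (auto intro!: derivative_eq_intros)
      fix s assume s: "s \<in> {0..\<kappa> t}"
      then have s': "s \<in> {0..1}" using \<kappa>(2)[of t] by auto
      have \<rho>1: "1 \<le> \<rho> s" using \<rho>_mono(1)[of s s] s by simp
      have "\<bar>rhsC (cC U s) (cW U s) (c2 U s) c\<bar> \<le> (Q + \<rho> s * S) * S"
        using cC_le(1)[of s] \<kappa>_id[OF s'] by (intro rhs_le) simp
      also have "\<dots> \<le> (Q * \<rho> s + \<rho> s * S) * S"
        using \<rho>1 Q_nonneg S_nonneg by (intro mult_right_mono add_mono) (auto simp: mult_le_cancel_left1)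
      finally show "norm (rhsC (cC U s) (cW U s) (c2 U s) c) \<le> S * (Q + S) * \<rho> s"
        by (simp add: algebra_simps)
    qed
    moreover have "\<rho> 0 = m + 1" by (simp add: \<rho>_def)
    ultimately show "\<bar>cC (\<Gamma> U) t c\<bar> \<le> \<rho> (\<kappa> t)"
      using \<iota>c(2)[of c] by (simp add: unweight[OF U] comp[OF U])
    have "norm (integral {0..\<kappa> t} (\<lambda>s. rhsW2 (cC U s) (cW U s) (c2 U s) c w)) \<le> R2 * \<kappa> t - R2 * 0"
      using rhs_le(2)[OF cC_le(2)]
      by (intro norm_integral_upto_le[OF cont(2) \<kappa>(1), where \<phi>' = "\<lambda>_. R2"])
        (auto simp: R2_def intro!: derivative_eq_intros)
    also have "\<dots> \<le> R2 * 1" using \<kappa>(2)[of t] R2 by (simp add: mult_left_le)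
    finally show "\<bar>cD (\<Gamma> U) t c w\<bar> \<le> R2" by (simp add: unweight[OF U] comp[OF U])
  qed
  have contraction: "dist (\<Gamma> U) (\<Gamma> V) \<le> 1 / 2 * dist U V" if U: "good U" and V: "good V" for U V
  proof (rule dist_bound)
    fix p :: "real \<times> real \<times> 'a"
    obtain t l where p: "p = (t, l)" by (cases p)
    define \<delta> where "\<delta> = dist U V"
    have "I U p - I V p = integral {0..\<kappa> t} (\<lambda>s. G U s l) - integral {0..\<kappa> t} (\<lambda>s. G V s l)"
      by (simp add: I_def p)
    also have "\<dots> = integral {0..\<kappa> t} (\<lambda>s. G U s l - G V s l)"
      by (intro Henstock_Kurzweil_Integration.integral_diff[symmetric] integrable_continuous_real G_cont1 U V)
    also have "norm \<dots> \<le> 3 * L * \<delta> / \<mu> * exp (\<mu> * \<kappa> t) - 3 * L * \<delta> / \<mu> * exp (\<mu> * 0)"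
    proof (rule norm_integral_upto_le[where \<phi>' = "\<lambda>s. 3 * L * \<delta> * exp (\<mu> * s)"])
      show "norm (G U s l - G V s l) \<le> 3 * L * \<delta> * exp (\<mu> * s)" if "s \<in> {0..\<kappa> t}" for s
        using G_diff[OF U V, of s l] \<kappa>_id[of s] \<kappa>(2)[of t] that by (auto simp: e_def \<delta>_def mult_ac)
      show "((\<lambda>s. 3 * L * \<delta> / \<mu> * exp (\<mu> * s)) has_real_derivative 3 * L * \<delta> * exp (\<mu> * s)) (at s within {0..\<kappa> t})" for s
        using \<mu> by (auto intro!: derivative_eq_intros)
    qed (auto intro!: continuous_intros G_cont1 U V \<kappa>)
    also have "\<dots> \<le> 3 * L * \<delta> / \<mu> * e t" using L \<mu> by (simp add: e_def \<delta>_def)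
    finally have "norm (I U p - I V p) \<le> 3 * L * \<delta> / \<mu> * e t" .
    then have "inverse (e t) * norm (I U p - I V p) \<le> 3 * L * \<delta> / \<mu>"
      using e(2)[of t] by (simp add: field_simps)
    also have "\<dots> \<le> 1 / 2 * \<delta>"
      using L \<mu> by (auto simp: \<mu>_def \<delta>_def field_simps)
    finally show "dist (apply_bcontfun (\<Gamma> U) p) (apply_bcontfun (\<Gamma> V) p) \<le> 1 / 2 * dist U V"
      using e(2)[of t] by (simp add: \<Gamma>_apply[OF U] \<Gamma>_apply[OF V] dist_norm p \<delta>_def flip: scaleR_right_diff_distrib)
  qed
  have "closed {U. good U}"
    unfolding closed_sequential_limits
  proof (intro allI impI, elim conjE)
    fix X and U assume X: "\<forall>n. X n \<in> {U. good U}" and lim: "X \<longlonglongrightarrow> U"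
    have lim': "(\<lambda>n. apply_bcontfun (X n) p) \<longlonglongrightarrow> apply_bcontfun U p" for p
    proof (rule metric_tendsto_imp_tendsto[OF lim])
      show "\<forall>\<^sub>F n in sequentially. dist (apply_bcontfun (X n) p) (apply_bcontfun U p) \<le> dist (X n) U"
        by (intro always_eventually allI dist_bounded)
    qed
    show "U \<in> {U. good U}" unfolding good_def mem_Collect_eq
    proof (intro allI conjI)
      fix t c w
      have "(\<lambda>n. \<bar>cC (X n) t c\<bar>) \<longlonglongrightarrow> \<bar>cC U t c\<bar>" "(\<lambda>n. \<bar>cD (X n) t c w\<bar>) \<longlonglongrightarrow> \<bar>cD U t c w\<bar>"
        unfolding cC_def cD_def by (intro tendsto_intros lim')+
      then show "\<bar>cC U t c\<bar> \<le> \<rho> (\<kappa> t)" "\<bar>cD U t c w\<bar> \<le> R2"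
        using X by (auto simp: good_def intro!: LIMSEQ_le_const2)
    qed
  qed
  moreover have "good 0"
    using \<rho>_mono(1) \<kappa>(1) R2 by (auto simp: good_def cC_def cD_def intro: order_trans[OF zero_le_one])
  ultimately have "\<exists>!U\<in>{U. good U}. \<Gamma> U = U"
    using good_\<Gamma> contraction
    by (intro Banach_fix[where c = "1 / 2"]) (auto simp: complete_eq_closed)
  then obtain U where U: "good U" "\<Gamma> U = U" by blast
  have fixpoint: "cC U t c = \<iota>c c + integral {0..\<kappa> t} (\<lambda>s. rhsC (cC U s) (cW U s) (c2 U s) c)"
    "cW U t w = \<iota>w w + integral {0..\<kappa> t} (\<lambda>s. rhsW1 (cC U s) (cW U s) (c2 U s) w)"
    "cD U t c w = integral {0..\<kappa> t} (\<lambda>s. rhsW2 (cC U s) (cW U s) (c2 U s) c w)" for t c w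
    using unweight[OF U(1)] comp[OF U(1)] by (simp_all add: U(2))
  have rhs_c: "continuous_on A (\<lambda>s. rhsC (cC U s) (cW U s) (c2 U s) c)"
    "continuous_on A (\<lambda>s. rhsW1 (cC U s) (cW U s) (c2 U s) w)"
    "continuous_on A (\<lambda>s. rhsW2 (cC U s) (cW U s) (c2 U s) c w)" for A c w
    using rhs_cont[OF conts(1,2,4) bd[OF U(1)], of "\<lambda>s. s" "\<lambda>_. c" "\<lambda>_. w"]
    by (auto intro: continuous_on_subset)
  have deriv: "((\<lambda>t. i + integral {0..\<kappa> t} f) has_vector_derivative f t) (at t within {0..1})"
    if "\<And>A. continuous_on A f" "t \<in> {0..1}" for f :: "real \<Rightarrow> 'z::banach" and i t
  proof (rule has_vector_derivative_transform[OF that(2)])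
    show "((\<lambda>t. i + integral {0..t} f) has_vector_derivative f t) (at t within {0..1})"
      using integral_has_vector_derivative[OF that] by (auto intro!: derivative_eq_intros)
  qed (simp add: \<kappa>_id)
  define R' where "R' = max R (m + 3 * B)"
  have c2: "(\<lambda>c w u. \<iota>u u + cD U t c w) = c2 U t" for t by (simp add: c2_def[abs_def] fun_eq_iff)
  show thesis
  proof (rule that[of "cC U" "cW U" "cD U" R'])
    show "\<bar>cC U t c\<bar> \<le> R'" "\<bar>\<iota>u u + cD U t c w\<bar> \<le> R'" for t c w u
      using bd(1)[OF U(1), of t c] bd(2)[OF U(1), of t c w u] by (auto simp: R'_def c2_def)
    show "norm (cW U t w) \<le> R'" for t w
    proof -
      have "norm (integral {0..\<kappa> t} (\<lambda>s. rhsW1 (cC U s) (cW U s) (c2 U s) w))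
          \<le> norm (integral {0..\<kappa> t} (\<lambda>s. G U s (0, w)))"
        using norm_component_le(2)[of "integral {0..\<kappa> t} (\<lambda>s. G U s (0, w))"]
          comp(2)[OF U(1), of t 0 w] by (simp add: I_def)
      then show ?thesis
        using int_le[OF U(1), of t "(0, w)"] \<iota>w(2)[of w] norm_triangle_ineq
        unfolding fixpoint(2)[of t w] R'_def by (smt (verit) max.cobounded2)
    qed
    show "cC U 0 c = \<iota>c c" "cW U 0 w = \<iota>w w" "cD U 0 c w = 0" for c w
      by (subst fixpoint, simp add: \<kappa>_def)+
    fix t :: real assume t: "t \<in> {0..1}"
    show "((\<lambda>s. cC U s c) has_vector_derivative
        rhsC (cC U t) (cW U t) (\<lambda>c w u. \<iota>u u + cD U t c w) c) (at t within {0..1})" for c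
      unfolding c2 using deriv[OF rhs_c(1)[of _ c] t, of "\<iota>c c"] by (simp only: fixpoint(1)[symmetric])
    show "((\<lambda>s. cW U s w) has_vector_derivative
        rhsW1 (cC U t) (cW U t) (\<lambda>c w u. \<iota>u u + cD U t c w) w) (at t within {0..1})" for w
      unfolding c2 using deriv[OF rhs_c(2)[of _ w] t, of "\<iota>w w"] by (simp only: fixpoint(2)[symmetric])
    show "((\<lambda>s. cD U s c w) has_vector_derivative
        rhsW2 (cC U t) (cW U t) (\<lambda>c w u. \<iota>u u + cD U t c w) c w) (at t within {0..1})" for c w
      unfolding c2 using deriv[OF rhs_c(3)[of _ c w] t, of 0] by (simp only: fixpoint(3)[symmetric] add_0)
  qed (use conts in auto)
qed

end

section \<open>Independent sources and averages\<close>

lemma (in prob_space) expectation_norm_le_sqrt: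
  fixes X :: "'a \<Rightarrow> 'b::euclidean_space"
  assumes [measurable]: "X \<in> borel_measurable M" and bound: "\<And>\<omega>. norm (X \<omega>) \<le> B"
  shows "expectation (\<lambda>\<omega>. norm (X \<omega>)) \<le> sqrt (expectation (\<lambda>\<omega>. (norm (X \<omega>))\<^sup>2))"
proof -
  have i: "integrable M (\<lambda>\<omega>. norm (X \<omega>))" "integrable M (\<lambda>\<omega>. (norm (X \<omega>))\<^sup>2)"
    using bound power_mono[OF bound norm_ge_zero, of _ 2]
    by (auto intro!: integrable_const_bound[of "\<lambda>\<omega>. norm (X \<omega>)" B] integrable_const_bound[of "\<lambda>\<omega>. (norm (X \<omega>))\<^sup>2" "B\<^sup>2"])
  show ?thesis
    using variance_positive[of "\<lambda>\<omega>. norm (X \<omega>)"] variance_eq[OF i]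
    by (intro real_le_rsqrt) simp
qed

lemma (in prob_space) expectation_norm_centered_sum_le:
  fixes \<phi> :: "nat \<Rightarrow> 'y \<times> 'x \<Rightarrow> 'b::euclidean_space"
  assumes Y [measurable]: "Y \<in> measurable M N"
    and X [measurable]: "\<And>l. l < n \<Longrightarrow> X l \<in> measurable M K"
    and law: "\<And>l. l < n \<Longrightarrow> distr M K (X l) = \<mu>"
    and indep: "\<And>l m. l < n \<Longrightarrow> m < n \<Longrightarrow> l \<noteq> m \<Longrightarrow>
      distr M (N \<Otimes>\<^sub>M K) (\<lambda>\<omega>. (Y \<omega>, X m \<omega>)) \<Otimes>\<^sub>M distr M K (X l) =
        distr M ((N \<Otimes>\<^sub>M K) \<Otimes>\<^sub>M K) (\<lambda>\<omega>. ((Y \<omega>, X m \<omega>), X l \<omega>))"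
    and \<phi> [measurable]: "\<And>l. \<phi> l \<in> borel_measurable (N \<Otimes>\<^sub>M K)"
    and bound: "\<And>l p. norm (\<phi> l p) \<le> B"
  shows "expectation (\<lambda>\<omega>. norm (\<Sum>l<n. \<phi> l (Y \<omega>, X l \<omega>) - (\<integral>x. \<phi> l (Y \<omega>, x) \<partial>\<mu>))) \<le> 2 * B * sqrt (real n)"
proof (cases "n = 0")
  case True
  then show ?thesis by simp
next
  case False
  have B: "0 \<le> B" using norm_ge_zero bound order_trans by blast
  have \<mu>: "prob_space \<mu>" and sets_\<mu> [measurable_cong]: "sets \<mu> = sets K"
    using law[of 0] False X[of 0] by (auto intro!: prob_space_distr)
  interpret \<mu>: prob_space \<mu> by fact
  define \<psi> where "\<psi> l y x = \<phi> l (y, x) - (\<integral>x. \<phi> l (y, x) \<partial>\<mu>)" for l y x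
  have i\<phi>: "integrable \<mu> (\<lambda>x. \<phi> l (y, x))" if "y \<in> space N" for l y
    using bound that by (intro \<mu>.integrable_const_bound[where B = B]) auto
  have \<psi>_meas [measurable]: "(\<lambda>p. \<psi> l (fst p) (snd p)) \<in> borel_measurable (N \<Otimes>\<^sub>M K)" for l
    unfolding \<psi>_def by measurable
  have \<psi>_meas' [measurable]: "(\<lambda>p. \<psi> l (f p) (g p)) \<in> borel_measurable L"
    if "f \<in> measurable L N" "g \<in> measurable L K" for f g l L
    using measurable_compose[OF measurable_Pair[OF that] \<psi>_meas] by simp
  have mean_le: "norm (\<integral>x. \<phi> l (y, x) \<partial>\<mu>) \<le> B" for l y
  proof (cases "integrable \<mu> (\<lambda>x. \<phi> l (y, x))")
    case True
    have "norm (\<integral>x. \<phi> l (y, x) \<partial>\<mu>) \<le> (\<integral>x. norm (\<phi> l (y, x)) \<partial>\<mu>)" by (rule integral_norm_bound)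
    also have "\<dots> \<le> (\<integral>x. B \<partial>\<mu>)" using True bound by (intro integral_mono) auto
    finally show ?thesis by (simp add: \<mu>.prob_space)
  qed (simp add: not_integrable_integral_eq B)
  have \<psi>_le: "norm (\<psi> l y x) \<le> 2 * B" for l y x
    using norm_triangle_ineq4[of "\<phi> l (y, x)" "\<integral>x. \<phi> l (y, x) \<partial>\<mu>"] bound[of l "(y, x)"] mean_le[of l y]
    by (simp add: \<psi>_def)
  have \<psi>_mean: "(\<integral>x. \<psi> l y x \<partial>\<mu>) = 0" if "y \<in> space N" for l y
    unfolding \<psi>_def using i\<phi>[OF that] by (simp add: \<mu>.prob_space)
  have \<psi>_int: "integrable \<mu> (\<psi> l y)" if "y \<in> space N" for l y
    using \<psi>_le that by (intro \<mu>.integrable_const_bound[where B = "2 * B"]) auto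
  define V where "V l \<omega> = \<psi> l (Y \<omega>) (X l \<omega>)" for l \<omega>
  have V_meas [measurable]: "V l \<in> borel_measurable M" if "l < n" for l
    unfolding V_def using X[OF that] by measurable
  have V_le: "norm (V l \<omega>) \<le> 2 * B" for l \<omega> by (simp add: V_def \<psi>_le)
  have prod_le: "\<bar>\<psi> l y x \<bullet> \<psi> m y' x'\<bar> \<le> (2 * B) * (2 * B)" for l y x m y' x'
    using \<psi>_le Cauchy_Schwarz_ineq2[of "\<psi> l y x" "\<psi> m y' x'"] B
    by (meson mult_mono norm_ge_zero order_trans mult_nonneg_nonneg zero_le_numeral)
  have V_prod_le: "\<bar>V l \<omega> \<bullet> V m \<omega>\<bar> \<le> (2 * B) * (2 * B)" for l m \<omega>
    unfolding V_def by (rule prod_le)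
  have orth: "expectation (\<lambda>\<omega>. V l \<omega> \<bullet> V m \<omega>) = 0" if lm: "l < n" "m < n" "l \<noteq> m" for l m
  proof -
    note [measurable] = X[OF lm(1)] X[OF lm(2)]
    define \<nu> where "\<nu> = distr M (N \<Otimes>\<^sub>M K) (\<lambda>\<omega>. (Y \<omega>, X m \<omega>))"
    have sets_\<nu> [measurable_cong]: "sets \<nu> = sets (N \<Otimes>\<^sub>M K)" by (simp add: \<nu>_def)
    interpret \<nu>: prob_space \<nu> unfolding \<nu>_def by (rule prob_space_distr) measurable
    interpret P: pair_prob_space \<nu> \<mu> ..
    define h where "h q = \<psi> l (fst (fst q)) (snd q) \<bullet> \<psi> m (fst (fst q)) (snd (fst q))" for q
    have h [measurable]: "h \<in> borel_measurable ((N \<Otimes>\<^sub>M K) \<Otimes>\<^sub>M K)" unfolding h_def by measurable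
    have joint: "distr M ((N \<Otimes>\<^sub>M K) \<Otimes>\<^sub>M K) (\<lambda>\<omega>. ((Y \<omega>, X m \<omega>), X l \<omega>)) = \<nu> \<Otimes>\<^sub>M \<mu>"
      using indep[OF lm] law[OF lm(1)] by (simp add: \<nu>_def)
    have "expectation (\<lambda>\<omega>. V l \<omega> \<bullet> V m \<omega>) = (\<integral>q. h q \<partial>distr M ((N \<Otimes>\<^sub>M K) \<Otimes>\<^sub>M K) (\<lambda>\<omega>. ((Y \<omega>, X m \<omega>), X l \<omega>)))"
      by (subst integral_distr) (auto simp: h_def V_def)
    also have "\<dots> = (\<integral>q. h q \<partial>(\<nu> \<Otimes>\<^sub>M \<mu>))" by (simp add: joint)
    also have "\<dots> = (\<integral>v. (\<integral>x. h (v, x) \<partial>\<mu>) \<partial>\<nu>)"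
    proof (rule P.integral_fst'[symmetric])
      show "integrable (\<nu> \<Otimes>\<^sub>M \<mu>) h"
        using prod_le by (intro P.integrable_const_bound[where B = "(2 * B) * (2 * B)"]) (auto simp: h_def)
    qed
    also have "\<dots> = (\<integral>v. 0 \<partial>\<nu>)"
    proof (rule Bochner_Integration.integral_cong[OF refl])
      fix v assume "v \<in> space \<nu>"
      then have y: "fst v \<in> space N" by (auto simp: \<nu>_def space_pair_measure)
      show "(\<integral>x. h (v, x) \<partial>\<mu>) = 0"
        using \<psi>_int[OF y, of l] \<psi>_mean[OF y, of l] by (simp add: h_def)
    qed
    finally show ?thesis by simp
  qed
  have V_int: "integrable M (\<lambda>\<omega>. V l \<omega> \<bullet> V m \<omega>)" if "l < n" "m < n" for l m
    using V_prod_le[of l _ m] V_meas[OF that(1)] V_meas[OF that(2)]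
    by (intro integrable_const_bound[where B = "(2 * B) * (2 * B)"]) auto
  have diag: "expectation (\<lambda>\<omega>. V l \<omega> \<bullet> V l \<omega>) \<le> (2 * B)\<^sup>2" if "l < n" for l
  proof -
    have "expectation (\<lambda>\<omega>. V l \<omega> \<bullet> V l \<omega>) \<le> expectation (\<lambda>\<omega>. (2 * B) * (2 * B))"
      using V_int[OF that that] V_prod_le[of l _ l] by (intro integral_mono) (auto simp: abs_le_iff)
    then show ?thesis by (simp add: prob_space power2_eq_square)
  qed
  have sum_meas [measurable]: "(\<lambda>\<omega>. \<Sum>l<n. V l \<omega>) \<in> borel_measurable M"
    by (intro borel_measurable_sum) auto
  have "expectation (\<lambda>\<omega>. (norm (\<Sum>l<n. V l \<omega>))\<^sup>2) = expectation (\<lambda>\<omega>. \<Sum>l<n. \<Sum>m<n. V l \<omega> \<bullet> V m \<omega>)"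
    by (simp add: power2_norm_eq_inner inner_sum_left inner_sum_right inner_commute)
  also have "\<dots> = (\<Sum>l<n. \<Sum>m<n. expectation (\<lambda>\<omega>. V l \<omega> \<bullet> V m \<omega>))"
  proof -
    have "expectation (\<lambda>\<omega>. \<Sum>l<n. \<Sum>m<n. V l \<omega> \<bullet> V m \<omega>) = (\<Sum>l<n. expectation (\<lambda>\<omega>. \<Sum>m<n. V l \<omega> \<bullet> V m \<omega>))"
      using V_int by (intro Bochner_Integration.integral_sum Bochner_Integration.integrable_sum) auto
    also have "\<dots> = (\<Sum>l<n. \<Sum>m<n. expectation (\<lambda>\<omega>. V l \<omega> \<bullet> V m \<omega>))"
      using V_int by (intro sum.cong refl Bochner_Integration.integral_sum) auto
    finally show ?thesis .
  qed
  also have "\<dots> = (\<Sum>l<n. expectation (\<lambda>\<omega>. V l \<omega> \<bullet> V l \<omega>))"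
  proof (rule sum.cong[OF refl])
    fix l assume l: "l \<in> {..<n}"
    have "(\<Sum>m<n. expectation (\<lambda>\<omega>. V l \<omega> \<bullet> V m \<omega>)) = (\<Sum>m<n. if m = l then expectation (\<lambda>\<omega>. V l \<omega> \<bullet> V l \<omega>) else 0)"
      using orth l by (intro sum.cong) auto
    then show "(\<Sum>m<n. expectation (\<lambda>\<omega>. V l \<omega> \<bullet> V m \<omega>)) = expectation (\<lambda>\<omega>. V l \<omega> \<bullet> V l \<omega>)"
      using l by simp
  qed
  also have "\<dots> \<le> (\<Sum>l<n. (2 * B)\<^sup>2)" by (intro sum_mono diag) auto
  finally have sq: "expectation (\<lambda>\<omega>. (norm (\<Sum>l<n. V l \<omega>))\<^sup>2) \<le> real n * (2 * B)\<^sup>2" by simp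
  have "norm (\<Sum>l<n. V l \<omega>) \<le> real n * (2 * B)" for \<omega>
    using sum_norm_le[of "{..<n}" "\<lambda>l. V l \<omega>" "\<lambda>_. 2 * B"] V_le by simp
  then have "expectation (\<lambda>\<omega>. norm (\<Sum>l<n. V l \<omega>)) \<le> sqrt (expectation (\<lambda>\<omega>. (norm (\<Sum>l<n. V l \<omega>))\<^sup>2))"
    by (rule expectation_norm_le_sqrt[OF sum_meas])
  also have "\<dots> \<le> sqrt (real n * (2 * B)\<^sup>2)" using sq by simp
  also have "\<dots> = 2 * B * sqrt (real n)" using B by (simp add: real_sqrt_mult)
  finally show ?thesis by (simp add: V_def \<psi>_def)
qed

definition source_var ::
  "(nat \<Rightarrow> 'w \<Rightarrow> real) \<Rightarrow> (nat \<Rightarrow> nat \<Rightarrow> 'w \<Rightarrow> real) \<Rightarrow> (nat \<Rightarrow> 'w \<Rightarrow> 'a::euclidean_space) \<Rightarrow>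
   (nat \<Rightarrow> 'w \<Rightarrow> 'a \<times> real) \<Rightarrow> source \<Rightarrow> 'w \<Rightarrow> 'a \<times> real" where
  "source_var C0 W20 W10 XY s \<omega> = (case s of Src_C i \<Rightarrow> (0, C0 i \<omega>) | Src_W2 i j \<Rightarrow> (0, W20 i j \<omega>)
     | Src_W1 j \<Rightarrow> (W10 j \<omega>, 0) | Src_data k \<Rightarrow> XY k \<omega>)"

locale sources = prob_space M for M :: "'w measure" +
  fixes \<pi> :: "('a::euclidean_space \<times> real) measure"
    and mu_c :: "real measure" and mu_W1 :: "'a measure" and mu_W2 :: "real measure"
    and C0 :: "nat \<Rightarrow> 'w \<Rightarrow> real" and W20 :: "nat \<Rightarrow> nat \<Rightarrow> 'w \<Rightarrow> real" and W10 :: "nat \<Rightarrow> 'w \<Rightarrow> 'a"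
    and XY :: "nat \<Rightarrow> 'w \<Rightarrow> 'a \<times> real"
  assumes independent: "independent_sources M C0 W20 W10 XY"
    and laws: "distr M borel (C0 i) = mu_c" "distr M borel (W20 i j) = mu_W2"
      "distr M borel (W10 j) = mu_W1" "distr M borel (XY k) = \<pi>"
begin

lemma source_measurable [measurable]:
  "C0 i \<in> borel_measurable M" "W20 i j \<in> borel_measurable M" "W10 j \<in> borel_measurable M"
  "XY k \<in> borel_measurable M"
  using independent by (auto simp: independent_sources_def)

lemma XY_measurable_pair [measurable]: "XY k \<in> measurable M (borel \<Otimes>\<^sub>M borel)"
  using source_measurable(4)[of k] by (simp add: borel_prod)

abbreviation "src \<equiv> source_var C0 W20 W10 XY"

lemma indep_vars_src: "indep_vars (\<lambda>_. borel) src UNIV"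
proof -
  have "indep_sets (\<lambda>s. {src s -` A \<inter> space M |A. A \<in> sets borel}) UNIV"
  proof (rule indep_sets_mono_sets)
    show "indep_sets (\<lambda>s. case s of Src_C i \<Rightarrow> events_of M (C0 i) | Src_W2 i j \<Rightarrow> events_of M (W20 i j)
        | Src_W1 j \<Rightarrow> events_of M (W10 j) | Src_data k \<Rightarrow> events_of M (XY k)) UNIV"
      using independent by (simp add: independent_sources_def)
    have right: "{(\<lambda>\<omega>. (0::'a, f \<omega>)) -` A \<inter> space M |A. A \<in> sets borel} \<subseteq> events_of M f" for f :: "'w \<Rightarrow> real"
    proof safe
      fix A :: "('a \<times> real) set" assume A: "A \<in> sets borel"
      have "(\<lambda>c. (0::'a, c)) -` A \<in> sets borel"
        using A by (auto intro!: measurable_sets_borel[OF borel_measurable_continuous_onI] continuous_intros)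
      then show "(\<lambda>\<omega>. (0::'a, f \<omega>)) -` A \<inter> space M \<in> events_of M f"
        by (auto simp: events_of_def intro!: exI[of _ "(\<lambda>c. (0::'a, c)) -` A"])
    qed
    have left: "{(\<lambda>\<omega>. (f \<omega>, 0::real)) -` A \<inter> space M |A. A \<in> sets borel} \<subseteq> events_of M f" for f :: "'w \<Rightarrow> 'a"
    proof safe
      fix A :: "('a \<times> real) set" assume A: "A \<in> sets borel"
      have "(\<lambda>c. (c, 0::real)) -` A \<in> sets borel"
        using A by (auto intro!: measurable_sets_borel[OF borel_measurable_continuous_onI] continuous_intros)
      then show "(\<lambda>\<omega>. (f \<omega>, 0::real)) -` A \<inter> space M \<in> events_of M f"
        by (auto simp: events_of_def intro!: exI[of _ "(\<lambda>c. (c, 0::real)) -` A"])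
    qed
    show "{src s -` A \<inter> space M |A. A \<in> sets borel} \<subseteq> (case s of Src_C i \<Rightarrow> events_of M (C0 i)
        | Src_W2 i j \<Rightarrow> events_of M (W20 i j) | Src_W1 j \<Rightarrow> events_of M (W10 j)
        | Src_data k \<Rightarrow> events_of M (XY k))" for s
      using left right by (cases s) (simp_all add: source_var_def[abs_def] events_of_def)
  qed
  moreover have "src s \<in> borel_measurable M" for s
    by (cases s) (simp_all add: source_var_def[abs_def] flip: borel_prod)
  ultimately show ?thesis by (simp add: indep_vars_def2)
qed

lemma joint_law_src:
  assumes AB: "A \<inter> B = {}" and f: "f \<in> measurable (PiM A (\<lambda>_. borel)) N"
    and g: "g \<in> measurable (PiM B (\<lambda>_. borel)) K"
    and FG: "\<And>\<omega>. F \<omega> = f (\<lambda>s\<in>A. src s \<omega>)" "\<And>\<omega>. G \<omega> = g (\<lambda>s\<in>B. src s \<omega>)"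
  shows "distr M N F \<Otimes>\<^sub>M distr M K G = distr M (N \<Otimes>\<^sub>M K) (\<lambda>\<omega>. (F \<omega>, G \<omega>))"
proof -
  define RA where "RA \<omega> = (\<lambda>s\<in>A. src s \<omega>)" for \<omega>
  define RB where "RB \<omega> = (\<lambda>s\<in>B. src s \<omega>)" for \<omega>
  have joint: "random_variable (PiM A (\<lambda>_. borel)) RA" "random_variable (PiM B (\<lambda>_. borel)) RB"
    "distr M (PiM A (\<lambda>_. borel)) RA \<Otimes>\<^sub>M distr M (PiM B (\<lambda>_. borel)) RB =
      distr M (PiM A (\<lambda>_. borel) \<Otimes>\<^sub>M PiM B (\<lambda>_. borel)) (\<lambda>\<omega>. (RA \<omega>, RB \<omega>))"
    using indep_var_restrict[OF indep_vars_src AB] unfolding indep_var_distribution_eq RA_def RB_def by auto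
  note [measurable] = f g joint(1,2)
  have F: "F = (\<lambda>\<omega>. f (RA \<omega>))" and G: "G = (\<lambda>\<omega>. g (RB \<omega>))"
    using FG by (auto simp: RA_def RB_def)
  have "distr M N F \<Otimes>\<^sub>M distr M K G =
      distr (distr M (PiM A (\<lambda>_. borel)) RA) N f \<Otimes>\<^sub>M distr (distr M (PiM B (\<lambda>_. borel)) RB) K g"
    by (simp add: distr_distr F G o_def)
  also have "\<dots> = distr (distr M (PiM A (\<lambda>_. borel)) RA \<Otimes>\<^sub>M distr M (PiM B (\<lambda>_. borel)) RB) (N \<Otimes>\<^sub>M K)
      (\<lambda>(x, y). (f x, g y))"
    by (rule pair_measure_distr)
      (auto intro!: prob_space_imp_sigma_finite prob_space.prob_space_distr prob_space_distr)
  also have "\<dots> = distr M (N \<Otimes>\<^sub>M K) (\<lambda>\<omega>. (F \<omega>, G \<omega>))"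
    unfolding joint(3) by (subst distr_distr) (auto simp: F G o_def)
  finally show ?thesis .
qed

lemma proj_measurable [measurable]:
  "s \<in> A \<Longrightarrow> (\<lambda>z. fst (z s)) \<in> borel_measurable (PiM A (\<lambda>_. borel :: ('a \<times> real) measure))"
  "s \<in> A \<Longrightarrow> (\<lambda>z. snd (z s)) \<in> borel_measurable (PiM A (\<lambda>_. borel :: ('a \<times> real) measure))"
  by (auto intro!: measurable_compose[OF measurable_component_singleton] borel_measurable_continuous_onI continuous_intros)

lemma prob_space_laws: "prob_space \<pi>" "prob_space mu_c" "prob_space mu_W1" "prob_space mu_W2"
  using laws(1)[of 0] laws(2)[of 0 0] laws(3)[of 0] laws(4)[of 0] by (metis prob_space_distr source_measurable)+

lemma sets_laws [measurable_cong]: "sets mu_c = sets borel" "sets mu_W1 = sets borel" "sets mu_W2 = sets borel"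
  and sets_pi: "sets \<pi> = sets borel"
  using laws(1)[of 0] laws(2)[of 0 0] laws(3)[of 0] laws(4)[of 0] by (metis sets_distr)+

lemma law_W1_W2: "distr M (borel \<Otimes>\<^sub>M borel) (\<lambda>\<omega>. (W10 j \<omega>, W20 i j \<omega>)) = mu_W1 \<Otimes>\<^sub>M mu_W2"
proof -
  have "distr M borel (W10 j) \<Otimes>\<^sub>M distr M borel (W20 i j) = distr M (borel \<Otimes>\<^sub>M borel) (\<lambda>\<omega>. (W10 j \<omega>, W20 i j \<omega>))"
    by (rule joint_law_src[where A = "{Src_W1 j}" and B = "{Src_W2 i j}" and f = "\<lambda>z. fst (z (Src_W1 j))"
          and g = "\<lambda>z. snd (z (Src_W2 i j))"]) (auto simp: source_var_def)
  then show ?thesis by (simp add: laws)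
qed

lemma law_C_W2: "distr M (borel \<Otimes>\<^sub>M borel) (\<lambda>\<omega>. (C0 i \<omega>, W20 i j \<omega>)) = mu_c \<Otimes>\<^sub>M mu_W2"
proof -
  have "distr M borel (C0 i) \<Otimes>\<^sub>M distr M borel (W20 i j) = distr M (borel \<Otimes>\<^sub>M borel) (\<lambda>\<omega>. (C0 i \<omega>, W20 i j \<omega>))"
    by (rule joint_law_src[where A = "{Src_C i}" and B = "{Src_W2 i j}" and f = "\<lambda>z. snd (z (Src_C i))"
          and g = "\<lambda>z. snd (z (Src_W2 i j))"]) (auto simp: source_var_def)
  then show ?thesis by (simp add: laws)
qed

text \<open>The input at which a limit law is evaluated is \<open>h (XY k)\<close>, which covers both a fresh sample
  (\<open>h = fst\<close>) and a deterministic point.\<close>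

lemma hidden_average:
  fixes \<phi> :: "(real \<times> 'a) \<times> ('a \<times> real) \<Rightarrow> real"
  assumes h [measurable]: "h \<in> borel_measurable (borel :: ('a \<times> real) measure)"
    and \<phi>: "\<phi> \<in> borel_measurable ((borel \<Otimes>\<^sub>M borel) \<Otimes>\<^sub>M (borel \<Otimes>\<^sub>M borel))" "\<And>p. \<bar>\<phi> p\<bar> \<le> B"
  shows "expectation (\<lambda>\<omega>. \<bar>\<Sum>j<n. \<phi> ((C0 i \<omega>, h (XY k \<omega>)), (W10 j \<omega>, W20 i j \<omega>)) -
      (\<integral>z. \<phi> ((C0 i \<omega>, h (XY k \<omega>)), z) \<partial>(mu_W1 \<Otimes>\<^sub>M mu_W2))\<bar>) \<le> 2 * B * sqrt (real n)"
proof -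
  have "distr M ((borel \<Otimes>\<^sub>M borel) \<Otimes>\<^sub>M (borel \<Otimes>\<^sub>M borel)) (\<lambda>\<omega>. ((C0 i \<omega>, h (XY k \<omega>)), (W10 m \<omega>, W20 i m \<omega>))) \<Otimes>\<^sub>M distr M (borel \<Otimes>\<^sub>M borel) (\<lambda>\<omega>. (W10 l \<omega>, W20 i l \<omega>)) =
      distr M (((borel \<Otimes>\<^sub>M borel) \<Otimes>\<^sub>M (borel \<Otimes>\<^sub>M borel)) \<Otimes>\<^sub>M (borel \<Otimes>\<^sub>M borel)) (\<lambda>\<omega>. (((C0 i \<omega>, h (XY k \<omega>)), (W10 m \<omega>, W20 i m \<omega>)), (W10 l \<omega>, W20 i l \<omega>)))" if "l \<noteq> m" for l m
    by (rule joint_law_src[where A = "{Src_C i, Src_data k, Src_W1 m, Src_W2 i m}" and B = "{Src_W1 l, Src_W2 i l}"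
          and f = "\<lambda>z. ((snd (z (Src_C i)), h (z (Src_data k))), (fst (z (Src_W1 m)), snd (z (Src_W2 i m))))"
          and g = "\<lambda>z. (fst (z (Src_W1 l)), snd (z (Src_W2 i l)))"])
      (use that in \<open>auto simp: source_var_def intro!: measurable_compose[OF _ h]\<close>)
  then show ?thesis
    using expectation_norm_centered_sum_le[of "\<lambda>\<omega>. (C0 i \<omega>, h (XY k \<omega>))" "borel \<Otimes>\<^sub>M borel" n
        "\<lambda>j \<omega>. (W10 j \<omega>, W20 i j \<omega>)" "borel \<Otimes>\<^sub>M borel" "mu_W1 \<Otimes>\<^sub>M mu_W2" "\<lambda>_. \<phi>" B] \<phi>
    by (simp add: law_W1_W2)
qed

lemma output_average:
  fixes \<phi> :: "'a \<times> real \<Rightarrow> real"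
  assumes h [measurable]: "h \<in> borel_measurable (borel :: ('a \<times> real) measure)"
    and \<phi>: "\<phi> \<in> borel_measurable (borel \<Otimes>\<^sub>M borel)" "\<And>p. \<bar>\<phi> p\<bar> \<le> B"
  shows "expectation (\<lambda>\<omega>. \<bar>\<Sum>i<n. \<phi> (h (XY k \<omega>), C0 i \<omega>) - (\<integral>c. \<phi> (h (XY k \<omega>), c) \<partial>mu_c)\<bar>) \<le> 2 * B * sqrt (real n)"
proof -
  have "distr M (borel \<Otimes>\<^sub>M borel) (\<lambda>\<omega>. (h (XY k \<omega>), C0 m \<omega>)) \<Otimes>\<^sub>M distr M borel (\<lambda>\<omega>. C0 l \<omega>) =
      distr M ((borel \<Otimes>\<^sub>M borel) \<Otimes>\<^sub>M borel) (\<lambda>\<omega>. ((h (XY k \<omega>), C0 m \<omega>), C0 l \<omega>))" if "l \<noteq> m" for l m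
    by (rule joint_law_src[where A = "{Src_C m, Src_data k}" and B = "{Src_C l}"
          and f = "\<lambda>z. (h (z (Src_data k)), snd (z (Src_C m)))" and g = "\<lambda>z. snd (z (Src_C l))"])
      (use that in \<open>auto simp: source_var_def intro!: measurable_compose[OF _ h]\<close>)
  then show ?thesis
    using expectation_norm_centered_sum_le[of "\<lambda>\<omega>. h (XY k \<omega>)" borel n C0 borel mu_c "\<lambda>_. \<phi>" B] \<phi>
    by (simp add: laws)
qed

lemma backward_average:
  fixes \<phi> :: "('a \<times> 'a) \<times> (real \<times> real) \<Rightarrow> real"
  assumes h [measurable]: "h \<in> borel_measurable (borel :: ('a \<times> real) measure)"
    and \<phi>: "\<phi> \<in> borel_measurable ((borel \<Otimes>\<^sub>M borel) \<Otimes>\<^sub>M (borel \<Otimes>\<^sub>M borel))" "\<And>p. \<bar>\<phi> p\<bar> \<le> B"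
  shows "expectation (\<lambda>\<omega>. \<bar>\<Sum>i<n. \<phi> ((W10 j \<omega>, h (XY k \<omega>)), (C0 i \<omega>, W20 i j \<omega>)) -
      (\<integral>z. \<phi> ((W10 j \<omega>, h (XY k \<omega>)), z) \<partial>(mu_c \<Otimes>\<^sub>M mu_W2))\<bar>) \<le> 2 * B * sqrt (real n)"
proof -
  have "distr M ((borel \<Otimes>\<^sub>M borel) \<Otimes>\<^sub>M (borel \<Otimes>\<^sub>M borel)) (\<lambda>\<omega>. ((W10 j \<omega>, h (XY k \<omega>)), (C0 m \<omega>, W20 m j \<omega>))) \<Otimes>\<^sub>M distr M (borel \<Otimes>\<^sub>M borel) (\<lambda>\<omega>. (C0 l \<omega>, W20 l j \<omega>)) =
      distr M (((borel \<Otimes>\<^sub>M borel) \<Otimes>\<^sub>M (borel \<Otimes>\<^sub>M borel)) \<Otimes>\<^sub>M (borel \<Otimes>\<^sub>M borel)) (\<lambda>\<omega>. (((W10 j \<omega>, h (XY k \<omega>)), (C0 m \<omega>, W20 m j \<omega>)), (C0 l \<omega>, W20 l j \<omega>)))" if "l \<noteq> m" for l m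
    by (rule joint_law_src[where A = "{Src_W1 j, Src_data k, Src_C m, Src_W2 m j}" and B = "{Src_C l, Src_W2 l j}"
          and f = "\<lambda>z. ((fst (z (Src_W1 j)), h (z (Src_data k))), (snd (z (Src_C m)), snd (z (Src_W2 m j))))"
          and g = "\<lambda>z. (snd (z (Src_C l)), snd (z (Src_W2 l j)))"])
      (use that in \<open>auto simp: source_var_def intro!: measurable_compose[OF _ h]\<close>)
  then show ?thesis
    using expectation_norm_centered_sum_le[of "\<lambda>\<omega>. (W10 j \<omega>, h (XY k \<omega>))" "borel \<Otimes>\<^sub>M borel" n
        "\<lambda>i \<omega>. (C0 i \<omega>, W20 i j \<omega>)" "borel \<Otimes>\<^sub>M borel" "mu_c \<Otimes>\<^sub>M mu_W2" "\<lambda>_. \<phi>" B] \<phi>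
    by (simp add: law_C_W2)
qed

lemma sample_average:
  fixes \<phi> :: "nat \<Rightarrow> (real \<times> 'a) \<times> ('a \<times> real) \<Rightarrow> 'b::euclidean_space"
  assumes \<phi>: "\<And>l. \<phi> l \<in> borel_measurable ((borel \<Otimes>\<^sub>M borel) \<Otimes>\<^sub>M borel)" "\<And>l p. norm (\<phi> l p) \<le> B"
  shows "expectation (\<lambda>\<omega>. norm (\<Sum>l<n. \<phi> l ((C0 i \<omega>, W10 j \<omega>), XY l \<omega>) -
      (\<integral>z. \<phi> l ((C0 i \<omega>, W10 j \<omega>), z) \<partial>\<pi>))) \<le> 2 * B * sqrt (real n)"
proof -
  have "distr M ((borel \<Otimes>\<^sub>M borel) \<Otimes>\<^sub>M borel) (\<lambda>\<omega>. ((C0 i \<omega>, W10 j \<omega>), XY m \<omega>)) \<Otimes>\<^sub>M distr M borel (\<lambda>\<omega>. XY l \<omega>) =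
      distr M (((borel \<Otimes>\<^sub>M borel) \<Otimes>\<^sub>M borel) \<Otimes>\<^sub>M borel) (\<lambda>\<omega>. (((C0 i \<omega>, W10 j \<omega>), XY m \<omega>), XY l \<omega>))" if "l \<noteq> m" for l m
    by (rule joint_law_src[where A = "{Src_C i, Src_W1 j, Src_data m}" and B = "{Src_data l}"
          and f = "\<lambda>z. ((snd (z (Src_C i)), fst (z (Src_W1 j))), z (Src_data m))" and g = "\<lambda>z. z (Src_data l)"])
      (use that in \<open>auto simp: source_var_def\<close>)
  then show ?thesis
    using expectation_norm_centered_sum_le[of "\<lambda>\<omega>. (C0 i \<omega>, W10 j \<omega>)" "borel \<Otimes>\<^sub>M borel" n XY borel \<pi> \<phi> B] \<phi>
    by (simp add: laws)
qed

end

section \<open>Pathwise estimates for gradient descent\<close>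

definition avg :: "nat \<Rightarrow> (nat \<Rightarrow> 'b::real_vector) \<Rightarrow> 'b" where
  "avg n f = (1 / real n) *\<^sub>R (\<Sum>i<n. f i)"

lemma avg_real: "avg n f = 1 / real n * (\<Sum>i<n. f i)" for f :: "nat \<Rightarrow> real"
  by (simp add: avg_def)

lemma avg_mono: "(\<And>i. i < n \<Longrightarrow> f i \<le> g i) \<Longrightarrow> avg n f \<le> avg n g" for f g :: "nat \<Rightarrow> real"
  by (auto simp: avg_real intro!: mult_left_mono divide_right_mono sum_mono)

lemma avg_add: "avg n (\<lambda>i. f i + g i) = avg n f + avg n g"
  by (simp add: avg_def sum.distrib scaleR_add_right)

lemma avg_diff: "avg n (\<lambda>i. f i - g i) = avg n f - avg n g"
  by (simp add: avg_def sum_subtractf scaleR_diff_right)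

lemma avg_cmult: "avg n (\<lambda>i. c * f i) = c * avg n f" for c :: real
  by (simp add: avg_real sum_distrib_left mult.left_commute)

lemma avg_const: "0 < n \<Longrightarrow> avg n (\<lambda>_. c) = c"
  by (simp add: avg_def sum_constant_scaleR)

lemma avg_nonneg: "(\<And>i. i < n \<Longrightarrow> 0 \<le> f i) \<Longrightarrow> 0 \<le> avg n f" for f :: "nat \<Rightarrow> real"
  by (auto simp: avg_real intro!: sum_nonneg divide_nonneg_nonneg)

lemma norm_avg_le: "norm (avg n f) \<le> avg n (\<lambda>i. norm (f i))" for f :: "nat \<Rightarrow> 'b::real_normed_vector"
  by (auto simp: avg_def intro!: divide_right_mono norm_sum)

lemma norm_avg_bound:
  fixes f :: "nat \<Rightarrow> 'b::real_normed_vector"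
  assumes "\<And>i. i < n \<Longrightarrow> norm (f i) \<le> B" "0 \<le> B"
  shows "norm (avg n f) \<le> B"
proof (cases "n = 0")
  case False
  have "norm (avg n f) \<le> avg n (\<lambda>_. B)" using assms by (intro order_trans[OF norm_avg_le] avg_mono)
  then show ?thesis using False by (simp add: avg_const)
qed (simp add: avg_def assms)

lemma avg_diff_le:
  fixes f g :: "nat \<Rightarrow> real"
  shows "\<bar>avg n f - c\<bar> \<le> avg n (\<lambda>i. \<bar>f i - g i\<bar>) + \<bar>avg n g - c\<bar>"
  using norm_avg_le[of n "\<lambda>i. f i - g i"] by (simp add: avg_diff)

lemma Z2_avg: "Z2 \<sigma> N \<theta> i x = avg N (\<lambda>j. pW2 \<theta> i j * \<sigma> (pW1 \<theta> j \<bullet> x))"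
  by (simp add: Z2_def H1_def avg_real)

lemma net_avg: "net \<sigma> N n \<theta> x = avg n (\<lambda>i. pC \<theta> i * \<sigma> (Z2 \<sigma> N \<theta> i x))"
  by (simp add: net_def H2_def avg_real)

definition grad_C where
  "grad_C \<sigma> N n \<theta> x y i = (y - net \<sigma> N n \<theta> x) * \<sigma> (Z2 \<sigma> N \<theta> i x)"

definition backprop where
  "backprop \<sigma> N n \<theta> x j = avg n (\<lambda>i. pC \<theta> i * deriv \<sigma> (Z2 \<sigma> N \<theta> i x) * pW2 \<theta> i j)"

definition grad_W1 where
  "grad_W1 \<sigma> N n \<theta> x y j = ((y - net \<sigma> N n \<theta> x) * backprop \<sigma> N n \<theta> x j * deriv \<sigma> (pW1 \<theta> j \<bullet> x)) *\<^sub>R x"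

definition grad_W2 where
  "grad_W2 \<sigma> N n \<theta> x y i j = (y - net \<sigma> N n \<theta> x) * pC \<theta> i * deriv \<sigma> (Z2 \<sigma> N \<theta> i x) * \<sigma> (pW1 \<theta> j \<bullet> x)"

lemma sgd_step_simps:
  assumes "0 < n"
  shows "pC (sgd_step \<sigma> N n (x, y) \<theta>) i = pC \<theta> i + (1 / real N) *\<^sub>R grad_C \<sigma> N n \<theta> x y i"
    "pW1 (sgd_step \<sigma> N n (x, y) \<theta>) j = pW1 \<theta> j + (1 / real N) *\<^sub>R grad_W1 \<sigma> N n \<theta> x y j"
    "pW2 (sgd_step \<sigma> N n (x, y) \<theta>) i j = pW2 \<theta> i j + (1 / real N) *\<^sub>R grad_W2 \<sigma> N n \<theta> x y i j"
  using assms
  by (simp_all add: sgd_step_def rate_C_def rate_W1_def rate_W2_def grad_C_def grad_W1_def grad_W2_def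
      backprop_def H2_def H1_def avg_real)

definition "dist_C n \<theta> Ct = avg n (\<lambda>i. \<bar>pC \<theta> i - Ct i\<bar>)"
definition "dist_W1 N \<theta> W1t = avg N (\<lambda>j. norm (pW1 \<theta> j - W1t j))"
definition "dist_W2 n N \<theta> W2t = avg n (\<lambda>i. avg N (\<lambda>j. \<bar>pW2 \<theta> i j - W2t i j\<bar>))"
definition "fluct_Z \<sigma> N W1t W2t Zt x i = \<bar>avg N (\<lambda>j. W2t i j * \<sigma> (W1t j \<bullet> x)) - Zt i\<bar>"
definition "fluct_g \<sigma> n Ct Zt G = \<bar>avg n (\<lambda>i. Ct i * \<sigma> (Zt i)) - G\<bar>"
definition "fluct_V \<sigma> n Ct W2t Zt Vt j = \<bar>avg n (\<lambda>i. Ct i * deriv \<sigma> (Zt i) * W2t i j) - Vt j\<bar>"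

context mf_data begin

lemma abs_net_le:
  assumes "\<And>i. i < n \<Longrightarrow> \<bar>pC \<theta> i\<bar> \<le> r" "0 \<le> r"
  shows "\<bar>net \<sigma> N n \<theta> x\<bar> \<le> r * S"
  unfolding net_avg real_norm_def[symmetric]
  by (rule norm_avg_bound) (use assms sigma_bound S_nonneg in \<open>auto simp: abs_mult intro!: mult_mono\<close>)

lemma abs_back_le:
  assumes "\<And>i. i < n \<Longrightarrow> \<bar>pC \<theta> i\<bar> \<le> r" "\<And>i. i < n \<Longrightarrow> \<bar>pW2 \<theta> i j\<bar> \<le> r'" "0 \<le> r" "0 \<le> r'"
  shows "\<bar>backprop \<sigma> N n \<theta> x j\<bar> \<le> r * S * r'"
  unfolding backprop_def real_norm_def[symmetric]
  by (rule norm_avg_bound) (use assms sigma_bound S_nonneg in \<open>auto simp: abs_mult intro!: mult_mono\<close>)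

definition "rc_C m = (m + 1) * exp (S * (Q + S))"
definition "rc_W2 m = m + (Q + rc_C m * S) * rc_C m * S * S"
definition "rc_W1 m = m + (Q + rc_C m * S) * (rc_C m * S * rc_W2 m) * S * Q"
definition "rc m = max m (max (rc_C m) (max (rc_W2 m) (rc_W1 m)))"

context
  fixes n N :: nat and \<theta>0 :: "'a params" and xy :: "nat \<Rightarrow> 'a \<times> real" and m :: real
  assumes n: "0 < n" and N: "0 < N"
    and init: "\<And>i. i < n \<Longrightarrow> \<bar>pC \<theta>0 i\<bar> \<le> m" "\<And>i j. i < n \<Longrightarrow> j < N \<Longrightarrow> \<bar>pW2 \<theta>0 i j\<bar> \<le> m"
      "\<And>j. j < N \<Longrightarrow> norm (pW1 \<theta>0 j) \<le> m"
    and xy: "\<And>k. norm (fst (xy k)) \<le> Q" "\<And>k. \<bar>snd (xy k)\<bar> \<le> Q"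
    and m: "0 \<le> m"
begin

abbreviation (input) "iter \<equiv> sgd \<sigma> N n \<theta>0 xy"

lemma sgd_Suc_simps:
  "pC (iter (Suc k)) i = pC (iter k) i + (1 / real N) *\<^sub>R grad_C \<sigma> N n (iter k) (fst (xy k)) (snd (xy k)) i"
  "pW1 (iter (Suc k)) j = pW1 (iter k) j + (1 / real N) *\<^sub>R grad_W1 \<sigma> N n (iter k) (fst (xy k)) (snd (xy k)) j"
  "pW2 (iter (Suc k)) i j = pW2 (iter k) i j + (1 / real N) *\<^sub>R grad_W2 \<sigma> N n (iter k) (fst (xy k)) (snd (xy k)) i j"
  using sgd_step_simps[OF n, of \<sigma> N "fst (xy k)" "snd (xy k)"] by simp_all

lemma linear_growth:
  fixes X :: "nat \<Rightarrow> 'b::real_normed_vector"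
  assumes "norm (X 0) \<le> m" "\<And>k. k < N \<Longrightarrow> X (Suc k) = X k + (1 / real N) *\<^sub>R F k"
    "\<And>k. k < N \<Longrightarrow> norm (F k) \<le> B" "k \<le> N"
  shows "norm (X k) \<le> m + B"
proof -
  have B: "0 \<le> B" using assms(3)[of 0] N norm_ge_zero order_trans by blast
  have "norm (X k) \<le> m + real k / real N * B" if "k \<le> N" for k
    using that
  proof (induction k)
    case (Suc k)
    have "norm (X (Suc k)) \<le> norm (X k) + 1 / real N * norm (F k)"
      using assms(2)[of k] Suc.prems norm_triangle_ineq[of "X k" "(1 / real N) *\<^sub>R F k"] by simp
    also have "\<dots> \<le> (m + real k / real N * B) + 1 / real N * B"
      using Suc assms(3)[of k] by (intro add_mono mult_left_mono) auto
    also have "\<dots> = m + real (Suc k) / real N * B"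
      by (simp add: add_divide_distrib algebra_simps)
    finally show ?case .
  qed (use assms in simp)
  from this[OF assms(4)] show ?thesis
    using assms(4) N B mult_right_mono[of "real k / real N" 1 B] by simp
qed

lemma sgd_C_bound:
  assumes "k \<le> N" "i < n"
  shows "\<bar>pC (iter k) i\<bar> \<le> (m + 1) * exp (S * (Q + S))"
proof -
  define l where "l = S * (Q + S)"
  have l: "0 \<le> l" using S_nonneg Q_nonneg by (simp add: l_def)
  have "\<forall>i<n. \<bar>pC (iter k) i\<bar> \<le> (m + 1) * (1 + l / real N) ^ k" for k
  proof (induction k)
    case 0
    then show ?case using init(1) by (force simp: add_increasing2)
  next
    case (Suc k)
    define r where "r = (m + 1) * (1 + l / real N) ^ k"
    have "1 \<le> (1 + l / real N) ^ k" using l by (intro one_le_power) simp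
    then have "(m + 1) * 1 \<le> r" unfolding r_def using m by (intro mult_left_mono) auto
    then have r: "1 \<le> r" using m by simp
    show ?case
    proof (intro allI impI)
      fix i assume i: "i < n"
      have "\<bar>grad_C \<sigma> N n (iter k) (fst (xy k)) (snd (xy k)) i\<bar> \<le> (Q + r * S) * S"
        using abs_net_le[of n "iter k" r N "fst (xy k)"] Suc r xy[of k] sigma_bound S_nonneg Q_nonneg
        unfolding grad_C_def abs_mult by (intro mult_mono) (auto simp: r_def)
      also have "\<dots> \<le> (Q * r + r * S) * S"
        using r Q_nonneg S_nonneg by (intro mult_right_mono add_mono) (auto simp: mult_le_cancel_left1)
      also have "\<dots> = l * r" by (simp add: l_def algebra_simps)
      finally have "\<bar>pC (iter (Suc k)) i\<bar> \<le> r + 1 / real N * (l * r)"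
        using Suc i unfolding sgd_Suc_simps r_def[symmetric]
        by (intro order_trans[OF abs_triangle_ineq] add_mono) (auto simp: r_def abs_mult divide_right_mono)
      also have "r + 1 / real N * (l * r) = r * (1 + l / real N)" by (simp add: distrib_left)
      also have "\<dots> = (m + 1) * (1 + l / real N) ^ Suc k" by (simp add: r_def mult_ac)
      finally show "\<bar>pC (iter (Suc k)) i\<bar> \<le> (m + 1) * (1 + l / real N) ^ Suc k" .
    qed
  qed
  moreover have "(1 + l / real N) ^ k \<le> exp l"
  proof -
    have "(1 + l / real N) ^ k \<le> (1 + l / real N) ^ N" using l assms by (intro power_increasing) auto
    also have "\<dots> \<le> exp l" using N l by (intro exp_ge_one_plus_x_over_n_power_n) auto
    finally show ?thesis .
  qed
  ultimately show ?thesis using assms m unfolding l_def[symmetric]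
    by (meson mult_left_mono order_trans add_nonneg_nonneg zero_le_one)
qed

lemma rc_nonneg: "0 \<le> rc_C m" "0 \<le> rc_W2 m"
  using m S_nonneg Q_nonneg by (auto simp: rc_C_def rc_W2_def)

lemma residual_le:
  assumes "k \<le> N"
  shows "\<bar>snd (xy k) - net \<sigma> N n (iter k) x\<bar> \<le> Q + rc_C m * S"
  using abs_net_le[of n "iter k" "rc_C m" N x] sgd_C_bound[OF assms] rc_nonneg xy[of k]
  by (simp add: rc_C_def)

lemma sgd_W2_bound:
  assumes "k \<le> N" "i < n" "j < N"
  shows "\<bar>pW2 (iter k) i j\<bar> \<le> rc_W2 m"
proof -
  have "norm (pW2 (iter k) i j) \<le> m + (Q + rc_C m * S) * rc_C m * S * S"
  proof (rule linear_growth[where X = "\<lambda>k. pW2 (iter k) i j", OF _ sgd_Suc_simps(3)])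
    show "norm (grad_W2 \<sigma> N n (iter k) (fst (xy k)) (snd (xy k)) i j) \<le> (Q + rc_C m * S) * rc_C m * S * S"
      if "k < N" for k
      using residual_le[of k "fst (xy k)"] sgd_C_bound[of k i] that assms sigma_bound rc_nonneg S_nonneg Q_nonneg
      unfolding grad_W2_def real_norm_def abs_mult
      by (intro mult_mono) (auto simp: rc_C_def intro!: mult_nonneg_nonneg)
  qed (use init assms in auto)
  then show ?thesis by (simp add: rc_W2_def)
qed

lemma sgd_W1_bound:
  assumes "k \<le> N" "j < N"
  shows "norm (pW1 (iter k) j) \<le> rc_W1 m"
  unfolding rc_W1_def
proof (rule linear_growth[where X = "\<lambda>k. pW1 (iter k) j", OF _ sgd_Suc_simps(2)])
  show "norm (grad_W1 \<sigma> N n (iter k) (fst (xy k)) (snd (xy k)) j)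
      \<le> (Q + rc_C m * S) * (rc_C m * S * rc_W2 m) * S * Q" if "k < N" for k
    using residual_le[of k "fst (xy k)"] sgd_C_bound[of k] sgd_W2_bound[of k _ j] that assms sigma_bound rc_nonneg
      S_nonneg Q_nonneg abs_back_le[of n "iter k" "rc_C m" j "rc_W2 m" N "fst (xy k)"] xy(1)[of k]
    unfolding grad_W1_def norm_scaleR real_norm_def abs_mult
    by (intro mult_mono) (auto simp: rc_C_def intro!: mult_nonneg_nonneg)
qed (use init assms in auto)

lemma sgd_bounds:
  assumes "k \<le> N"
  shows "i < n \<Longrightarrow> \<bar>pC (iter k) i\<bar> \<le> rc m" "i < n \<Longrightarrow> j < N \<Longrightarrow> \<bar>pW2 (iter k) i j\<bar> \<le> rc m"
    "j < N \<Longrightarrow> norm (pW1 (iter k) j) \<le> rc m"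
  using sgd_C_bound[OF assms] sgd_W2_bound[OF assms] sgd_W1_bound[OF assms]
  unfolding rc_def rc_C_def[symmetric] by (meson le_max_iff_disj)+

end

definition "K_Z R = S + R * (S * Q) + 1"
definition "K_g R = R * (S * K_Z R) + S + 1"
definition "K_V R = R * S + R * (R * (S * K_Z R)) + R * S + 1"
definition "K_step R = ((Q + R * S) * (S * K_Z R) + S * K_g R) +
  Q * ((Q + R * S) * (R * S * R) * (S * Q) + S * ((Q + R * S) * K_V R + (R * S * R) * K_g R)) +
  ((Q + R * S) * R * S * (S * Q) + S * ((Q + R * S) * R * (S * K_Z R) + S * ((Q + R * S) + R * K_g R)))"

text \<open>\<open>Ct\<close>, \<open>W1t\<close>, \<open>W2t\<close> stand for the limiting parameters and \<open>Zt\<close>, \<open>G\<close>, \<open>Vt\<close> for the limits of the three averages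
  in the network; the fluctuations compare the latter with the averages over the limiting parameters.\<close>

context
  fixes n N :: nat and \<theta> :: "'a params" and x :: 'a and R :: real
    and Ct :: "nat \<Rightarrow> real" and W1t :: "nat \<Rightarrow> 'a" and W2t :: "nat \<Rightarrow> nat \<Rightarrow> real"
    and Zt :: "nat \<Rightarrow> real" and G :: real and Vt :: "nat \<Rightarrow> real"
  assumes n: "0 < n" and N: "0 < N" and x: "norm x \<le> Q"
    and b\<theta>: "\<And>i. i < n \<Longrightarrow> \<bar>pC \<theta> i\<bar> \<le> R" "\<And>i j. i < n \<Longrightarrow> j < N \<Longrightarrow> \<bar>pW2 \<theta> i j\<bar> \<le> R"
    and bt: "\<And>i. i < n \<Longrightarrow> \<bar>Ct i\<bar> \<le> R" "\<And>i j. i < n \<Longrightarrow> j < N \<Longrightarrow> \<bar>W2t i j\<bar> \<le> R"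
    and bG: "\<bar>G\<bar> \<le> R * S" and bV: "\<And>j. j < N \<Longrightarrow> \<bar>Vt j\<bar> \<le> R * S * R"
    and R: "0 \<le> R"
begin

abbreviation (input) "eC \<equiv> dist_C n \<theta> Ct"
abbreviation (input) "eW1 \<equiv> dist_W1 N \<theta> W1t"
abbreviation (input) "eW2 \<equiv> dist_W2 n N \<theta> W2t"
abbreviation (input) "flZ \<equiv> fluct_Z \<sigma> N W1t W2t Zt x"
abbreviation (input) "flg \<equiv> fluct_g \<sigma> n Ct Zt G"
abbreviation (input) "flV \<equiv> fluct_V \<sigma> n Ct W2t Zt Vt"
abbreviation (input) "eZ i \<equiv> \<bar>Z2 \<sigma> N \<theta> i x - Zt i\<bar>"
abbreviation (input) "eg \<equiv> \<bar>net \<sigma> N n \<theta> x - G\<bar>"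
abbreviation (input) "etotal \<equiv> eC + eW1 + eW2 + avg n flZ + flg + avg N flV"

lemma dist_nonneg: "0 \<le> eC" "0 \<le> eW1" "0 \<le> eW2" "0 \<le> avg n flZ" "0 \<le> flg" "0 \<le> avg N flV"
  by (auto simp: dist_C_def dist_W1_def dist_W2_def fluct_Z_def fluct_g_def fluct_V_def intro!: avg_nonneg)

lemma Z_diff:
  assumes i: "i < n"
  shows "eZ i \<le> S * avg N (\<lambda>j. \<bar>pW2 \<theta> i j - W2t i j\<bar>) + R * (S * Q) * eW1 + flZ i"
proof -
  have "eZ i \<le> avg N (\<lambda>j. \<bar>pW2 \<theta> i j * \<sigma> (pW1 \<theta> j \<bullet> x) - W2t i j * \<sigma> (W1t j \<bullet> x)\<bar>) + flZ i"
    unfolding Z2_avg fluct_Z_def by (rule avg_diff_le)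
  also have "avg N (\<lambda>j. \<bar>pW2 \<theta> i j * \<sigma> (pW1 \<theta> j \<bullet> x) - W2t i j * \<sigma> (W1t j \<bullet> x)\<bar>)
      \<le> avg N (\<lambda>j. S * \<bar>pW2 \<theta> i j - W2t i j\<bar> + R * (S * Q) * norm (pW1 \<theta> j - W1t j))"
  proof (rule avg_mono)
    fix j assume j: "j < N"
    have "\<bar>pW2 \<theta> i j * \<sigma> (pW1 \<theta> j \<bullet> x) - W2t i j * \<sigma> (W1t j \<bullet> x)\<bar>
        \<le> R * \<bar>\<sigma> (pW1 \<theta> j \<bullet> x) - \<sigma> (W1t j \<bullet> x)\<bar> + S * \<bar>pW2 \<theta> i j - W2t i j\<bar>"
      using b\<theta>(2)[OF i j] sigma_bound by (intro abs_mult_diff_le)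
    also have "\<dots> \<le> R * (S * Q * norm (pW1 \<theta> j - W1t j)) + S * \<bar>pW2 \<theta> i j - W2t i j\<bar>"
      using sigma_inner_diff(1)[OF x] R by (intro add_right_mono mult_left_mono)
    finally show "\<bar>pW2 \<theta> i j * \<sigma> (pW1 \<theta> j \<bullet> x) - W2t i j * \<sigma> (W1t j \<bullet> x)\<bar>
        \<le> S * \<bar>pW2 \<theta> i j - W2t i j\<bar> + R * (S * Q) * norm (pW1 \<theta> j - W1t j)" by (simp add: mult.assoc)
  qed
  finally show ?thesis by (simp add: avg_add avg_cmult dist_W1_def)
qed

lemma avg_Z_diff: "avg n eZ \<le> S * eW2 + R * (S * Q) * eW1 + avg n flZ"
proof -
  have "avg n eZ \<le> avg n (\<lambda>i. S * avg N (\<lambda>j. \<bar>pW2 \<theta> i j - W2t i j\<bar>) + R * (S * Q) * eW1 + flZ i)"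
    by (rule avg_mono) (rule Z_diff)
  then show ?thesis using n by (simp add: avg_add avg_cmult avg_const dist_W2_def)
qed

lemma sigma_Z_diff:
  "\<bar>\<sigma> (Z2 \<sigma> N \<theta> i x) - \<sigma> (Zt i)\<bar> \<le> S * eZ i" "\<bar>deriv \<sigma> (Z2 \<sigma> N \<theta> i x) - deriv \<sigma> (Zt i)\<bar> \<le> S * eZ i"
  by (rule sigma_lip)+

lemma g_diff: "eg \<le> R * (S * avg n eZ) + S * eC + flg"
proof -
  have "eg \<le> avg n (\<lambda>i. \<bar>pC \<theta> i * \<sigma> (Z2 \<sigma> N \<theta> i x) - Ct i * \<sigma> (Zt i)\<bar>) + flg"
    unfolding net_avg fluct_g_def by (rule avg_diff_le)
  also have "avg n (\<lambda>i. \<bar>pC \<theta> i * \<sigma> (Z2 \<sigma> N \<theta> i x) - Ct i * \<sigma> (Zt i)\<bar>)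
      \<le> avg n (\<lambda>i. R * (S * eZ i) + S * \<bar>pC \<theta> i - Ct i\<bar>)"
  proof (rule avg_mono)
    fix i assume i: "i < n"
    have "\<bar>pC \<theta> i * \<sigma> (Z2 \<sigma> N \<theta> i x) - Ct i * \<sigma> (Zt i)\<bar>
        \<le> R * \<bar>\<sigma> (Z2 \<sigma> N \<theta> i x) - \<sigma> (Zt i)\<bar> + S * \<bar>pC \<theta> i - Ct i\<bar>"
      using b\<theta>(1)[OF i] sigma_bound by (intro abs_mult_diff_le)
    also have "\<dots> \<le> R * (S * eZ i) + S * \<bar>pC \<theta> i - Ct i\<bar>"
      using sigma_Z_diff R by (intro add_right_mono mult_left_mono)
    finally show "\<bar>pC \<theta> i * \<sigma> (Z2 \<sigma> N \<theta> i x) - Ct i * \<sigma> (Zt i)\<bar> \<le> R * (S * eZ i) + S * \<bar>pC \<theta> i - Ct i\<bar>" .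
  qed
  finally show ?thesis by (simp add: avg_add avg_cmult dist_C_def)
qed

lemma V_diff:
  assumes j: "j < N"
  shows "\<bar>backprop \<sigma> N n \<theta> x j - Vt j\<bar> \<le>
    R * S * avg n (\<lambda>i. \<bar>pW2 \<theta> i j - W2t i j\<bar>) + R * (R * (S * avg n eZ)) + R * S * eC + flV j"
proof -
  have "\<bar>backprop \<sigma> N n \<theta> x j - Vt j\<bar> \<le> avg n (\<lambda>i. \<bar>pC \<theta> i * deriv \<sigma> (Z2 \<sigma> N \<theta> i x) * pW2 \<theta> i j
      - Ct i * deriv \<sigma> (Zt i) * W2t i j\<bar>) + flV j"
    unfolding backprop_def fluct_V_def by (rule avg_diff_le)
  also have "avg n (\<lambda>i. \<bar>pC \<theta> i * deriv \<sigma> (Z2 \<sigma> N \<theta> i x) * pW2 \<theta> i j - Ct i * deriv \<sigma> (Zt i) * W2t i j\<bar>)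
      \<le> avg n (\<lambda>i. R * S * \<bar>pW2 \<theta> i j - W2t i j\<bar> + R * (R * (S * eZ i) + S * \<bar>pC \<theta> i - Ct i\<bar>))"
  proof (rule avg_mono)
    fix i assume i: "i < n"
    have "\<bar>pC \<theta> i * deriv \<sigma> (Z2 \<sigma> N \<theta> i x) * pW2 \<theta> i j - Ct i * deriv \<sigma> (Zt i) * W2t i j\<bar>
        \<le> R * S * \<bar>pW2 \<theta> i j - W2t i j\<bar> + R * \<bar>pC \<theta> i * deriv \<sigma> (Z2 \<sigma> N \<theta> i x) - Ct i * deriv \<sigma> (Zt i)\<bar>"
      using b\<theta>(1)[OF i] bt(2)[OF i j] sigma_bound R S_nonneg
      by (intro abs_mult_diff_le) (auto simp: abs_mult intro!: mult_mono)
    also have "\<bar>pC \<theta> i * deriv \<sigma> (Z2 \<sigma> N \<theta> i x) - Ct i * deriv \<sigma> (Zt i)\<bar>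
        \<le> R * \<bar>deriv \<sigma> (Z2 \<sigma> N \<theta> i x) - deriv \<sigma> (Zt i)\<bar> + S * \<bar>pC \<theta> i - Ct i\<bar>"
      using b\<theta>(1)[OF i] sigma_bound by (intro abs_mult_diff_le)
    also have "\<dots> \<le> R * (S * eZ i) + S * \<bar>pC \<theta> i - Ct i\<bar>"
      using sigma_Z_diff R by (intro add_right_mono mult_left_mono)
    finally show "\<bar>pC \<theta> i * deriv \<sigma> (Z2 \<sigma> N \<theta> i x) * pW2 \<theta> i j - Ct i * deriv \<sigma> (Zt i) * W2t i j\<bar>
        \<le> R * S * \<bar>pW2 \<theta> i j - W2t i j\<bar> + R * (R * (S * eZ i) + S * \<bar>pC \<theta> i - Ct i\<bar>)"
      using R by (simp add: mult_left_mono)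
  qed
  finally show ?thesis by (simp add: avg_add avg_cmult dist_C_def algebra_simps)
qed

lemma total_bounds:
  "avg n eZ \<le> K_Z R * etotal" "eg \<le> K_g R * etotal"
  "avg N (\<lambda>j. \<bar>backprop \<sigma> N n \<theta> x j - Vt j\<bar>) \<le> K_V R * etotal"
proof -
  note nn = dist_nonneg
  have T: "0 \<le> etotal" "eC \<le> etotal" "eW1 \<le> etotal" "eW2 \<le> etotal" "avg n flZ \<le> etotal" "flg \<le> etotal" "avg N flV \<le> etotal"
    using nn by linarith+
  note S = S_nonneg and Q = Q_nonneg
  have "avg n eZ \<le> S * etotal + R * (S * Q) * etotal + etotal"
    using T S Q R by (intro order_trans[OF avg_Z_diff] add_mono mult_left_mono) auto
  then show Z: "avg n eZ \<le> K_Z R * etotal" by (simp add: K_Z_def algebra_simps)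
  have "eg \<le> R * (S * (K_Z R * etotal)) + S * etotal + etotal"
    using T S Q R Z by (intro order_trans[OF g_diff] add_mono mult_left_mono) auto
  then show "eg \<le> K_g R * etotal" by (simp add: K_g_def algebra_simps)
  have swap: "avg N (\<lambda>j. avg n (\<lambda>i. \<bar>pW2 \<theta> i j - W2t i j\<bar>)) = eW2"
    unfolding dist_W2_def avg_def by (simp add: sum_distrib_left sum.swap[of _ "{..<N}"] mult.commute[of "real N"])
  have "avg N (\<lambda>j. \<bar>backprop \<sigma> N n \<theta> x j - Vt j\<bar>) \<le> avg N (\<lambda>j. R * S * avg n (\<lambda>i. \<bar>pW2 \<theta> i j - W2t i j\<bar>)
      + R * (R * (S * avg n eZ)) + R * S * eC + flV j)"
    by (rule avg_mono) (rule V_diff)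
  also have "\<dots> = R * S * eW2 + R * (R * (S * avg n eZ)) + R * S * eC + avg N flV"
    using N swap by (simp add: avg_add avg_cmult avg_const)
  also have "\<dots> \<le> R * S * etotal + R * (R * (S * (K_Z R * etotal))) + R * S * etotal + etotal"
    using T S Q R Z by (intro add_mono mult_left_mono) auto
  finally show "avg N (\<lambda>j. \<bar>backprop \<sigma> N n \<theta> x j - Vt j\<bar>) \<le> K_V R * etotal" by (simp add: K_V_def algebra_simps)
qed

lemma step_diff:
  assumes y: "\<bar>y\<bar> \<le> Q"
  shows "avg n (\<lambda>i. \<bar>grad_C \<sigma> N n \<theta> x y i - (y - G) * \<sigma> (Zt i)\<bar>) +
    avg N (\<lambda>j. norm (grad_W1 \<sigma> N n \<theta> x y j - ((y - G) * Vt j * deriv \<sigma> (W1t j \<bullet> x)) *\<^sub>R x)) +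
    avg n (\<lambda>i. avg N (\<lambda>j. \<bar>grad_W2 \<sigma> N n \<theta> x y i j - (y - G) * Ct i * deriv \<sigma> (Zt i) * \<sigma> (W1t j \<bullet> x)\<bar>))
    \<le> K_step R * etotal"
proof -
  note S = S_nonneg and Q = Q_nonneg
  define P where "P = Q + R * S"
  have P: "0 \<le> P" using R S Q by (simp add: P_def)
  define g where "g = net \<sigma> N n \<theta> x"
  have res: "\<bar>y - g\<bar> \<le> P" "\<bar>y - G\<bar> \<le> P"
    using abs_net_le[of n \<theta> R N x] b\<theta>(1) R y bG by (auto simp: P_def g_def)
  have resd: "\<bar>(y - g) - (y - G)\<bar> = eg" by (simp add: g_def abs_minus_commute)
  have T: "0 \<le> etotal" "eC \<le> etotal" "eW1 \<le> etotal" using dist_nonneg by linarith+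
  have C: "avg n (\<lambda>i. \<bar>grad_C \<sigma> N n \<theta> x y i - (y - G) * \<sigma> (Zt i)\<bar>) \<le> P * (S * (K_Z R * etotal)) + S * (K_g R * etotal)"
  proof -
    have "avg n (\<lambda>i. \<bar>grad_C \<sigma> N n \<theta> x y i - (y - G) * \<sigma> (Zt i)\<bar>) \<le> avg n (\<lambda>i. P * (S * eZ i) + S * eg)"
    proof (rule avg_mono)
      fix i
      have "\<bar>grad_C \<sigma> N n \<theta> x y i - (y - G) * \<sigma> (Zt i)\<bar> \<le> P * \<bar>\<sigma> (Z2 \<sigma> N \<theta> i x) - \<sigma> (Zt i)\<bar> + S * \<bar>(y - g) - (y - G)\<bar>"
        unfolding grad_C_def g_def[symmetric] using res sigma_bound by (intro abs_mult_diff_le)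
      also have "\<dots> \<le> P * (S * eZ i) + S * eg"
        unfolding resd using sigma_Z_diff P by (intro add_right_mono mult_left_mono)
      finally show "\<bar>grad_C \<sigma> N n \<theta> x y i - (y - G) * \<sigma> (Zt i)\<bar> \<le> P * (S * eZ i) + S * eg" .
    qed
    also have "\<dots> = P * (S * avg n eZ) + S * eg" using n by (simp add: avg_add avg_cmult avg_const)
    also have "\<dots> \<le> P * (S * (K_Z R * etotal)) + S * (K_g R * etotal)"
      using total_bounds P S by (intro add_mono mult_left_mono) auto
    finally show ?thesis .
  qed
  have W1: "avg N (\<lambda>j. norm (grad_W1 \<sigma> N n \<theta> x y j - ((y - G) * Vt j * deriv \<sigma> (W1t j \<bullet> x)) *\<^sub>R x))
      \<le> Q * (P * (R * S * R) * (S * Q) * etotal + S * (P * (K_V R * etotal) + (R * S * R) * (K_g R * etotal)))"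
  proof -
    define v where "v j = backprop \<sigma> N n \<theta> x j" for j
    have "avg N (\<lambda>j. norm (grad_W1 \<sigma> N n \<theta> x y j - ((y - G) * Vt j * deriv \<sigma> (W1t j \<bullet> x)) *\<^sub>R x))
        \<le> avg N (\<lambda>j. Q * (P * (R * S * R) * (S * Q) * norm (pW1 \<theta> j - W1t j) + S * (P * \<bar>v j - Vt j\<bar> + (R * S * R) * eg)))"
    proof (rule avg_mono)
      fix j assume j: "j < N"
      have v: "\<bar>v j\<bar> \<le> R * S * R" unfolding v_def using b\<theta> j R by (intro abs_back_le) auto
      have "\<bar>(y - g) * v j * deriv \<sigma> (pW1 \<theta> j \<bullet> x) - (y - G) * Vt j * deriv \<sigma> (W1t j \<bullet> x)\<bar>
          \<le> P * (R * S * R) * \<bar>deriv \<sigma> (pW1 \<theta> j \<bullet> x) - deriv \<sigma> (W1t j \<bullet> x)\<bar> + S * \<bar>(y - g) * v j - (y - G) * Vt j\<bar>"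
        using res v sigma_bound P by (intro abs_mult_diff_le) (auto simp: abs_mult intro!: mult_mono)
      also have "\<dots> \<le> P * (R * S * R) * (S * Q * norm (pW1 \<theta> j - W1t j)) + S * (P * \<bar>v j - Vt j\<bar> + (R * S * R) * eg)"
        unfolding resd[symmetric] using res bV[OF j] P R S sigma_inner_diff(2)[OF x]
        by (intro add_mono mult_left_mono abs_mult_diff_le) (auto intro!: mult_nonneg_nonneg)
      finally have "\<bar>(y - g) * v j * deriv \<sigma> (pW1 \<theta> j \<bullet> x) - (y - G) * Vt j * deriv \<sigma> (W1t j \<bullet> x)\<bar> * norm x
          \<le> (P * (R * S * R) * (S * Q * norm (pW1 \<theta> j - W1t j)) + S * (P * \<bar>v j - Vt j\<bar> + (R * S * R) * eg)) * Q"
        using x by (intro mult_mono) (auto intro: order_trans[OF abs_ge_zero])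
      then show "norm (grad_W1 \<sigma> N n \<theta> x y j - ((y - G) * Vt j * deriv \<sigma> (W1t j \<bullet> x)) *\<^sub>R x)
          \<le> Q * (P * (R * S * R) * (S * Q) * norm (pW1 \<theta> j - W1t j) + S * (P * \<bar>v j - Vt j\<bar> + (R * S * R) * eg))"
        unfolding grad_W1_def g_def[symmetric] v_def[symmetric]
        by (simp add: mult_ac flip: scaleR_left_diff_distrib)
    qed
    also have "\<dots> = Q * (P * (R * S * R) * (S * Q) * eW1 + S * (P * avg N (\<lambda>j. \<bar>v j - Vt j\<bar>) + (R * S * R) * eg))"
      using N by (simp only: avg_add avg_cmult avg_const dist_W1_def)
    also have "\<dots> \<le> Q * (P * (R * S * R) * (S * Q) * etotal + S * (P * (K_V R * etotal) + (R * S * R) * (K_g R * etotal)))"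
      using total_bounds P R S Q T unfolding v_def by (intro mult_left_mono add_mono) auto
    finally show ?thesis .
  qed
  have W2: "avg n (\<lambda>i. avg N (\<lambda>j. \<bar>grad_W2 \<sigma> N n \<theta> x y i j - (y - G) * Ct i * deriv \<sigma> (Zt i) * \<sigma> (W1t j \<bullet> x)\<bar>))
      \<le> P * R * S * (S * Q) * etotal + S * (P * R * (S * (K_Z R * etotal)) + S * (P * etotal + R * (K_g R * etotal)))"
  proof -
    have "avg n (\<lambda>i. avg N (\<lambda>j. \<bar>grad_W2 \<sigma> N n \<theta> x y i j - (y - G) * Ct i * deriv \<sigma> (Zt i) * \<sigma> (W1t j \<bullet> x)\<bar>))
      \<le> avg n (\<lambda>i. avg N (\<lambda>j. P * R * S * (S * Q) * norm (pW1 \<theta> j - W1t j)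
          + S * (P * R * (S * eZ i) + S * (P * \<bar>pC \<theta> i - Ct i\<bar> + R * eg))))"
    proof (intro avg_mono)
      fix i j assume i: "i < n" and j: "j < N"
      have 1: "\<bar>(y - g) * pC \<theta> i\<bar> \<le> P * R" "\<bar>(y - g) * pC \<theta> i * deriv \<sigma> (Z2 \<sigma> N \<theta> i x)\<bar> \<le> P * R * S"
        unfolding abs_mult using res b\<theta>(1)[OF i] sigma_bound P R by (auto intro!: mult_mono)
      have "\<bar>(y - g) * pC \<theta> i * deriv \<sigma> (Z2 \<sigma> N \<theta> i x) * \<sigma> (pW1 \<theta> j \<bullet> x) - (y - G) * Ct i * deriv \<sigma> (Zt i) * \<sigma> (W1t j \<bullet> x)\<bar>
          \<le> P * R * S * \<bar>\<sigma> (pW1 \<theta> j \<bullet> x) - \<sigma> (W1t j \<bullet> x)\<bar>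
            + S * \<bar>(y - g) * pC \<theta> i * deriv \<sigma> (Z2 \<sigma> N \<theta> i x) - (y - G) * Ct i * deriv \<sigma> (Zt i)\<bar>"
        using 1 sigma_bound by (intro abs_mult_diff_le)
      also have "\<dots> \<le> P * R * S * (S * Q * norm (pW1 \<theta> j - W1t j))
            + S * (P * R * \<bar>deriv \<sigma> (Z2 \<sigma> N \<theta> i x) - deriv \<sigma> (Zt i)\<bar> + S * \<bar>(y - g) * pC \<theta> i - (y - G) * Ct i\<bar>)"
        using 1 sigma_bound P R S sigma_inner_diff(1)[OF x]
        by (intro add_mono mult_left_mono abs_mult_diff_le) auto
      also have "\<dots> \<le> P * R * S * (S * Q * norm (pW1 \<theta> j - W1t j))
            + S * (P * R * (S * eZ i) + S * (P * \<bar>pC \<theta> i - Ct i\<bar> + R * eg))"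
        unfolding resd[symmetric] using res bt(1)[OF i] sigma_Z_diff P R S
        by (intro add_mono mult_left_mono abs_mult_diff_le order_refl) auto
      finally show "\<bar>grad_W2 \<sigma> N n \<theta> x y i j - (y - G) * Ct i * deriv \<sigma> (Zt i) * \<sigma> (W1t j \<bullet> x)\<bar>
          \<le> P * R * S * (S * Q) * norm (pW1 \<theta> j - W1t j) + S * (P * R * (S * eZ i) + S * (P * \<bar>pC \<theta> i - Ct i\<bar> + R * eg))"
        unfolding grad_W2_def g_def[symmetric] by (simp add: mult.assoc)
    qed
    also have "\<dots> = P * R * S * (S * Q) * eW1 + S * (P * R * (S * avg n eZ) + S * (P * eC + R * eg))"
      using n N by (simp only: avg_add avg_cmult avg_const dist_W1_def dist_C_def)
    also have "\<dots> \<le> P * R * S * (S * Q) * etotal + S * (P * R * (S * (K_Z R * etotal)) + S * (P * etotal + R * (K_g R * etotal)))"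
      using total_bounds P R S Q T by (intro mult_left_mono add_mono) auto
    finally show ?thesis .
  qed
  have eq: "K_step R * etotal = (P * (S * (K_Z R * etotal)) + S * (K_g R * etotal)) +
      Q * (P * (R * S * R) * (S * Q) * etotal + S * (P * (K_V R * etotal) + (R * S * R) * (K_g R * etotal))) +
      (P * R * S * (S * Q) * etotal + S * (P * R * (S * (K_Z R * etotal)) + S * (P * etotal + R * (K_g R * etotal))))"
    unfolding K_step_def P_def[symmetric] by (simp only: algebra_simps)
  show ?thesis unfolding eq by (intro add_mono C W1 W2)
qed

end

end

section \<open>Coupling of gradient descent with the mean-field system\<close>

lemma avg_minus_const:
  fixes f :: "nat \<Rightarrow> 'b::real_vector"
  assumes "0 < n"
  shows "avg n f - c = (1 / real n) *\<^sub>R (\<Sum>i<n. f i - c)"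
  using assms by (simp add: avg_def sum_subtractf scaleR_diff_right sum_constant_scaleR)

lemma coupled_recursion:
  fixes X Y F T G :: "nat \<Rightarrow> 'b::real_normed_vector"
  assumes X: "\<And>l. l < k \<Longrightarrow> X (Suc l) = X l + q *\<^sub>R F l" and "X 0 = Y 0" and q: "0 \<le> q"
    and Y: "\<And>l. l < k \<Longrightarrow> norm (Y (Suc l) - Y l - q *\<^sub>R G l) \<le> \<epsilon>"
  shows "norm (X k - Y k) \<le> q * (\<Sum>l<k. norm (F l - T l)) + q * norm (\<Sum>l<k. T l - G l) + real k * \<epsilon>"
proof -
  define r where "r l = Y (Suc l) - Y l - q *\<^sub>R G l" for l
  have "X m - Y m = q *\<^sub>R (\<Sum>l<m. F l - T l) + q *\<^sub>R (\<Sum>l<m. T l - G l) - (\<Sum>l<m. r l)" if "m \<le> k" for m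
    using that
  proof (induction m)
    case (Suc m)
    have "X (Suc m) - Y (Suc m) = (X m - Y m) + q *\<^sub>R (F m - T m) + q *\<^sub>R (T m - G m) - r m"
      using X[of m] Suc.prems by (simp add: r_def algebra_simps)
    then show ?case using Suc by (simp add: scaleR_add_right)
  qed (use assms in simp)
  then have "X k - Y k = q *\<^sub>R (\<Sum>l<k. F l - T l) + q *\<^sub>R (\<Sum>l<k. T l - G l) - (\<Sum>l<k. r l)" by simp
  also have "norm \<dots> \<le> norm (q *\<^sub>R (\<Sum>l<k. F l - T l)) + norm (q *\<^sub>R (\<Sum>l<k. T l - G l)) + norm (\<Sum>l<k. r l)"
    by (meson norm_triangle_ineq4 norm_triangle_ineq order_trans add_right_mono)
  also have "\<dots> \<le> q * (\<Sum>l<k. norm (F l - T l)) + q * norm (\<Sum>l<k. T l - G l) + (\<Sum>l<k. \<epsilon>)"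
    using q sum_norm_le[of "{..<k}" r "\<lambda>_. \<epsilon>"] Y by (intro add_mono) (auto simp: r_def intro!: mult_left_mono norm_sum)
  finally show ?thesis by simp
qed

lemma discrete_gronwall:
  fixes e :: "nat \<Rightarrow> real"
  assumes "\<And>k. k \<le> m \<Longrightarrow> e k \<le> A + q * (\<Sum>l<k. e l)" "0 \<le> q" "k \<le> m"
  shows "e k \<le> A * (1 + q) ^ k"
  using assms(3)
proof (induction k rule: less_induct)
  case (less k)
  have geom: "A + q * (\<Sum>l<j. A * (1 + q) ^ l) = A * (1 + q) ^ j" for j
    by (induction j) (simp_all add: algebra_simps)
  have "e k \<le> A + q * (\<Sum>l<k. e l)" using assms(1) less.prems by simp
  also have "\<dots> \<le> A + q * (\<Sum>l<k. A * (1 + q) ^ l)"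
    using less assms(2) by (intro add_left_mono mult_left_mono sum_mono) auto
  finally show ?case using geom by simp
qed

lemma (in prob_space) expectation_avg_le:
  fixes f :: "nat \<Rightarrow> 'a \<Rightarrow> real"
  assumes "0 < n" "\<And>i. i < n \<Longrightarrow> integrable M (f i)" "\<And>i. i < n \<Longrightarrow> expectation (f i) \<le> B"
  shows "integrable M (\<lambda>\<omega>. avg n (\<lambda>i. f i \<omega>))" "expectation (\<lambda>\<omega>. avg n (\<lambda>i. f i \<omega>)) \<le> B"
proof -
  show "integrable M (\<lambda>\<omega>. avg n (\<lambda>i. f i \<omega>))"
    unfolding avg_real using assms by (intro integrable_mult_right Bochner_Integration.integrable_sum) auto
  have "expectation (\<lambda>\<omega>. avg n (\<lambda>i. f i \<omega>)) = avg n (\<lambda>i. expectation (f i))"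
    unfolding avg_real using assms by (simp add: Bochner_Integration.integral_sum)
  also have "\<dots> \<le> avg n (\<lambda>_. B)" using assms by (intro avg_mono) auto
  finally show "expectation (\<lambda>\<omega>. avg n (\<lambda>i. f i \<omega>)) \<le> B" using assms by (simp add: avg_const)
qed

definition "rate n N = 1 / sqrt (real N) + 1 / sqrt (real n)"

locale coupling = mf_data_total \<sigma> \<pi> mu_c mu_W1 mu_W2 S Q + sources M \<pi> mu_c mu_W1 mu_W2 C0 W20 W10 XY
  for \<sigma> :: "real \<Rightarrow> real" and \<pi> :: "('a::euclidean_space \<times> real) measure" and mu_c mu_W1 mu_W2 S Q
    and M :: "'w measure" and C0 W20 W10 XY +
  fixes C :: "real \<Rightarrow> real \<Rightarrow> real" and W1 :: "real \<Rightarrow> 'a \<Rightarrow> 'a" and D :: "real \<Rightarrow> real \<Rightarrow> 'a \<Rightarrow> real"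
    and \<iota>u :: "real \<Rightarrow> real" and R :: real and CC :: "real set" and WW1 :: "'a set" and WW2 :: "real set"
    and W2 :: "real \<Rightarrow> real \<Rightarrow> 'a \<Rightarrow> real \<Rightarrow> real"
  assumes W2_def: "W2 = (\<lambda>t c w u. \<iota>u u + D t c w)"
    and conts: "continuous_on UNIV (\<lambda>(t, c). C t c)" "continuous_on UNIV (\<lambda>(t, w). W1 t w)"
      "continuous_on UNIV (\<lambda>(t, c, w). D t c w)" "continuous_on UNIV \<iota>u"
    and bounds: "\<bar>C t c\<bar> \<le> R" "\<bar>W2 t c w u\<bar> \<le> R" "norm (W1 t w) \<le> R"
    and init: "c \<in> CC \<Longrightarrow> C 0 c = c" "w \<in> WW1 \<Longrightarrow> W1 0 w = w" "D 0 c w = 0" "u \<in> WW2 \<Longrightarrow> \<iota>u u = u"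
    and ode: "t \<in> {0..1} \<Longrightarrow> ((\<lambda>s. C s c) has_vector_derivative rhsC (C t) (W1 t) (W2 t) c) (at t within {0..1})"
      "t \<in> {0..1} \<Longrightarrow> ((\<lambda>s. W1 s w) has_vector_derivative rhsW1 (C t) (W1 t) (W2 t) w) (at t within {0..1})"
      "t \<in> {0..1} \<Longrightarrow> ((\<lambda>s. D s c w) has_vector_derivative rhsW2 (C t) (W1 t) (W2 t) c w) (at t within {0..1})"
    and labels_AE: "AE \<omega> in M. C0 i \<omega> \<in> CC" "AE \<omega> in M. W10 j \<omega> \<in> WW1" "AE \<omega> in M. W20 i j \<omega> \<in> WW2"
begin

lemma W2_ode:
  "t \<in> {0..1} \<Longrightarrow> ((\<lambda>s. W2 s c w u) has_vector_derivative rhsW2 (C t) (W1 t) (W2 t) c w) (at t within {0..1})"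
  unfolding W2_def using ode(3)[of t c w] by (auto simp: W2_def intro!: derivative_eq_intros)

lemma W2_cont: "continuous_on UNIV (\<lambda>(t, c, w, u). W2 t c w u)"
proof -
  have "continuous_on UNIV (\<lambda>p::real \<times> real \<times> 'a \<times> real. D (fst p) (fst (snd p)) (fst (snd (snd p))))"
    using continuous_on_compose2[OF conts(3) continuous_on_Pair[OF continuous_on_fst[OF continuous_on_id]
      continuous_on_Pair[OF continuous_on_fst[OF continuous_on_snd[OF continuous_on_id]]
        continuous_on_fst[OF continuous_on_snd[OF continuous_on_snd[OF continuous_on_id]]]]]] by simp
  moreover have "continuous_on UNIV (\<lambda>p::real \<times> real \<times> 'a \<times> real. \<iota>u (snd (snd (snd p))))"
    by (intro continuous_on_compose2[OF conts(4)] continuous_intros) auto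
  ultimately show ?thesis unfolding W2_def split_beta' by (intro continuous_on_add) auto
qed

lemmas fam = family_slice[OF conts(1,2) W2_cont bounds(1,2)]

lemmas slice_measurable [measurable] = family_measurable[OF fam] Zf_measurable[OF fam]
  Hf_measurable[OF fam] gf_measurable[OF fam] Vf_measurable[OF fam]

lemma R_nonneg: "0 \<le> R" using bounds(1)[of 0 0] by linarith

lemma slice_bounds:
  "\<bar>Zf (W1 t) (W2 t) c x\<bar> \<le> R * S" "\<bar>gf (C t) (W1 t) (W2 t) x\<bar> \<le> R * S" "\<bar>Vf (C t) (W1 t) (W2 t) w x\<bar> \<le> R * S * R"
proof -
  have "norm (W2 t c w u * \<sigma> z) \<le> R * S" for w u z
    using bounds(2)[of t c w u] sigma_bound(1)[of z] R_nonneg by (auto simp: abs_mult intro!: mult_mono)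
  then have "norm (\<integral>u. W2 t c w u * \<sigma> z \<partial>mu_W2) \<le> R * S" for w z
    by (intro PW2.norm_integral_le_const AE_I2)
  then show "\<bar>Zf (W1 t) (W2 t) c x\<bar> \<le> R * S"
    unfolding mf_Z_def real_norm_def[symmetric] by (intro PW1.norm_integral_le_const AE_I2)
  show "\<bar>gf (C t) (W1 t) (W2 t) x\<bar> \<le> R * S" by (rule abs_gf_le[OF bounds(1)])
  show "\<bar>Vf (C t) (W1 t) (W2 t) w x\<bar> \<le> R * S * R"
    unfolding mf_V_def real_norm_def[symmetric]
    by (intro PC.norm_integral_le_const AE_I2 V_integrand_le[OF conts(1,2) W2_cont bounds(1,2)])
qed

abbreviation "B \<equiv> B_rhs R"
abbreviation "L \<equiv> L_rhs R * B_rhs R"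

lemma B_nonneg: "0 \<le> B" and L_nonneg: "0 \<le> L"
  using B_rhs_nonneg L_rhs_nonneg R_nonneg by auto

lemma rhs_bound:
  "\<bar>rhsC (C t) (W1 t) (W2 t) c\<bar> \<le> B" "norm (rhsW1 (C t) (W1 t) (W2 t) w) \<le> B"
  "\<bar>rhsW2 (C t) (W1 t) (W2 t) c w\<bar> \<le> B"
  using lip_rhs[OF fam[of t] fam[of t] close_fam_refl[OF order_refl] order_refl] unfolding lip_def by auto

lemma time_lipschitz:
  assumes "s \<in> {0..1}" "t \<in> {0..1}"
  shows "close_fam (B * \<bar>t - s\<bar>) (C t) (W1 t) (W2 t) (C s) (W1 s) (W2 s)"
proof -
  have le: "norm (f t - f s) \<le> B * \<bar>t - s\<bar>"
    if f: "\<And>t. t \<in> {0..1} \<Longrightarrow> (f has_vector_derivative f' t) (at t within {0..1})" "\<And>t. norm (f' t) \<le> B"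
    for f f' :: "real \<Rightarrow> 'z::real_normed_vector"
  proof -
    have *: "norm (f t - f s) \<le> B * t - B * s" if "0 \<le> s" "s \<le> t" "t \<le> 1" for s t
      by (rule norm_diff_le_of_derivative[where f = f and f' = f' and \<phi>' = "\<lambda>_. B"])
        (use f that in \<open>auto intro!: derivative_eq_intros\<close>)
    show ?thesis
      using *[of s t] *[of t s] assms by (cases "s \<le> t") (auto simp: norm_minus_commute algebra_simps abs_if)
  qed
  show ?thesis unfolding close_fam_def
    using le[OF ode(1)] le[OF ode(2)] le[OF W2_ode] rhs_bound by auto
qed

lemma increment:
  assumes st: "0 \<le> s" "s \<le> t" "t \<le> 1"
  shows "norm (C t c - C s c - (t - s) *\<^sub>R rhsC (C s) (W1 s) (W2 s) c) \<le> L * (t - s)\<^sup>2"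
    "norm (W1 t w - W1 s w - (t - s) *\<^sub>R rhsW1 (C s) (W1 s) (W2 s) w) \<le> L * (t - s)\<^sup>2"
    "norm (W2 t c w u - W2 s c w u - (t - s) *\<^sub>R rhsW2 (C s) (W1 s) (W2 s) c w) \<le> L * (t - s)\<^sup>2"
proof -
  have le: "norm (f t - f s - (t - s) *\<^sub>R f' s) \<le> L * (t - s)\<^sup>2"
    if f: "\<And>t. t \<in> {0..1} \<Longrightarrow> (f has_vector_derivative f' t) (at t within {0..1})"
      "\<And>v. v \<in> {s..t} \<Longrightarrow> lip (B * \<bar>v - s\<bar>) B (L_rhs R) (f' v) (f' s)"
    for f f' :: "real \<Rightarrow> 'z::real_normed_vector"
  proof -
    have "norm ((f t - t *\<^sub>R f' s) - (f s - s *\<^sub>R f' s)) \<le> (L * (t - s)) * t - (L * (t - s)) * s"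
    proof (rule norm_diff_le_of_derivative[where f = "\<lambda>v. f v - v *\<^sub>R f' s" and f' = "\<lambda>v. f' v - f' s"
          and \<phi>' = "\<lambda>_. L * (t - s)"])
      show "norm (f' v - f' s) \<le> L * (t - s)" if "v \<in> {s..t}" for v
      proof -
        have "norm (f' v - f' s) \<le> L * (v - s)" using f(2)[OF that] that by (simp add: lip_def mult.assoc)
        also have "\<dots> \<le> L * (t - s)" using L_nonneg that by (intro mult_left_mono) auto
        finally show ?thesis .
      qed
    qed (use st f(1) in \<open>auto intro!: derivative_eq_intros\<close>)
    then show ?thesis by (simp add: algebra_simps power2_eq_square)
  qed
  have lips: "lip (B * \<bar>v - s\<bar>) B (L_rhs R) (rhsC (C v) (W1 v) (W2 v) c) (rhsC (C s) (W1 s) (W2 s) c)"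
    "lip (B * \<bar>v - s\<bar>) B (L_rhs R) (rhsW1 (C v) (W1 v) (W2 v) w) (rhsW1 (C s) (W1 s) (W2 s) w)"
    "lip (B * \<bar>v - s\<bar>) B (L_rhs R) (rhsW2 (C v) (W1 v) (W2 v) c w) (rhsW2 (C s) (W1 s) (W2 s) c w)"
    if "v \<in> {s..t}" for v c w
    by (rule lip_rhs[OF fam fam time_lipschitz]; use st that B_nonneg in simp)+
  show "norm (C t c - C s c - (t - s) *\<^sub>R rhsC (C s) (W1 s) (W2 s) c) \<le> L * (t - s)\<^sup>2"
    by (rule le[OF ode(1) lips(1)])
  show "norm (W1 t w - W1 s w - (t - s) *\<^sub>R rhsW1 (C s) (W1 s) (W2 s) w) \<le> L * (t - s)\<^sup>2"
    by (rule le[OF ode(2) lips(2)])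
  show "norm (W2 t c w u - W2 s c w u - (t - s) *\<^sub>R rhsW2 (C s) (W1 s) (W2 s) c w) \<le> L * (t - s)\<^sup>2"
    by (rule le[OF W2_ode lips(3)])
qed

lemma g_time_diff:
  assumes "s \<in> {0..1}" "t \<in> {0..1}" "norm x \<le> Q"
  shows "\<bar>gf (C t) (W1 t) (W2 t) x - gf (C s) (W1 s) (W2 s) x\<bar> \<le> L_g R * (B * \<bar>t - s\<bar>)"
  using lip_g[OF fam fam time_lipschitz[OF assms(1,2)] assms(3)] by (simp add: lip_def)

lemma samples_AE: "AE \<omega> in M. norm (fst (XY k \<omega>)) \<le> Q \<and> \<bar>snd (XY k \<omega>)\<bar> \<le> Q"
proof -
  have "AE p in distr M borel (XY k). norm (fst p) \<le> Q \<and> \<bar>snd p\<bar> \<le> Q"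
    unfolding laws using samples by (simp only: split_beta')
  from AE_distrD[OF source_measurable(4) this] show ?thesis .
qed

text \<open>Clipping makes the update directions bounded everywhere, as \<open>sample_average\<close> requires, and
  changes them only on a null set.\<close>

definition clipped :: "('a \<times> real \<Rightarrow> 'b::real_normed_vector) \<Rightarrow> 'a \<times> real \<Rightarrow> 'b" where
  "clipped f p = (if norm (fst p) \<le> Q \<and> \<bar>snd p\<bar> \<le> Q then f p else 0)"

lemma integral_clipped:
  fixes f :: "'a \<times> real \<Rightarrow> 'b::{banach, second_countable_topology}"
  assumes [measurable]: "f \<in> borel_measurable (borel \<Otimes>\<^sub>M borel)"
  shows "(\<integral>p. clipped f p \<partial>\<pi>) = (\<integral>p. f p \<partial>\<pi>)"
  by (rule integral_cong_AE) (use samples in \<open>auto simp: clipped_def[abs_def] elim!: eventually_mono\<close>)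

definition target_C where
  "target_C t c p = (snd p - gf (C t) (W1 t) (W2 t) (fst p)) * \<sigma> (Zf (W1 t) (W2 t) c (fst p))"
definition target_W1 where
  "target_W1 t w p = ((snd p - gf (C t) (W1 t) (W2 t) (fst p)) * Vf (C t) (W1 t) (W2 t) w (fst p)
     * deriv \<sigma> (W1 t w \<bullet> fst p)) *\<^sub>R fst p"
definition target_W2 where
  "target_W2 t c w p = (snd p - gf (C t) (W1 t) (W2 t) (fst p)) * C t c
     * deriv \<sigma> (Zf (W1 t) (W2 t) c (fst p)) * \<sigma> (W1 t w \<bullet> fst p)"

lemma target_measurable [measurable]:
  assumes [measurable]: "f \<in> borel_measurable N" "g \<in> borel_measurable N" "h \<in> measurable N (borel \<Otimes>\<^sub>M borel)"
  shows "(\<lambda>q. target_C t (f q) (h q)) \<in> borel_measurable N"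
    "(\<lambda>q. target_W1 t (g q) (h q)) \<in> borel_measurable N"
    "(\<lambda>q. target_W2 t (f q) (g q) (h q)) \<in> borel_measurable N"
  unfolding target_C_def target_W1_def target_W2_def by measurable

lemma clipped_target_le:
  "norm (clipped (target_C t c) p) \<le> B" "norm (clipped (target_W1 t w) p) \<le> B" "norm (clipped (target_W2 t c w) p) \<le> B"
proof -
  note l = lip_rhs_C_integrand[OF fam fam close_fam_refl[OF order_refl], of c "fst p" "snd p" t]
    lip_rhs_W1_integrand[OF fam fam close_fam_refl[OF order_refl], of w "fst p" "snd p" t]
    lip_rhs_W2_integrand[OF fam fam close_fam_refl[OF order_refl], of c w "fst p" "snd p" t]
  show "norm (clipped (target_C t c) p) \<le> B" "norm (clipped (target_W1 t w) p) \<le> B" "norm (clipped (target_W2 t c w) p) \<le> B"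
    using l B_nonneg by (auto simp: clipped_def target_C_def target_W1_def target_W2_def mf_H2_def lip_def B_rhs_def
      simp del: norm_scaleR)
qed

lemma integral_target:
  "(\<integral>p. clipped (target_C t c) p \<partial>\<pi>) = rhsC (C t) (W1 t) (W2 t) c"
  "(\<integral>p. clipped (target_W1 t w) p \<partial>\<pi>) = rhsW1 (C t) (W1 t) (W2 t) w"
  "(\<integral>p. clipped (target_W2 t c w) p \<partial>\<pi>) = rhsW2 (C t) (W1 t) (W2 t) c w"
  by (simp_all add: integral_clipped mf_rhs_C_def mf_rhs_W1_def mf_rhs_W2_def mf_H2_def split_beta'
      target_C_def target_W1_def target_W2_def)

definition "K_fluct = 2 * (R * S * (2 + R))"
definition "K_err = (K_step (rc R) * K_fluct + 6 * B + 3 * L) * exp (K_step (rc R))"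
definition "K_final = K_g (rc R) * (K_err + K_fluct) + L_g R * B"
context
  fixes n N :: nat
  assumes n: "0 < n" and N: "0 < N"
begin

definition \<theta> :: "nat \<Rightarrow> 'w \<Rightarrow> 'a params" where
  "\<theta> k \<omega> = sgd \<sigma> N n \<lparr>pC = (\<lambda>i. C0 i \<omega>), pW2 = (\<lambda>i j. W20 i j \<omega>), pW1 = (\<lambda>j. W10 j \<omega>)\<rparr> (\<lambda>k. XY k \<omega>) k"

definition \<tau> :: "nat \<Rightarrow> real" where "\<tau> k = real k / real N"

lemma \<tau>: "k \<le> N \<Longrightarrow> \<tau> k \<in> {0..1}" "\<tau> 0 = 0" "\<tau> (Suc k) - \<tau> k = 1 / real N" "\<tau> k \<le> \<tau> (Suc k)"
  using N by (auto simp: \<tau>_def field_simps)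

lemma \<theta>_0: "pC (\<theta> 0 \<omega>) i = C0 i \<omega>" "pW1 (\<theta> 0 \<omega>) j = W10 j \<omega>" "pW2 (\<theta> 0 \<omega>) i j = W20 i j \<omega>"
  by (simp_all add: \<theta>_def)

lemma \<theta>_Suc:
  "pC (\<theta> (Suc k) \<omega>) i = pC (\<theta> k \<omega>) i + (1 / real N) *\<^sub>R grad_C \<sigma> N n (\<theta> k \<omega>) (fst (XY k \<omega>)) (snd (XY k \<omega>)) i"
  "pW1 (\<theta> (Suc k) \<omega>) j = pW1 (\<theta> k \<omega>) j + (1 / real N) *\<^sub>R grad_W1 \<sigma> N n (\<theta> k \<omega>) (fst (XY k \<omega>)) (snd (XY k \<omega>)) j"
  "pW2 (\<theta> (Suc k) \<omega>) i j = pW2 (\<theta> k \<omega>) i j + (1 / real N) *\<^sub>R grad_W2 \<sigma> N n (\<theta> k \<omega>) (fst (XY k \<omega>)) (snd (XY k \<omega>)) i j"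
  using sgd_step_simps[OF n, of \<sigma> N "fst (XY k \<omega>)" "snd (XY k \<omega>)" "\<theta> k \<omega>"] by (simp_all add: \<theta>_def)

lemma \<theta>_measurable [measurable]:
  "(\<lambda>\<omega>. pC (\<theta> k \<omega>) i) \<in> borel_measurable M" "(\<lambda>\<omega>. pW1 (\<theta> k \<omega>) j) \<in> borel_measurable M"
  "(\<lambda>\<omega>. pW2 (\<theta> k \<omega>) i j) \<in> borel_measurable M"
proof (induction k arbitrary: i j)
  case 0
  { case 1 show ?case by (simp add: \<theta>_def) }
  { case 2 show ?case by (simp add: \<theta>_def) }
  { case 3 show ?case by (simp add: \<theta>_def) }
next
  case (Suc k)
  note [measurable] = Suc
  { case 1 show ?case unfolding \<theta>_Suc grad_C_def net_avg Z2_avg avg_def by measurable }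
  { case 2 show ?case unfolding \<theta>_Suc grad_W1_def backprop_def net_avg Z2_avg avg_def by measurable }
  { case 3 show ?case unfolding \<theta>_Suc grad_W2_def net_avg Z2_avg avg_def by measurable }
qed

lemma net_measurable [measurable]: "(\<lambda>\<omega>. net \<sigma> N n (\<theta> k \<omega>) x) \<in> borel_measurable M"
  unfolding net_avg Z2_avg avg_def by measurable

definition "Ct k \<omega> i = C (\<tau> k) (C0 i \<omega>)"
definition "W1t k \<omega> j = W1 (\<tau> k) (W10 j \<omega>)"
definition "W2t k \<omega> i j = W2 (\<tau> k) (C0 i \<omega>) (W10 j \<omega>) (W20 i j \<omega>)"
definition "Zt k x \<omega> i = Zf (W1 (\<tau> k)) (W2 (\<tau> k)) (C0 i \<omega>) x"
definition "Gt k x = gf (C (\<tau> k)) (W1 (\<tau> k)) (W2 (\<tau> k)) x"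
definition "Vt k x \<omega> j = Vf (C (\<tau> k)) (W1 (\<tau> k)) (W2 (\<tau> k)) (W10 j \<omega>) x"

definition "err k \<omega> = dist_C n (\<theta> k \<omega>) (Ct k \<omega>) + dist_W1 N (\<theta> k \<omega>) (W1t k \<omega>) + dist_W2 n N (\<theta> k \<omega>) (W2t k \<omega>)"
definition "fluct k x \<omega> = avg n (fluct_Z \<sigma> N (W1t k \<omega>) (W2t k \<omega>) (Zt k x \<omega>) x) +
  fluct_g \<sigma> n (Ct k \<omega>) (Zt k x \<omega>) (Gt k x) + avg N (fluct_V \<sigma> n (Ct k \<omega>) (W2t k \<omega>) (Zt k x \<omega>) (Vt k x \<omega>))"

definition "noise_C k \<omega> i = norm (\<Sum>l<k. clipped (target_C (\<tau> l) (C0 i \<omega>)) (XY l \<omega>)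
   - rhsC (C (\<tau> l)) (W1 (\<tau> l)) (W2 (\<tau> l)) (C0 i \<omega>))"
definition "noise_W1 k \<omega> j = norm (\<Sum>l<k. clipped (target_W1 (\<tau> l) (W10 j \<omega>)) (XY l \<omega>)
   - rhsW1 (C (\<tau> l)) (W1 (\<tau> l)) (W2 (\<tau> l)) (W10 j \<omega>))"
definition "noise_W2 k \<omega> i j = norm (\<Sum>l<k. clipped (target_W2 (\<tau> l) (C0 i \<omega>) (W10 j \<omega>)) (XY l \<omega>)
   - rhsW2 (C (\<tau> l)) (W1 (\<tau> l)) (W2 (\<tau> l)) (C0 i \<omega>) (W10 j \<omega>))"
definition "noise k \<omega> = avg n (noise_C k \<omega>) + avg N (noise_W1 k \<omega>) + avg n (\<lambda>i. avg N (noise_W2 k \<omega> i))"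

definition "regular \<omega> \<longleftrightarrow> (\<forall>i. C0 i \<omega> \<in> CC) \<and> (\<forall>j. W10 j \<omega> \<in> WW1) \<and> (\<forall>i j. W20 i j \<omega> \<in> WW2) \<and>
  (\<forall>k. norm (fst (XY k \<omega>)) \<le> Q \<and> \<bar>snd (XY k \<omega>)\<bar> \<le> Q)"

lemma regular_AE: "AE \<omega> in M. regular \<omega>"
  unfolding regular_def using labels_AE samples_AE by (auto simp: AE_all_countable)

lemma R_le_rc: "R \<le> rc R" "0 \<le> rc R" using R_nonneg by (auto simp: rc_def)

context
  fixes \<omega> assumes reg: "regular \<omega>"
begin

lemma init_\<omega>: "C 0 (C0 i \<omega>) = C0 i \<omega>" "W1 0 (W10 j \<omega>) = W10 j \<omega>"
  "W2 0 (C0 i \<omega>) (W10 j \<omega>) (W20 i j \<omega>) = W20 i j \<omega>"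
  using reg init by (auto simp: regular_def W2_def)

lemma sgd_bounds_\<omega>:
  assumes "k \<le> N"
  shows "i < n \<Longrightarrow> \<bar>pC (\<theta> k \<omega>) i\<bar> \<le> rc R" "i < n \<Longrightarrow> j < N \<Longrightarrow> \<bar>pW2 (\<theta> k \<omega>) i j\<bar> \<le> rc R"
    "j < N \<Longrightarrow> norm (pW1 (\<theta> k \<omega>) j) \<le> rc R"
proof -
  have 0: "\<bar>C0 i \<omega>\<bar> \<le> R" "norm (W10 j \<omega>) \<le> R" "\<bar>W20 i j \<omega>\<bar> \<le> R" for i j
    using bounds(1)[of 0 "C0 i \<omega>"] bounds(3)[of 0 "W10 j \<omega>"] bounds(2)[of 0 "C0 i \<omega>" "W10 j \<omega>" "W20 i j \<omega>"]
    by (simp_all add: init_\<omega>)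
  show "i < n \<Longrightarrow> \<bar>pC (\<theta> k \<omega>) i\<bar> \<le> rc R" "i < n \<Longrightarrow> j < N \<Longrightarrow> \<bar>pW2 (\<theta> k \<omega>) i j\<bar> \<le> rc R"
    "j < N \<Longrightarrow> norm (pW1 (\<theta> k \<omega>) j) \<le> rc R"
    unfolding \<theta>_def
    by (rule sgd_bounds[OF n N _ _ _ _ _ R_nonneg assms]; use 0 reg in \<open>simp add: regular_def\<close>)+
qed

lemma limit_bounds: "\<bar>Ct k \<omega> i\<bar> \<le> rc R" "\<bar>W2t k \<omega> i j\<bar> \<le> rc R" "norm (W1t k \<omega> j) \<le> rc R"
  "\<bar>Gt k x\<bar> \<le> rc R * S" "\<bar>Vt k x \<omega> j\<bar> \<le> rc R * S * rc R"
proof -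
  show "\<bar>Ct k \<omega> i\<bar> \<le> rc R" "\<bar>W2t k \<omega> i j\<bar> \<le> rc R" "norm (W1t k \<omega> j) \<le> rc R"
    unfolding Ct_def W2t_def W1t_def by (rule order_trans[OF bounds(1) R_le_rc(1)] order_trans[OF bounds(2) R_le_rc(1)]
      order_trans[OF bounds(3) R_le_rc(1)])+
  have "R * S \<le> rc R * S" "R * S * R \<le> rc R * S * rc R"
    using R_le_rc R_nonneg S_nonneg by (auto intro!: mult_mono mult_nonneg_nonneg)
  from order_trans[OF slice_bounds(2) this(1)] order_trans[OF slice_bounds(3) this(2)]
  show "\<bar>Gt k x\<bar> \<le> rc R * S" "\<bar>Vt k x \<omega> j\<bar> \<le> rc R * S * rc R" by (simp_all add: Gt_def Vt_def)
qed

lemma net_diff: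
  assumes "k \<le> N" "norm x \<le> Q"
  shows "\<bar>net \<sigma> N n (\<theta> k \<omega>) x - Gt k x\<bar> \<le> K_g (rc R) * (err k \<omega> + fluct k x \<omega>)"
  using total_bounds(2)[where Ct = "Ct k \<omega>" and W1t = "W1t k \<omega>" and W2t = "W2t k \<omega>" and Zt = "Zt k x \<omega>" and G = "Gt k x" and Vt = "Vt k x \<omega>",
      OF n N assms(2) sgd_bounds_\<omega>(1,2)[OF assms(1)] limit_bounds(1,2,4,5) R_le_rc(2)]
  by (simp add: err_def fluct_def algebra_simps)

lemma err_step:
  assumes k: "k \<le> N"
  shows "err k \<omega> \<le> 1 / real N * (\<Sum>l<k. K_step (rc R) * (err l \<omega> + fluct l (fst (XY l \<omega>)) \<omega>))
    + 1 / real N * noise k \<omega> + 3 * (L / real N)"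
proof -
  define q where "q = 1 / real N"
  define x where "x l = fst (XY l \<omega>)" for l
  define y where "y l = snd (XY l \<omega>)" for l
  have xy: "norm (x l) \<le> Q" "\<bar>y l\<bar> \<le> Q" for l using reg by (auto simp: regular_def x_def y_def)
  have clip: "clipped f (XY l \<omega>) = f (x l, y l)" for f :: "'a \<times> real \<Rightarrow> 'z::real_normed_vector" and l
    using xy by (simp add: clipped_def x_def y_def)
  have q: "0 \<le> q" by (simp add: q_def)
  have small: "real k * (L * q\<^sup>2) \<le> L / real N"
  proof -
    have "real k * (L * q\<^sup>2) \<le> real N * (L * q\<^sup>2)" using k L_nonneg by (intro mult_right_mono) auto
    also have "\<dots> = L / real N" using N by (simp add: q_def power2_eq_square)
    finally show ?thesis .
  qed
  have inc: "norm (C (\<tau> (Suc l)) c - C (\<tau> l) c - q *\<^sub>R rhsC (C (\<tau> l)) (W1 (\<tau> l)) (W2 (\<tau> l)) c) \<le> L * q\<^sup>2"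
    "norm (W1 (\<tau> (Suc l)) w - W1 (\<tau> l) w - q *\<^sub>R rhsW1 (C (\<tau> l)) (W1 (\<tau> l)) (W2 (\<tau> l)) w) \<le> L * q\<^sup>2"
    "norm (W2 (\<tau> (Suc l)) c w u - W2 (\<tau> l) c w u - q *\<^sub>R rhsW2 (C (\<tau> l)) (W1 (\<tau> l)) (W2 (\<tau> l)) c w) \<le> L * q\<^sup>2"
    if "l < k" for l c w u
    using increment[of "\<tau> l" "\<tau> (Suc l)"] \<tau>(1)[of l] \<tau>(1)[of "Suc l"] that k \<tau>(4)[of l] unfolding \<tau>(3) q_def by auto
  define tC where "tC l i = (y l - Gt l (x l)) * \<sigma> (Zt l (x l) \<omega> i)" for l i
  define tW1 where "tW1 l j = ((y l - Gt l (x l)) * Vt l (x l) \<omega> j * deriv \<sigma> (W1t l \<omega> j \<bullet> x l)) *\<^sub>R x l" for l j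
  define tW2 where "tW2 l i j = (y l - Gt l (x l)) * Ct l \<omega> i * deriv \<sigma> (Zt l (x l) \<omega> i) * \<sigma> (W1t l \<omega> j \<bullet> x l)" for l i j
  define dC where "dC l i = \<bar>grad_C \<sigma> N n (\<theta> l \<omega>) (x l) (y l) i - tC l i\<bar>" for l i
  define dW1 where "dW1 l j = norm (grad_W1 \<sigma> N n (\<theta> l \<omega>) (x l) (y l) j - tW1 l j)" for l j
  define dW2 where "dW2 l i j = \<bar>grad_W2 \<sigma> N n (\<theta> l \<omega>) (x l) (y l) i j - tW2 l i j\<bar>" for l i j
  have C: "\<bar>pC (\<theta> k \<omega>) i - Ct k \<omega> i\<bar> \<le> q * (\<Sum>l<k. dC l i) + q * noise_C k \<omega> i + L / real N" for i
  proof -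
    have "norm (pC (\<theta> k \<omega>) i - Ct k \<omega> i) \<le> q * (\<Sum>l<k. norm (grad_C \<sigma> N n (\<theta> l \<omega>) (x l) (y l) i - tC l i))
        + q * norm (\<Sum>l<k. tC l i - rhsC (C (\<tau> l)) (W1 (\<tau> l)) (W2 (\<tau> l)) (C0 i \<omega>)) + real k * (L * q\<^sup>2)"
      by (rule coupled_recursion[where X = "\<lambda>k. pC (\<theta> k \<omega>) i" and Y = "\<lambda>k. Ct k \<omega> i"])
        (use inc(1) q in \<open>auto simp: \<theta>_Suc x_def y_def q_def \<theta>_0 Ct_def \<tau>(2) init_\<omega>\<close>)
    then show ?thesis using small
      by (simp add: noise_C_def clip target_C_def tC_def dC_def Gt_def Zt_def)
  qed
  have W1: "norm (pW1 (\<theta> k \<omega>) j - W1t k \<omega> j) \<le> q * (\<Sum>l<k. dW1 l j) + q * noise_W1 k \<omega> j + L / real N" for j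
  proof -
    have "norm (pW1 (\<theta> k \<omega>) j - W1t k \<omega> j) \<le> q * (\<Sum>l<k. norm (grad_W1 \<sigma> N n (\<theta> l \<omega>) (x l) (y l) j - tW1 l j))
        + q * norm (\<Sum>l<k. tW1 l j - rhsW1 (C (\<tau> l)) (W1 (\<tau> l)) (W2 (\<tau> l)) (W10 j \<omega>)) + real k * (L * q\<^sup>2)"
      by (rule coupled_recursion[where X = "\<lambda>k. pW1 (\<theta> k \<omega>) j" and Y = "\<lambda>k. W1t k \<omega> j"])
        (use inc(2) q in \<open>auto simp: \<theta>_Suc x_def y_def q_def \<theta>_0 W1t_def \<tau>(2) init_\<omega>\<close>)
    then show ?thesis using small
      by (simp add: noise_W1_def clip target_W1_def tW1_def dW1_def Gt_def Vt_def W1t_def)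
  qed
  have W2: "\<bar>pW2 (\<theta> k \<omega>) i j - W2t k \<omega> i j\<bar> \<le> q * (\<Sum>l<k. dW2 l i j) + q * noise_W2 k \<omega> i j + L / real N" for i j
  proof -
    have "norm (pW2 (\<theta> k \<omega>) i j - W2t k \<omega> i j) \<le> q * (\<Sum>l<k. norm (grad_W2 \<sigma> N n (\<theta> l \<omega>) (x l) (y l) i j - tW2 l i j))
        + q * norm (\<Sum>l<k. tW2 l i j - rhsW2 (C (\<tau> l)) (W1 (\<tau> l)) (W2 (\<tau> l)) (C0 i \<omega>) (W10 j \<omega>)) + real k * (L * q\<^sup>2)"
      by (rule coupled_recursion[where X = "\<lambda>k. pW2 (\<theta> k \<omega>) i j" and Y = "\<lambda>k. W2t k \<omega> i j"])
        (use inc(3) q in \<open>auto simp: \<theta>_Suc x_def y_def q_def \<theta>_0 W2t_def \<tau>(2) init_\<omega>\<close>)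
    then show ?thesis using small
      by (simp add: noise_W2_def clip target_W2_def tW2_def dW2_def Gt_def Zt_def W1t_def Ct_def)
  qed
  have avg_sum: "avg m (\<lambda>i. \<Sum>l<k. f l i) = (\<Sum>l<k. avg m (f l))" for m and f :: "nat \<Rightarrow> nat \<Rightarrow> real"
    unfolding avg_real sum_distrib_left by (rule sum.swap)
  have "dist_C n (\<theta> k \<omega>) (Ct k \<omega>) \<le> q * (\<Sum>l<k. avg n (dC l)) + q * avg n (noise_C k \<omega>) + L / real N"
    unfolding dist_C_def using avg_mono[of n, OF C] n by (simp add: avg_add avg_cmult avg_const avg_sum)
  moreover have "dist_W1 N (\<theta> k \<omega>) (W1t k \<omega>) \<le> q * (\<Sum>l<k. avg N (dW1 l)) + q * avg N (noise_W1 k \<omega>) + L / real N"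
    unfolding dist_W1_def using avg_mono[of N, OF W1] N by (simp add: avg_add avg_cmult avg_const avg_sum)
  moreover have "dist_W2 n N (\<theta> k \<omega>) (W2t k \<omega>) \<le> q * (\<Sum>l<k. avg n (\<lambda>i. avg N (dW2 l i)))
      + q * avg n (\<lambda>i. avg N (noise_W2 k \<omega> i)) + L / real N"
    unfolding dist_W2_def using avg_mono[of n, OF avg_mono[of N, OF W2]] n N
    by (simp add: avg_add avg_cmult avg_const avg_sum)
  moreover have "avg n (dC l) + avg N (dW1 l) + avg n (\<lambda>i. avg N (dW2 l i))
      \<le> K_step (rc R) * (err l \<omega> + fluct l (x l) \<omega>)" if "l < k" for l
    using step_diff[where Ct = "Ct l \<omega>" and W1t = "W1t l \<omega>" and W2t = "W2t l \<omega>" and Zt = "Zt l (x l) \<omega>" and G = "Gt l (x l)" and Vt = "Vt l (x l) \<omega>",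
      OF n N xy(1)[of l] sgd_bounds_\<omega>(1,2)[of l] limit_bounds(1,2,4,5) R_le_rc(2) xy(2)[of l]]
      that k unfolding dC_def dW1_def dW2_def tC_def tW1_def tW2_def err_def fluct_def
    by (simp add: add.assoc)
  then have "q * (\<Sum>l<k. avg n (dC l) + avg N (dW1 l) + avg n (\<lambda>i. avg N (dW2 l i)))
      \<le> q * (\<Sum>l<k. K_step (rc R) * (err l \<omega> + fluct l (x l) \<omega>))"
    using q by (intro mult_left_mono sum_mono) auto
  ultimately show ?thesis
    unfolding err_def noise_def q_def[symmetric] x_def[symmetric] by (simp add: sum.distrib algebra_simps)
qed

end

lemma sqrt_over: "0 < m \<Longrightarrow> sqrt (real m) / real m = 1 / sqrt (real m)" for m :: nat
  by (simp add: frac_eq_eq)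

lemma diff_integrable:
  assumes k: "k \<le> N"
  shows "i < n \<Longrightarrow> integrable M (\<lambda>\<omega>. \<bar>pC (\<theta> k \<omega>) i - Ct k \<omega> i\<bar>)"
    "j < N \<Longrightarrow> integrable M (\<lambda>\<omega>. norm (pW1 (\<theta> k \<omega>) j - W1t k \<omega> j))"
    "i < n \<Longrightarrow> j < N \<Longrightarrow> integrable M (\<lambda>\<omega>. \<bar>pW2 (\<theta> k \<omega>) i j - W2t k \<omega> i j\<bar>)"
proof -
  have bounded: "integrable M (\<lambda>\<omega>. norm (p \<omega> - q \<omega>))"
    if [measurable]: "p \<in> borel_measurable M" "q \<in> borel_measurable M"
      and le: "\<And>\<omega>. regular \<omega> \<Longrightarrow> norm (p \<omega>) \<le> rc R" "\<And>\<omega>. regular \<omega> \<Longrightarrow> norm (q \<omega>) \<le> rc R"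
    for p q :: "'w \<Rightarrow> 'z::euclidean_space"
  proof (rule integrable_const_bound[where B = "2 * rc R"])
    show "AE \<omega> in M. norm (norm (p \<omega> - q \<omega>)) \<le> 2 * rc R"
      using regular_AE
    proof eventually_elim
      case (elim \<omega>)
      then show ?case using le[OF elim] norm_triangle_ineq4[of "p \<omega>" "q \<omega>"] by simp
    qed
  qed measurable
  show "integrable M (\<lambda>\<omega>. \<bar>pC (\<theta> k \<omega>) i - Ct k \<omega> i\<bar>)" if "i < n"
    using bounded[of "\<lambda>\<omega>. pC (\<theta> k \<omega>) i" "\<lambda>\<omega>. Ct k \<omega> i"] sgd_bounds_\<omega>(1)[OF _ k that] limit_bounds(1)
    by (simp add: Ct_def)
  show "integrable M (\<lambda>\<omega>. norm (pW1 (\<theta> k \<omega>) j - W1t k \<omega> j))" if "j < N"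
    using bounded[of "\<lambda>\<omega>. pW1 (\<theta> k \<omega>) j" "\<lambda>\<omega>. W1t k \<omega> j"] sgd_bounds_\<omega>(3)[OF _ k that] limit_bounds(3)
    by (simp add: W1t_def)
  show "integrable M (\<lambda>\<omega>. \<bar>pW2 (\<theta> k \<omega>) i j - W2t k \<omega> i j\<bar>)" if "i < n" "j < N"
    using bounded[of "\<lambda>\<omega>. pW2 (\<theta> k \<omega>) i j" "\<lambda>\<omega>. W2t k \<omega> i j"] sgd_bounds_\<omega>(2)[OF _ k that] limit_bounds(2)
    by (simp add: W2t_def)
qed

lemma err_integrable: "k \<le> N \<Longrightarrow> integrable M (err k)"
  unfolding err_def[abs_def] dist_C_def dist_W1_def dist_W2_def avg_real
  by (intro Bochner_Integration.integrable_add integrable_mult_right Bochner_Integration.integrable_sum diff_integrable) auto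

context
  fixes h :: "'a \<times> real \<Rightarrow> 'a" and k m :: nat
  assumes h [measurable]: "h \<in> borel_measurable borel"
begin

abbreviation (input) "xr \<omega> \<equiv> h (XY m \<omega>)"

lemma fluct_Z_expectation:
  "integrable M (\<lambda>\<omega>. fluct_Z \<sigma> N (W1t k \<omega>) (W2t k \<omega>) (Zt k (xr \<omega>) \<omega>) (xr \<omega>) i)" (is ?I)
  "expectation (\<lambda>\<omega>. fluct_Z \<sigma> N (W1t k \<omega>) (W2t k \<omega>) (Zt k (xr \<omega>) \<omega>) (xr \<omega>) i) \<le> 2 * (R * S) / sqrt (real N)" (is ?E)
proof -
  define \<phi> where "\<phi> q = W2 (\<tau> k) (fst (fst q)) (fst (snd q)) (snd (snd q)) * \<sigma> (W1 (\<tau> k) (fst (snd q)) \<bullet> snd (fst q))" for q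
  have \<phi>_meas [measurable]: "\<phi> \<in> borel_measurable ((borel \<Otimes>\<^sub>M borel) \<Otimes>\<^sub>M (borel \<Otimes>\<^sub>M borel))"
    unfolding \<phi>_def by measurable
  have \<phi>_le: "\<bar>\<phi> q\<bar> \<le> R * S" for q
    using bounds(2) sigma_bound(1) R_nonneg by (auto simp: \<phi>_def abs_mult intro!: mult_mono)
  interpret P: pair_prob_space mu_W1 mu_W2 ..
  have mean: "(\<integral>z. \<phi> ((c, x), z) \<partial>(mu_W1 \<Otimes>\<^sub>M mu_W2)) = Zf (W1 (\<tau> k)) (W2 (\<tau> k)) c x" for c x
    unfolding mf_Z_def
    by (subst P.integral_fst'[symmetric])
      (use \<phi>_le in \<open>auto simp: \<phi>_def intro!: P.integrable_const_bound[where B = "R * S"]\<close>)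
  have eq: "fluct_Z \<sigma> N (W1t k \<omega>) (W2t k \<omega>) (Zt k (xr \<omega>) \<omega>) (xr \<omega>) i = 1 / real N *
      \<bar>\<Sum>j<N. \<phi> ((C0 i \<omega>, xr \<omega>), (W10 j \<omega>, W20 i j \<omega>)) -
        (\<integral>z. \<phi> ((C0 i \<omega>, xr \<omega>), z) \<partial>(mu_W1 \<Otimes>\<^sub>M mu_W2))\<bar>" for \<omega>
    unfolding fluct_Z_def avg_minus_const[OF N] mean by (simp add: \<phi>_def W1t_def W2t_def Zt_def)
  have le: "fluct_Z \<sigma> N (W1t k \<omega>) (W2t k \<omega>) (Zt k (xr \<omega>) \<omega>) (xr \<omega>) i \<le> 2 * (R * S)" for \<omega>
  proof -
    have "norm (avg N (\<lambda>j. W2t k \<omega> i j * \<sigma> (W1t k \<omega> j \<bullet> xr \<omega>))) \<le> R * S"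
      using \<phi>_le[of "((C0 i \<omega>, xr \<omega>), (W10 _ \<omega>, W20 i _ \<omega>))"] R_nonneg S_nonneg
      by (intro norm_avg_bound) (auto simp: \<phi>_def W1t_def W2t_def)
    then show ?thesis using slice_bounds(1)[of "\<tau> k" "C0 i \<omega>" "xr \<omega>"] by (simp add: fluct_Z_def Zt_def)
  qed
  show ?I
    by (rule integrable_const_bound[where B = "2 * (R * S)"])
      (use le in \<open>auto simp: fluct_Z_def avg_def W1t_def W2t_def Zt_def\<close>)
  show ?E
    using hidden_average[OF h \<phi>_meas \<phi>_le, where n = N and i = i and k = m] N
    unfolding eq integral_mult_right_zero
    by (subst sqrt_over[OF N, THEN arg_cong[where f = "\<lambda>z. 2 * (R * S) * z"], simplified, symmetric])
      (simp add: divide_right_mono)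
qed

lemma fluct_g_expectation:
  "integrable M (\<lambda>\<omega>. fluct_g \<sigma> n (Ct k \<omega>) (Zt k (xr \<omega>) \<omega>) (Gt k (xr \<omega>)))" (is ?I)
  "expectation (\<lambda>\<omega>. fluct_g \<sigma> n (Ct k \<omega>) (Zt k (xr \<omega>) \<omega>) (Gt k (xr \<omega>))) \<le> 2 * (R * S) / sqrt (real n)" (is ?E)
proof -
  define \<phi> where "\<phi> q = C (\<tau> k) (snd q) * \<sigma> (Zf (W1 (\<tau> k)) (W2 (\<tau> k)) (snd q) (fst q))" for q
  have \<phi>_meas [measurable]: "\<phi> \<in> borel_measurable (borel \<Otimes>\<^sub>M borel)"
    unfolding \<phi>_def by measurable
  have \<phi>_le: "\<bar>\<phi> q\<bar> \<le> R * S" for q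
    using bounds(1) sigma_bound(1) R_nonneg by (auto simp: \<phi>_def abs_mult intro!: mult_mono)
  have mean: "(\<integral>c. \<phi> (x, c) \<partial>mu_c) = gf (C (\<tau> k)) (W1 (\<tau> k)) (W2 (\<tau> k)) x" for x
    by (simp add: mf_g_def mf_H2_def \<phi>_def)
  have eq: "fluct_g \<sigma> n (Ct k \<omega>) (Zt k (xr \<omega>) \<omega>) (Gt k (xr \<omega>)) = 1 / real n *
      \<bar>\<Sum>i<n. \<phi> (xr \<omega>, C0 i \<omega>) - (\<integral>c. \<phi> (xr \<omega>, c) \<partial>mu_c)\<bar>" for \<omega>
    unfolding fluct_g_def avg_minus_const[OF n] mean by (simp add: \<phi>_def Ct_def Zt_def Gt_def)
  have le: "fluct_g \<sigma> n (Ct k \<omega>) (Zt k (xr \<omega>) \<omega>) (Gt k (xr \<omega>)) \<le> 2 * (R * S)" for \<omega>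
  proof -
    have "norm (avg n (\<lambda>i. Ct k \<omega> i * \<sigma> (Zt k (xr \<omega>) \<omega> i))) \<le> R * S"
      using \<phi>_le[of "(xr \<omega>, C0 _ \<omega>)"] R_nonneg S_nonneg
      by (intro norm_avg_bound) (auto simp: \<phi>_def Ct_def Zt_def)
    then show ?thesis using slice_bounds(2)[of "\<tau> k" "xr \<omega>"] by (simp add: fluct_g_def Gt_def)
  qed
  show ?I
    by (rule integrable_const_bound[where B = "2 * (R * S)"])
      (use le in \<open>auto simp: fluct_g_def avg_def Ct_def Zt_def Gt_def\<close>)
  show ?E
    using output_average[OF h \<phi>_meas \<phi>_le, where n = n and k = m] n
    unfolding eq integral_mult_right_zero
    by (subst sqrt_over[OF n, THEN arg_cong[where f = "\<lambda>z. 2 * (R * S) * z"], simplified, symmetric])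
      (simp add: divide_right_mono)
qed

lemma fluct_V_expectation:
  "integrable M (\<lambda>\<omega>. fluct_V \<sigma> n (Ct k \<omega>) (W2t k \<omega>) (Zt k (xr \<omega>) \<omega>) (Vt k (xr \<omega>) \<omega>) j)" (is ?I)
  "expectation (\<lambda>\<omega>. fluct_V \<sigma> n (Ct k \<omega>) (W2t k \<omega>) (Zt k (xr \<omega>) \<omega>) (Vt k (xr \<omega>) \<omega>) j) \<le> 2 * (R * S * R) / sqrt (real n)" (is ?E)
proof -
  define \<phi> where "\<phi> q = C (\<tau> k) (fst (snd q)) * deriv \<sigma> (Zf (W1 (\<tau> k)) (W2 (\<tau> k)) (fst (snd q)) (snd (fst q))) *
    W2 (\<tau> k) (fst (snd q)) (fst (fst q)) (snd (snd q))" for q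
  have \<phi>_meas [measurable]: "\<phi> \<in> borel_measurable ((borel \<Otimes>\<^sub>M borel) \<Otimes>\<^sub>M (borel \<Otimes>\<^sub>M borel))"
    unfolding \<phi>_def by measurable
  have \<phi>_le: "\<bar>\<phi> q\<bar> \<le> R * S * R" for q
    using bounds(1,2) sigma_bound(2) R_nonneg S_nonneg by (auto simp: \<phi>_def abs_mult intro!: mult_mono)
  interpret P: pair_prob_space mu_c mu_W2 ..
  have mean: "(\<integral>z. \<phi> ((w, x), z) \<partial>(mu_c \<Otimes>\<^sub>M mu_W2)) = Vf (C (\<tau> k)) (W1 (\<tau> k)) (W2 (\<tau> k)) w x" for w x
    unfolding mf_V_def
    by (subst P.integral_fst'[symmetric])
      (use \<phi>_le in \<open>auto simp: \<phi>_def intro!: P.integrable_const_bound[where B = "R * S * R"]\<close>)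
  have eq: "fluct_V \<sigma> n (Ct k \<omega>) (W2t k \<omega>) (Zt k (xr \<omega>) \<omega>) (Vt k (xr \<omega>) \<omega>) j = 1 / real n *
      \<bar>\<Sum>i<n. \<phi> ((W10 j \<omega>, xr \<omega>), (C0 i \<omega>, W20 i j \<omega>)) -
        (\<integral>z. \<phi> ((W10 j \<omega>, xr \<omega>), z) \<partial>(mu_c \<Otimes>\<^sub>M mu_W2))\<bar>" for \<omega>
    unfolding fluct_V_def avg_minus_const[OF n] mean by (simp add: \<phi>_def Ct_def W2t_def Zt_def Vt_def)
  have le: "fluct_V \<sigma> n (Ct k \<omega>) (W2t k \<omega>) (Zt k (xr \<omega>) \<omega>) (Vt k (xr \<omega>) \<omega>) j \<le> 2 * (R * S * R)" for \<omega>
  proof -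
    have "norm (avg n (\<lambda>i. Ct k \<omega> i * deriv \<sigma> (Zt k (xr \<omega>) \<omega> i) * W2t k \<omega> i j)) \<le> R * S * R"
      using \<phi>_le[of "((W10 j \<omega>, xr \<omega>), (C0 _ \<omega>, W20 _ j \<omega>))"] R_nonneg S_nonneg
      by (intro norm_avg_bound) (auto simp: \<phi>_def Ct_def Zt_def W2t_def)
    then show ?thesis using slice_bounds(3)[of "\<tau> k" "W10 j \<omega>" "xr \<omega>"] by (simp add: fluct_V_def Vt_def)
  qed
  show ?I
    by (rule integrable_const_bound[where B = "2 * (R * S * R)"])
      (use le in \<open>auto simp: fluct_V_def avg_def Ct_def W2t_def Zt_def Vt_def\<close>)
  show ?E
    using backward_average[OF h \<phi>_meas \<phi>_le, where n = n and j = j and k = m] n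
    unfolding eq integral_mult_right_zero
    by (subst sqrt_over[OF n, THEN arg_cong[where f = "\<lambda>z. 2 * (R * S * R) * z"], simplified, symmetric])
      (simp add: divide_right_mono)
qed

lemma fluct_expectation:
  "integrable M (\<lambda>\<omega>. fluct k (xr \<omega>) \<omega>)"
  "expectation (\<lambda>\<omega>. fluct k (xr \<omega>) \<omega>) \<le> 2 * (R * S * (2 + R)) * rate n N"
proof -
  note Z = expectation_avg_le[OF n fluct_Z_expectation] and V = expectation_avg_le[OF N fluct_V_expectation]
    and g = fluct_g_expectation
  show "integrable M (\<lambda>\<omega>. fluct k (xr \<omega>) \<omega>)"
    unfolding fluct_def by (intro Bochner_Integration.integrable_add Z g V)
  have "expectation (\<lambda>\<omega>. fluct k (xr \<omega>) \<omega>) \<le>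
      2 * (R * S) / sqrt (real N) + 2 * (R * S) / sqrt (real n) + 2 * (R * S * R) / sqrt (real n)"
    unfolding fluct_def using Z g V by (simp add: add_mono)
  also have "\<dots> \<le> 2 * (R * S * (2 + R)) / sqrt (real N) + 2 * (R * S * (2 + R)) / sqrt (real n)"
  proof -
    have "2 * (R * S) \<le> 2 * (R * S * (2 + R))" "2 * (R * S) + 2 * (R * S * R) \<le> 2 * (R * S * (2 + R))"
      using R_nonneg S_nonneg mult_nonneg_nonneg[of R S] mult_nonneg_nonneg[of "R * S" R] by (auto simp: algebra_simps)
    then have "2 * (R * S) / sqrt (real N) \<le> 2 * (R * S * (2 + R)) / sqrt (real N)"
      "(2 * (R * S) + 2 * (R * S * R)) / sqrt (real n) \<le> 2 * (R * S * (2 + R)) / sqrt (real n)"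
      by (auto intro!: divide_right_mono)
    then show ?thesis by (simp add: add_divide_distrib)
  qed
  finally show "expectation (\<lambda>\<omega>. fluct k (xr \<omega>) \<omega>) \<le> 2 * (R * S * (2 + R)) * rate n N"
    by (simp only: rate_def distrib_left times_divide_eq_right mult_1_right)
qed

end

lemma clipped_target_measurable [measurable]:
  assumes [measurable]: "f \<in> borel_measurable K" "g \<in> borel_measurable K" "p \<in> measurable K (borel \<Otimes>\<^sub>M borel)"
  shows "(\<lambda>q. clipped (target_C t (f q)) (p q)) \<in> borel_measurable K"
    "(\<lambda>q. clipped (target_W1 t (g q)) (p q)) \<in> borel_measurable K"
    "(\<lambda>q. clipped (target_W2 t (f q) (g q)) (p q)) \<in> borel_measurable K"
  unfolding clipped_def by measurable

lemma snd_pair_measurable: "snd \<in> measurable (((borel :: real measure) \<Otimes>\<^sub>M (borel :: 'a measure)) \<Otimes>\<^sub>M borel) ((borel :: 'a measure) \<Otimes>\<^sub>M (borel :: real measure))"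
  unfolding borel_prod by (intro borel_measurable_continuous_onI continuous_intros)

lemma noise_expectation:
  "integrable M (\<lambda>\<omega>. noise_C k \<omega> i)" "expectation (\<lambda>\<omega>. noise_C k \<omega> i) \<le> 2 * B * sqrt (real k)"
  "integrable M (\<lambda>\<omega>. noise_W1 k \<omega> j)" "expectation (\<lambda>\<omega>. noise_W1 k \<omega> j) \<le> 2 * B * sqrt (real k)"
  "integrable M (\<lambda>\<omega>. noise_W2 k \<omega> i j)" "expectation (\<lambda>\<omega>. noise_W2 k \<omega> i j) \<le> 2 * B * sqrt (real k)"
proof -
  note [measurable] = snd_pair_measurable
  have meas_rhs [measurable]: "(\<lambda>c. rhsC (C t) (W1 t) (W2 t) c) \<in> borel_measurable borel"
    "(\<lambda>w. rhsW1 (C t) (W1 t) (W2 t) w) \<in> borel_measurable borel"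
    "(\<lambda>p. rhsW2 (C t) (W1 t) (W2 t) (fst p) (snd p)) \<in> borel_measurable (borel \<Otimes>\<^sub>M borel)" for t
    unfolding mf_rhs_C_def mf_rhs_W1_def mf_rhs_W2_def split_beta' by measurable
  have meas_rhs_W2 [measurable]: "(\<lambda>\<omega>. rhsW2 (C t) (W1 t) (W2 t) (C0 i \<omega>) (W10 j \<omega>)) \<in> borel_measurable M" for t
    using measurable_compose[OF _ meas_rhs(3), of "\<lambda>\<omega>. (C0 i \<omega>, W10 j \<omega>)" M t] by simp
  have sum_le: "norm (\<Sum>l<k. a l - b l) \<le> real k * (2 * B)"
    if "\<And>l. norm (a l) \<le> B" "\<And>l. norm (b l) \<le> B" for a b :: "nat \<Rightarrow> 'z::real_normed_vector"
  proof -
    have "norm (a l - b l) \<le> 2 * B" for l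
      using norm_triangle_ineq4[of "a l" "b l"] that(1)[of l] that(2)[of l] by linarith
    then show ?thesis using sum_norm_le[of "{..<k}" "\<lambda>l. a l - b l" "\<lambda>_. 2 * B"] by simp
  qed
  show "integrable M (\<lambda>\<omega>. noise_C k \<omega> i)"
    by (rule integrable_const_bound[where B = "real k * (2 * B)"])
      (use sum_le[OF clipped_target_le(1)] rhs_bound(1) in \<open>auto simp: noise_C_def\<close>)
  show "integrable M (\<lambda>\<omega>. noise_W1 k \<omega> j)"
    by (rule integrable_const_bound[where B = "real k * (2 * B)"])
      (use sum_le[OF clipped_target_le(2)] rhs_bound(2) in \<open>auto simp: noise_W1_def\<close>)
  show "integrable M (\<lambda>\<omega>. noise_W2 k \<omega> i j)"
    by (rule integrable_const_bound[where B = "real k * (2 * B)"])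
      (use sum_le[OF clipped_target_le(3)] rhs_bound(3) in \<open>auto simp: noise_W2_def\<close>)
  show "expectation (\<lambda>\<omega>. noise_C k \<omega> i) \<le> 2 * B * sqrt (real k)"
    using sample_average[of "\<lambda>l q. clipped (target_C (\<tau> l) (fst (fst q))) (snd q)" B i 0 k] clipped_target_le(1)
    by (simp add: noise_C_def integral_target)
  show "expectation (\<lambda>\<omega>. noise_W1 k \<omega> j) \<le> 2 * B * sqrt (real k)"
    using sample_average[of "\<lambda>l q. clipped (target_W1 (\<tau> l) (snd (fst q))) (snd q)" B 0 j k] clipped_target_le(2)
    by (simp add: noise_W1_def integral_target)
  show "expectation (\<lambda>\<omega>. noise_W2 k \<omega> i j) \<le> 2 * B * sqrt (real k)"
    using sample_average[of "\<lambda>l q. clipped (target_W2 (\<tau> l) (fst (fst q)) (snd (fst q))) (snd q)" B i j k] clipped_target_le(3)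
    by (simp add: noise_W2_def integral_target)
qed

lemma noise_total_expectation:
  "integrable M (noise k)" "expectation (noise k) \<le> 6 * B * sqrt (real k)"
proof -
  note C = expectation_avg_le[where f = "\<lambda>i \<omega>. noise_C k \<omega> i", OF n noise_expectation(1,2)]
    and W1 = expectation_avg_le[where f = "\<lambda>j \<omega>. noise_W1 k \<omega> j", OF N noise_expectation(3,4)]
  have W2': "integrable M (\<lambda>\<omega>. avg N (noise_W2 k \<omega> i))" "expectation (\<lambda>\<omega>. avg N (noise_W2 k \<omega> i)) \<le> 2 * B * sqrt (real k)" for i
    using expectation_avg_le[where f = "\<lambda>j \<omega>. noise_W2 k \<omega> i j", OF N noise_expectation(5,6)] by simp_all
  note W2 = expectation_avg_le[where f = "\<lambda>i \<omega>. avg N (noise_W2 k \<omega> i)", OF n W2']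
  show "integrable M (noise k)"
    unfolding noise_def[abs_def] by (intro Bochner_Integration.integrable_add C W1 W2)
  have "expectation (noise k) = expectation (\<lambda>\<omega>. avg n (noise_C k \<omega>)) +
      expectation (\<lambda>\<omega>. avg N (noise_W1 k \<omega>)) + expectation (\<lambda>\<omega>. avg n (\<lambda>i. avg N (noise_W2 k \<omega> i)))"
    unfolding noise_def[abs_def] using C W1 W2 by simp
  then show "expectation (noise k) \<le> 6 * B * sqrt (real k)" using C(2) W1(2) W2(2) by linarith
qed

lemma K_nonneg: "0 \<le> K_step (rc R)" "0 \<le> K_g (rc R)" "0 \<le> K_fluct" "0 \<le> K_err"
proof -
  note nn = R_nonneg S_nonneg Q_nonneg R_le_rc(2) B_nonneg L_nonneg
  show 1: "0 \<le> K_step (rc R)" "0 \<le> K_g (rc R)" "0 \<le> K_fluct"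
    using nn by (auto simp: K_step_def K_Z_def K_g_def K_V_def K_fluct_def intro!: add_nonneg_nonneg mult_nonneg_nonneg)
  then show "0 \<le> K_err" using nn by (auto simp: K_err_def)
qed

lemma rate_bounds: "1 / sqrt (real N) \<le> rate n N" "1 / real N \<le> rate n N" "0 \<le> rate n N"
proof -
  show 1: "1 / sqrt (real N) \<le> rate n N" "0 \<le> rate n N" by (auto simp: rate_def)
  have "sqrt (real N) * 1 \<le> sqrt (real N) * sqrt (real N)" using N by (intro mult_left_mono) auto
  then have "1 / real N \<le> 1 / sqrt (real N)" using N by (intro divide_left_mono) auto
  with 1 show "1 / real N \<le> rate n N" by linarith
qed

lemma err_expectation:
  assumes k: "k \<le> N"
  shows "expectation (err k) \<le> K_err * rate n N"
proof -
  define Ks where "Ks = K_step (rc R)"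
  have Ks: "0 \<le> Ks" using K_nonneg by (simp add: Ks_def)
  define A where "A = (Ks * K_fluct + 6 * B + 3 * L) * rate n N"
  have rec: "expectation (err k) \<le> A + Ks / real N * (\<Sum>l<k. expectation (err l))" if k: "k \<le> N" for k
  proof -
    define fl where "fl l \<omega> = fluct l (fst (XY l \<omega>)) \<omega>" for l \<omega>
    have fst_meas: "fst \<in> borel_measurable (borel :: ('a \<times> real) measure)"
      by (intro borel_measurable_continuous_onI continuous_intros)
    have fl: "integrable M (fl l)" "expectation (fl l) \<le> K_fluct * rate n N" for l
      using fluct_expectation[OF fst_meas, of l l] by (simp_all add: fl_def[abs_def] K_fluct_def)
    define r where "r \<omega> = 1 / real N * (\<Sum>l<k. Ks * (err l \<omega> + fl l \<omega>)) + 1 / real N * noise k \<omega> + 3 * (L / real N)" for \<omega>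
    have "has_bochner_integral M r (1 / real N * (\<Sum>l<k. Ks * (expectation (err l) + expectation (fl l)))
        + 1 / real N * expectation (noise k) + expectation (\<lambda>_. 3 * (L / real N)))"
      unfolding r_def using k
      by (intro has_bochner_integral_add has_bochner_integral_mult_right has_bochner_integral_sum
          has_bochner_integral_integrable err_integrable fl noise_total_expectation) auto
    then have r: "integrable M r" "expectation r = 1 / real N * (\<Sum>l<k. Ks * (expectation (err l) + expectation (fl l)))
        + 1 / real N * expectation (noise k) + 3 * (L / real N)"
      by (auto simp: has_bochner_integral_iff prob_space)
    have "expectation (err k) \<le> expectation r"
      using regular_AE err_step[OF _ k] unfolding r_def fl_def Ks_def
      by (intro integral_mono_AE err_integrable[OF k] r(1)[unfolded r_def fl_def Ks_def]) (auto elim!: eventually_mono)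
    also have "\<dots> \<le> 1 / real N * (\<Sum>l<k. Ks * (expectation (err l) + K_fluct * rate n N))
        + 1 / real N * (6 * B * sqrt (real k)) + 3 * (L / real N)"
      unfolding r(2) using Ks fl noise_total_expectation
      by (intro add_mono mult_left_mono sum_mono) auto
    also have "\<dots> = Ks / real N * (\<Sum>l<k. expectation (err l)) + real k / real N * (Ks * K_fluct * rate n N)
        + 6 * B * (sqrt (real k) / real N) + 3 * L * (1 / real N)"
      by (simp add: distrib_left sum.distrib sum_distrib_left field_simps)
    also have "\<dots> \<le> Ks / real N * (\<Sum>l<k. expectation (err l)) + 1 * (Ks * K_fluct * rate n N)
        + 6 * B * rate n N + 3 * L * rate n N"
    proof (intro add_mono order_refl mult_right_mono mult_left_mono)
      show "real k / real N \<le> 1" using k N by simp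
      have "sqrt (real k) / real N \<le> sqrt (real N) / real N" using k by (intro divide_right_mono) auto
      then show "sqrt (real k) / real N \<le> rate n N" using rate_bounds(1) sqrt_over[OF N] by linarith
      show "1 / real N \<le> rate n N" by (rule rate_bounds)
    qed (use Ks K_nonneg rate_bounds B_nonneg L_nonneg in auto)
    finally show ?thesis by (simp add: A_def algebra_simps)
  qed
  have A: "0 \<le> A" using Ks K_nonneg rate_bounds B_nonneg L_nonneg by (auto simp: A_def)
  have "expectation (err k) \<le> A * (1 + Ks / real N) ^ k"
    by (rule discrete_gronwall[of N "\<lambda>k. expectation (err k)", OF rec _ k]) (use Ks in auto)
  also have "\<dots> \<le> A * exp Ks"
  proof -
    have "(1 + Ks / real N) ^ k \<le> (1 + Ks / real N) ^ N" using Ks k by (intro power_increasing) auto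
    also have "\<dots> \<le> exp Ks" using N Ks by (intro exp_ge_one_plus_x_over_n_power_n) auto
    finally show ?thesis using A by (rule mult_left_mono)
  qed
  finally show ?thesis by (simp add: A_def K_err_def Ks_def mult_ac)
qed

theorem net_expectation:
  assumes t: "t \<in> {0..1}" and x: "norm x \<le> Q"
  shows "integrable M (\<lambda>\<omega>. \<bar>net \<sigma> N n (sgd_at \<sigma> C0 W20 W10 XY N n t \<omega>) x - gf (C t) (W1 t) (W2 t) x\<bar>)"
    "expectation (\<lambda>\<omega>. \<bar>net \<sigma> N n (sgd_at \<sigma> C0 W20 W10 XY N n t \<omega>) x - gf (C t) (W1 t) (W2 t) x\<bar>) \<le> K_final * rate n N"
    "(\<lambda>\<omega>. net \<sigma> N n (sgd_at \<sigma> C0 W20 W10 XY N n t \<omega>) x) \<in> borel_measurable M"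
proof -
  define k where "k = nat \<lfloor>real N * t\<rfloor>"
  have Nt: "0 \<le> real N * t" "real N * t \<le> real N" using t by (auto simp: mult_left_le)
  have kt: "real k \<le> real N * t" "real N * t < real k + 1" using Nt(1) unfolding k_def by linarith+
  have k: "k \<le> N" using kt Nt by linarith
  have eq: "sgd_at \<sigma> C0 W20 W10 XY N n t \<omega> = \<theta> k \<omega>" for \<omega>
    by (simp add: sgd_at_def \<theta>_def k_def)
  have "\<tau> k \<le> t" "t < \<tau> k + 1 / real N" using kt N by (auto simp: \<tau>_def field_simps)
  then have close: "\<bar>t - \<tau> k\<bar> \<le> 1 / real N" by auto
  have gd: "\<bar>Gt k x - gf (C t) (W1 t) (W2 t) x\<bar> \<le> L_g R * B * rate n N"
  proof -
    have Lg: "0 \<le> L_g R" using R_nonneg S_nonneg Q_nonneg by (auto simp: L_g_def L_Z_def)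
    have "\<bar>Gt k x - gf (C t) (W1 t) (W2 t) x\<bar> \<le> L_g R * (B * \<bar>\<tau> k - t\<bar>)"
      unfolding Gt_def by (rule g_time_diff[OF t \<tau>(1)[OF k] x])
    also have "\<dots> \<le> L_g R * (B * rate n N)"
      using close rate_bounds(2) Lg B_nonneg by (intro mult_left_mono) (auto simp: abs_minus_commute)
    finally show ?thesis by (simp add: mult.assoc)
  qed
  note fl = fluct_expectation[of "\<lambda>_. x" k 0, folded K_fluct_def, simplified]
  define r where "r \<omega> = K_g (rc R) * (err k \<omega> + fluct k x \<omega>) + L_g R * B * rate n N" for \<omega>
  have "has_bochner_integral M r (K_g (rc R) * (expectation (err k) + expectation (fluct k x)) + expectation (\<lambda>_. L_g R * B * rate n N))"
    unfolding r_def using k fl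
    by (intro has_bochner_integral_add has_bochner_integral_mult_right
        has_bochner_integral_integrable err_integrable) auto
  then have r: "integrable M r" "expectation r = K_g (rc R) * (expectation (err k) + expectation (fluct k x)) + L_g R * B * rate n N"
    by (auto simp: has_bochner_integral_iff prob_space)
  have le: "AE \<omega> in M. \<bar>net \<sigma> N n (\<theta> k \<omega>) x - gf (C t) (W1 t) (W2 t) x\<bar> \<le> r \<omega>"
    using regular_AE
  proof eventually_elim
    case (elim \<omega>)
    show ?case using net_diff[OF elim k x] gd unfolding r_def by linarith
  qed
  show meas: "(\<lambda>\<omega>. net \<sigma> N n (sgd_at \<sigma> C0 W20 W10 XY N n t \<omega>) x) \<in> borel_measurable M"
    unfolding eq by measurable
  show int: "integrable M (\<lambda>\<omega>. \<bar>net \<sigma> N n (sgd_at \<sigma> C0 W20 W10 XY N n t \<omega>) x - gf (C t) (W1 t) (W2 t) x\<bar>)"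
    by (rule Bochner_Integration.integrable_bound[OF r(1)]) (use meas le in \<open>auto simp: eq elim!: eventually_mono\<close>)
  have "expectation (\<lambda>\<omega>. \<bar>net \<sigma> N n (sgd_at \<sigma> C0 W20 W10 XY N n t \<omega>) x - gf (C t) (W1 t) (W2 t) x\<bar>) \<le> expectation r"
    by (rule integral_mono_AE[OF int r(1)]) (use le in \<open>simp add: eq\<close>)
  also have "\<dots> \<le> K_g (rc R) * (K_err * rate n N + K_fluct * rate n N) + L_g R * B * rate n N"
    unfolding r(2) using K_nonneg err_expectation[OF k] fl by (intro add_right_mono mult_left_mono add_mono) auto
  finally show "expectation (\<lambda>\<omega>. \<bar>net \<sigma> N n (sgd_at \<sigma> C0 W20 W10 XY N n t \<omega>) x - gf (C t) (W1 t) (W2 t) x\<bar>) \<le> K_final * rate n N"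
    by (simp add: K_final_def algebra_simps)
qed

end

lemma sgd_at_regular:
  assumes n: "0 < n" and N: "0 < N" and t: "t \<in> {0..1}"
  shows "(\<lambda>\<omega>. pC (sgd_at \<sigma> C0 W20 W10 XY N n t \<omega>) i) \<in> borel_measurable M"
    "(\<lambda>\<omega>. pW1 (sgd_at \<sigma> C0 W20 W10 XY N n t \<omega>) j) \<in> borel_measurable M"
    "(\<lambda>\<omega>. pW2 (sgd_at \<sigma> C0 W20 W10 XY N n t \<omega>) i j) \<in> borel_measurable M"
    "AE \<omega> in M. \<forall>i<n. \<bar>pC (sgd_at \<sigma> C0 W20 W10 XY N n t \<omega>) i\<bar> \<le> rc R \<and>
      (\<forall>j<N. \<bar>pW2 (sgd_at \<sigma> C0 W20 W10 XY N n t \<omega>) i j\<bar> \<le> rc R)"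
proof -
  define k where "k = nat \<lfloor>real N * t\<rfloor>"
  have "real N * t \<le> real N" using t by (auto simp: mult_left_le)
  then have k: "k \<le> N" unfolding k_def by linarith
  have eq: "sgd_at \<sigma> C0 W20 W10 XY N n t \<omega> = \<theta> n N k \<omega>" for \<omega>
    by (simp add: sgd_at_def \<theta>_def[OF n N] k_def)
  show "(\<lambda>\<omega>. pC (sgd_at \<sigma> C0 W20 W10 XY N n t \<omega>) i) \<in> borel_measurable M"
    "(\<lambda>\<omega>. pW1 (sgd_at \<sigma> C0 W20 W10 XY N n t \<omega>) j) \<in> borel_measurable M"
    "(\<lambda>\<omega>. pW2 (sgd_at \<sigma> C0 W20 W10 XY N n t \<omega>) i j) \<in> borel_measurable M"
    unfolding eq by (rule \<theta>_measurable[OF n N])+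
  show "AE \<omega> in M. \<forall>i<n. \<bar>pC (sgd_at \<sigma> C0 W20 W10 XY N n t \<omega>) i\<bar> \<le> rc R \<and>
      (\<forall>j<N. \<bar>pW2 (sgd_at \<sigma> C0 W20 W10 XY N n t \<omega>) i j\<bar> \<le> rc R)"
    unfolding eq using regular_AE[OF n N]
    by eventually_elim (use sgd_bounds_\<omega>[OF n N _ k] in blast)
qed

end

section \<open>First-layer limits\<close>

lemma (in prob_space) expectation_conv_imp_prob_conv:
  fixes X :: "nat \<Rightarrow> 'a \<Rightarrow> real" and Y :: "'a \<Rightarrow> real"
  assumes [measurable]: "\<And>n. X n \<in> borel_measurable M" "Y \<in> borel_measurable M"
    and conv: "\<And>f :: real \<Rightarrow> real. continuous_on UNIV f \<Longrightarrow> (\<And>x. \<bar>f x\<bar> \<le> 1) \<Longrightarrow>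
      (\<lambda>n. expectation (\<lambda>\<omega>. f (X n \<omega>))) \<longlonglongrightarrow> expectation (\<lambda>\<omega>. f (Y \<omega>))"
    and null: "\<P>(\<omega> in M. \<bar>Y \<omega> - g\<bar> = \<epsilon>) = 0"
  shows "(\<lambda>n. \<P>(\<omega> in M. \<bar>X n \<omega> - g\<bar> > \<epsilon>)) \<longlonglongrightarrow> \<P>(\<omega> in M. \<bar>Y \<omega> - g\<bar> > \<epsilon>)"
proof -
  define A where "A = {z::real. \<bar>z - g\<bar> > \<epsilon>}"
  have "open A" unfolding A_def by (intro open_Collect_less continuous_intros)
  then have A [measurable]: "A \<in> sets borel" by simp
  have fr: "frontier A \<subseteq> {z. \<bar>z - g\<bar> = \<epsilon>}"
  proof -
    have "closure A \<subseteq> {z. \<bar>z - g\<bar> \<ge> \<epsilon>}"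
      by (rule closure_minimal) (auto simp: A_def intro!: closed_Collect_le continuous_intros)
    with \<open>open A\<close> show ?thesis by (auto simp: frontier_def interior_open A_def)
  qed
  have rd: "real_distribution (distr M borel (X n))" "real_distribution (distr M borel Y)" for n
    by (auto simp: real_distribution_def real_distribution_axioms_def intro!: prob_space_distr)
  have weak: "weak_conv_m (\<lambda>n. distr M borel (X n)) (distr M borel Y)"
    by (rule integral_bdd_continuous_conv_imp_weak_conv)
      (use rd conv in \<open>auto simp: integral_distr borel_measurable_continuous_onI continuous_at_imp_continuous_on\<close>)
  have "measure (distr M borel Y) {z. \<bar>z - g\<bar> = \<epsilon>} = 0"
    using null by (subst measure_distr) (auto simp: vimage_def Int_def conj_commute)
  then have null': "measure (distr M borel Y) (frontier A) = 0"
  proof -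
    interpret D: real_distribution "distr M borel Y" by (rule rd)
    have "measure (distr M borel Y) (frontier A) \<le> measure (distr M borel Y) {z. \<bar>z - g\<bar> = \<epsilon>}"
      by (intro D.finite_measure_mono fr) (auto intro!: borel_closed closed_Collect_eq continuous_intros)
    with \<open>measure (distr M borel Y) {z. \<bar>z - g\<bar> = \<epsilon>} = 0\<close> show ?thesis
      using measure_nonneg[of "distr M borel Y" "frontier A"] by linarith
  qed
  have "(\<lambda>n. measure (distr M borel (X n)) A) \<longlonglongrightarrow> measure (distr M borel Y) A"
    using weak_conv_imp_continuity_set_conv[OF rd weak A] null' rd(2)
    by (simp add: real_distribution_def prob_space_def finite_measure.emeasure_eq_measure)
  then show ?thesis
    by (simp add: measure_distr A_def vimage_def Int_def conj_commute)
qed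

lemma measurable_phase [measurable]:
  "(\<lambda>p. fst p) \<in> borel_measurable (phase n)"
  "i < n \<Longrightarrow> (\<lambda>p. fst (snd p) i) \<in> borel_measurable (phase n)"
  "i < n \<Longrightarrow> (\<lambda>p. snd (snd p) i) \<in> borel_measurable (phase n)"
  unfolding phase_def by measurable

lemma continuous_on_phase_coords:
  fixes A :: "'a::euclidean_space point set"
  shows "continuous_on A (\<lambda>p. fst (snd p) i)" "continuous_on A (\<lambda>p. snd (snd p) i)"
  by (rule continuous_on_compose2[OF continuous_on_product_coordinates], rule continuous_on_fst[OF continuous_on_snd[OF continuous_on_id]], simp,
    rule continuous_on_compose2[OF continuous_on_product_coordinates], rule continuous_on_snd[OF continuous_on_snd[OF continuous_on_id]], simp)

definition clamp_real :: "real \<Rightarrow> real \<Rightarrow> real" where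
  "clamp_real R z = max (- R) (min R z)"

lemma clamp_real:
  "0 \<le> R \<Longrightarrow> \<bar>clamp_real R z\<bar> \<le> R" "\<bar>z\<bar> \<le> R \<Longrightarrow> clamp_real R z = z"
  "continuous_on UNIV (clamp_real R)" "clamp_real R \<in> borel_measurable borel"
  by (auto simp: clamp_real_def[abs_def] intro!: continuous_intros)

locale first_layer = prob_space M for M :: "'w measure" +
  fixes \<sigma> :: "real \<Rightarrow> real" and S R :: real and n :: nat
    and \<Theta> :: "nat \<Rightarrow> real \<Rightarrow> 'w \<Rightarrow> 'a::euclidean_space params" and \<gamma> :: "real \<Rightarrow> 'w \<Rightarrow> 'a point measure"
    and t :: real and x :: 'a
  assumes \<sigma>_cont: "continuous_on UNIV \<sigma>" and \<sigma>_bound: "\<And>z. \<bar>\<sigma> z\<bar> \<le> S"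
    and R: "0 \<le> R" and n: "0 < n" and t: "t \<in> {0..1}"
    and \<Theta>_meas [measurable]: "\<And>N i. 0 < N \<Longrightarrow> (\<lambda>\<omega>. pC (\<Theta> N t \<omega>) i) \<in> borel_measurable M"
      "\<And>N j. 0 < N \<Longrightarrow> (\<lambda>\<omega>. pW1 (\<Theta> N t \<omega>) j) \<in> borel_measurable M"
      "\<And>N i j. 0 < N \<Longrightarrow> (\<lambda>\<omega>. pW2 (\<Theta> N t \<omega>) i j) \<in> borel_measurable M"
    and \<Theta>_bound: "\<And>N. 0 < N \<Longrightarrow> AE \<omega> in M. \<forall>i<n. \<bar>pC (\<Theta> N t \<omega>) i\<bar> \<le> R \<and> (\<forall>j<N. \<bar>pW2 (\<Theta> N t \<omega>) i j\<bar> \<le> R)"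
    and \<gamma>_meas: "\<gamma> t \<in> measurable M (prob_algebra (phase n))"
    and \<gamma>_conv: "process_converges_in_distribution M n (\<lambda>N t \<omega>. empirical N n (\<Theta> N t \<omega>)) \<gamma>"
begin

lemma \<sigma>_meas [measurable]: "\<sigma> \<in> borel_measurable borel"
  by (rule borel_measurable_continuous_onI[OF \<sigma>_cont])

lemma S_nonneg: "0 \<le> S" using \<sigma>_bound[of 0] by linarith

lemmas [measurable] = clamp_real(4)

lemma \<gamma>_subprob [measurable]: "\<gamma> t \<in> measurable M (subprob_algebra (phase n))"
  by (rule measurable_prob_algebraD[OF \<gamma>_meas])

lemma \<gamma>_prob: "\<omega> \<in> space M \<Longrightarrow> prob_space (\<gamma> t \<omega>)" "\<omega> \<in> space M \<Longrightarrow> sets (\<gamma> t \<omega>) = sets (phase n)"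
  using measurable_space[OF \<gamma>_meas] by (auto simp: space_prob_algebra)

lemma integral_empirical:
  fixes f :: "'a point \<Rightarrow> real"
  assumes [measurable]: "f \<in> borel_measurable (phase n)"
  shows "(\<integral>p. f p \<partial>empirical N n \<theta>) =
    (\<Sum>j<N. f (pW1 \<theta> j, restrict (\<lambda>i. pW2 \<theta> i j) {..<n}, restrict (pC \<theta>) {..<n})) / real N"
proof -
  have "(\<lambda>j. (pW1 \<theta> j, restrict (\<lambda>i. pW2 \<theta> i j) {..<n}, restrict (pC \<theta>) {..<n}))
      \<in> measurable (uniform_count_measure {..<N}) (phase n)"
    by (auto simp: phase_def measurable_def space_uniform_count_measure sets_uniform_count_measure
        space_pair_measure space_PiM)
  then show ?thesis
    unfolding empirical_def by (subst integral_distr) (auto simp: integral_uniform_count_measure)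
qed

lemma functional_limit:
  fixes F :: "'a point measure \<Rightarrow> real"
  assumes "\<And>p ps. (\<And>k. ps k \<in> space (prob_algebra (phase n))) \<Longrightarrow> p \<in> space (prob_algebra (phase n)) \<Longrightarrow>
      weakly_converges n ps p \<Longrightarrow> (\<lambda>k. F (ps k)) \<longlonglongrightarrow> F p"
    and "bounded (range F)"
  shows "(\<lambda>N. expectation (\<lambda>\<omega>. F (empirical N n (\<Theta> N t \<omega>)))) \<longlonglongrightarrow> expectation (\<lambda>\<omega>. F (\<gamma> t \<omega>))"
proof -
  have "continuous_functional n {t} (\<lambda>ps. F (ps t))"
    using assms(1) by (auto simp: continuous_functional_def)
  moreover have "bounded (range (\<lambda>ps :: real \<Rightarrow> 'a point measure. F (ps t)))"
    by (rule bounded_subset[OF assms(2)]) auto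
  ultimately show ?thesis
    using \<gamma>_conv[unfolded process_converges_in_distribution_def, rule_format, of "{t}" "\<lambda>ps. F (ps t)"] t by simp
qed

definition "excess p = min 1 (\<Sum>i<n. max 0 (\<bar>fst (snd p) i\<bar> - R) + max 0 (\<bar>snd (snd p) i\<bar> - R))"
  for p :: "'a point"

lemma excess_bounds: "0 \<le> excess p" "excess p \<le> 1"
  by (auto simp: excess_def intro!: sum_nonneg)

lemma excess_meas [measurable]: "excess \<in> borel_measurable (phase n)"
  unfolding excess_def by measurable

lemma excess_continuous: "bounded_continuous n excess"
  unfolding bounded_continuous_def
proof
  show "continuous_on (space (phase n)) excess"
    unfolding excess_def by (intro continuous_intros continuous_on_phase_coords)
  show "bounded (excess ` space (phase n))"
    using excess_bounds by (auto simp: bounded_iff intro!: exI[of _ 1])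
qed

lemma support_AE: "AE \<omega> in M. AE p in \<gamma> t \<omega>. \<forall>i<n. \<bar>fst (snd p) i\<bar> \<le> R \<and> \<bar>snd (snd p) i\<bar> \<le> R"
proof -
  define F where "F p = min 1 \<bar>\<integral>q. excess q \<partial>p\<bar>" for p :: "'a point measure"
  have F: "0 \<le> F p" "F p \<le> 1" for p by (auto simp: F_def)
  have lim: "(\<lambda>N. expectation (\<lambda>\<omega>. F (empirical N n (\<Theta> N t \<omega>)))) \<longlonglongrightarrow> expectation (\<lambda>\<omega>. F (\<gamma> t \<omega>))"
  proof (rule functional_limit)
    show "bounded (range F)" using F by (auto simp: bounded_iff intro!: exI[of _ 1])
    fix p and ps :: "nat \<Rightarrow> 'a point measure" assume "weakly_converges n ps p"
    then have "(\<lambda>k. \<integral>q. excess q \<partial>ps k) \<longlonglongrightarrow> (\<integral>q. excess q \<partial>p)"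
      using excess_continuous by (simp add: weakly_converges_def)
    then show "(\<lambda>k. F (ps k)) \<longlonglongrightarrow> F p" unfolding F_def by (intro tendsto_intros)
  qed
  have zero: "expectation (\<lambda>\<omega>. F (empirical N n (\<Theta> N t \<omega>))) = 0" if "0 < N" for N
  proof (rule integral_eq_zero_AE)
    show "AE \<omega> in M. F (empirical N n (\<Theta> N t \<omega>)) = 0"
      using \<Theta>_bound[OF that]
    proof eventually_elim
      case (elim \<omega>)
      then have "excess (pW1 (\<Theta> N t \<omega>) j, restrict (\<lambda>i. pW2 (\<Theta> N t \<omega>) i j) {..<n}, restrict (pC (\<Theta> N t \<omega>)) {..<n}) = 0"
        if "j < N" for j
        using that by (simp add: excess_def)
      then show ?case by (simp add: F_def integral_empirical)
    qed
  qed
  then have "(\<lambda>N. expectation (\<lambda>\<omega>. F (empirical N n (\<Theta> N t \<omega>)))) \<longlonglongrightarrow> 0"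
    by (intro tendsto_eventually eventually_mono[OF eventually_gt_at_top[of 0]]) auto
  with lim have "expectation (\<lambda>\<omega>. F (\<gamma> t \<omega>)) = 0" by (rule LIMSEQ_unique)
  moreover have F_meas: "(\<lambda>\<omega>. F (\<gamma> t \<omega>)) \<in> borel_measurable M"
    unfolding F_def by measurable
  moreover have "integrable M (\<lambda>\<omega>. F (\<gamma> t \<omega>))"
    using F F_meas by (intro integrable_const_bound[where B = 1]) auto
  ultimately have "AE \<omega> in M. F (\<gamma> t \<omega>) = 0"
    using F by (subst integral_nonneg_eq_0_iff_AE[symmetric]) auto
  then show ?thesis using AE_space
  proof eventually_elim
    case (elim \<omega>)
    interpret \<gamma>: prob_space "\<gamma> t \<omega>" by (rule \<gamma>_prob(1)[OF elim(2)])
    note [measurable_cong] = \<gamma>_prob(2)[OF elim(2)]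
    have meas: "excess \<in> borel_measurable (\<gamma> t \<omega>)"
      using excess_meas by (simp add: measurable_cong_sets[OF \<gamma>_prob(2)[OF elim(2)] refl])
    then have "integrable (\<gamma> t \<omega>) excess"
      using excess_bounds by (intro \<gamma>.integrable_const_bound[where B = 1]) auto
    moreover have "(\<integral>q. excess q \<partial>\<gamma> t \<omega>) = 0" using elim(1) by (auto simp: F_def min_def split: if_splits)
    ultimately have "AE p in \<gamma> t \<omega>. excess p = 0"
      using excess_bounds by (subst integral_nonneg_eq_0_iff_AE[symmetric]) auto
    then show ?case
    proof eventually_elim
      case (elim p)
      then have "(\<Sum>i<n. max 0 (\<bar>fst (snd p) i\<bar> - R) + max 0 (\<bar>snd (snd p) i\<bar> - R)) = 0"
        by (auto simp: excess_def min_def split: if_splits)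
      then have "max 0 (\<bar>fst (snd p) i\<bar> - R) + max 0 (\<bar>snd (snd p) i\<bar> - R) = 0" if "i < n" for i
        using that by (subst (asm) sum_nonneg_eq_0_iff) auto
      then show ?case by (force simp: max_def split: if_splits)
    qed
  qed
qed

definition "mean_C i p = (\<integral>q. clamp_real R (snd (snd q) i) \<partial>p)" for p :: "'a point measure"
definition "mean_Z i p = (\<integral>q. clamp_real R (fst (snd q) i) * \<sigma> (fst q \<bullet> x) \<partial>p)" for p :: "'a point measure"
definition "trunc_g p = avg n (\<lambda>i. mean_C i p * \<sigma> (mean_Z i p))"

lemma trunc_integrands:
  assumes [simp]: "i < n"
  shows "(\<lambda>q. clamp_real R (snd (snd q) i)) \<in> borel_measurable (phase n)"
    "(\<lambda>q. clamp_real R (fst (snd q) i) * \<sigma> (fst q \<bullet> x)) \<in> borel_measurable (phase n)"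
    "(\<lambda>q::'a point. snd (snd q) i) \<in> borel_measurable (phase n)"
    "(\<lambda>q. fst (snd q) i * \<sigma> (fst q \<bullet> x)) \<in> borel_measurable (phase n)"
  by measurable

lemma mean_continuous:
  assumes "weakly_converges n ps p"
  shows "(\<lambda>k. mean_C i (ps k)) \<longlonglongrightarrow> mean_C i p" "(\<lambda>k. mean_Z i (ps k)) \<longlonglongrightarrow> mean_Z i p"
proof -
  have "bounded_continuous n (\<lambda>q::'a point. clamp_real R (snd (snd q) i))"
    unfolding bounded_continuous_def
    by (auto intro!: continuous_on_compose2[OF clamp_real(3)] continuous_on_phase_coords
        simp: bounded_iff intro: exI[of _ R] clamp_real(1)[OF R])
  moreover have "bounded_continuous n (\<lambda>q::'a point. clamp_real R (fst (snd q) i) * \<sigma> (fst q \<bullet> x))"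
    unfolding bounded_continuous_def
    by (auto intro!: continuous_intros continuous_on_compose2[OF clamp_real(3)] continuous_on_compose2[OF \<sigma>_cont]
        continuous_on_phase_coords mult_mono clamp_real(1)[OF R] \<sigma>_bound R exI[of _ "R * S"] simp: bounded_iff abs_mult)
  ultimately show "(\<lambda>k. mean_C i (ps k)) \<longlonglongrightarrow> mean_C i p" "(\<lambda>k. mean_Z i (ps k)) \<longlonglongrightarrow> mean_Z i p"
    using assms by (auto simp: weakly_converges_def mean_C_def mean_Z_def)
qed

lemma trunc_empirical:
  assumes N: "0 < N"
  shows "trunc_g (empirical N n \<theta>) =
    avg n (\<lambda>i. clamp_real R (pC \<theta> i) * \<sigma> (avg N (\<lambda>j. clamp_real R (pW2 \<theta> i j) * \<sigma> (pW1 \<theta> j \<bullet> x))))"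
proof -
  have "mean_C i (empirical N n \<theta>) = clamp_real R (pC \<theta> i)"
    "mean_Z i (empirical N n \<theta>) = avg N (\<lambda>j. clamp_real R (pW2 \<theta> i j) * \<sigma> (pW1 \<theta> j \<bullet> x))" if "i < n" for i
    unfolding mean_C_def mean_Z_def avg_real using N that
      integral_empirical[OF trunc_integrands(1)[OF that]] integral_empirical[OF trunc_integrands(2)[OF that]]
    by simp_all
  then show ?thesis
    unfolding trunc_g_def avg_def[of n] by (intro arg_cong2[where f = scaleR] refl sum.cong) simp
qed

lemma trunc_limit_AE: "AE \<omega> in M. trunc_g (\<gamma> t \<omega>) = fl_g \<sigma> n (\<gamma> t \<omega>) x \<and> \<bar>trunc_g (\<gamma> t \<omega>)\<bar> \<le> R * S"
  using support_AE AE_space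
proof eventually_elim
  case (elim \<omega>)
  interpret \<gamma>: prob_space "\<gamma> t \<omega>" by (rule \<gamma>_prob(1)[OF elim(2)])
  note [measurable_cong] = \<gamma>_prob(2)[OF elim(2)]
  have C: "mean_C i (\<gamma> t \<omega>) = (\<integral>(w, v, c). c i \<partial>\<gamma> t \<omega>)" if i: "i < n" for i
    unfolding mean_C_def split_beta' using i elim(1) trunc_integrands[OF i]
    by (intro integral_cong_AE) (auto simp: clamp_real(2) measurable_cong_sets[OF \<gamma>_prob(2)[OF elim(2)] refl] elim!: eventually_mono)
  have Z: "mean_Z i (\<gamma> t \<omega>) = fl_Z \<sigma> (\<gamma> t \<omega>) i x" if i: "i < n" for i
    unfolding mean_Z_def fl_Z_def split_beta' using i elim(1) trunc_integrands[OF i]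
    by (intro integral_cong_AE) (auto simp: clamp_real(2) measurable_cong_sets[OF \<gamma>_prob(2)[OF elim(2)] refl] elim!: eventually_mono)
  have "\<bar>mean_C i (\<gamma> t \<omega>)\<bar> \<le> R" for i
    unfolding mean_C_def real_norm_def[symmetric]
    by (intro \<gamma>.norm_integral_le_const AE_I2) (simp add: clamp_real(1)[OF R])
  then have "norm (trunc_g (\<gamma> t \<omega>)) \<le> R * S"
    unfolding trunc_g_def using R S_nonneg \<sigma>_bound
    by (intro norm_avg_bound) (auto simp: abs_mult intro!: mult_mono)
  moreover have "trunc_g (\<gamma> t \<omega>) = fl_g \<sigma> n (\<gamma> t \<omega>) x"
    unfolding trunc_g_def fl_g_def avg_real using C Z by (intro arg_cong2[where f = "(*)"] refl sum.cong) auto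
  ultimately show ?case by simp
qed

lemma trunc_limit_measurable: "(\<lambda>\<omega>. trunc_g (\<gamma> t \<omega>)) \<in> borel_measurable M"
  and fl_g_measurable: "(\<lambda>\<omega>. fl_g \<sigma> n (\<gamma> t \<omega>) x) \<in> borel_measurable M"
proof -
  have int [measurable]: "(\<lambda>\<omega>. integral\<^sup>L (\<gamma> t \<omega>) f) \<in> borel_measurable M" if [measurable]: "f \<in> borel_measurable (phase n)"
    for f :: "'a point \<Rightarrow> real" by measurable
  have [measurable]: "(\<lambda>\<omega>. mean_C i (\<gamma> t \<omega>)) \<in> borel_measurable M" "(\<lambda>\<omega>. mean_Z i (\<gamma> t \<omega>)) \<in> borel_measurable M"
    "(\<lambda>\<omega>. \<integral>(w, v, c). c i \<partial>\<gamma> t \<omega>) \<in> borel_measurable M" "(\<lambda>\<omega>. fl_Z \<sigma> (\<gamma> t \<omega>) i x) \<in> borel_measurable M"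
    if [simp]: "i < n" for i
    unfolding mean_C_def mean_Z_def fl_Z_def split_beta' by (intro int trunc_integrands that)+
  show "(\<lambda>\<omega>. trunc_g (\<gamma> t \<omega>)) \<in> borel_measurable M" "(\<lambda>\<omega>. fl_g \<sigma> n (\<gamma> t \<omega>) x) \<in> borel_measurable M"
    unfolding trunc_g_def avg_real fl_g_def by measurable
qed

theorem expectation_convergence:
  fixes \<phi> :: "real \<Rightarrow> real"
  assumes \<phi>: "continuous_on UNIV \<phi>" "\<And>z. \<bar>\<phi> z\<bar> \<le> b"
  shows "(\<lambda>N. expectation (\<lambda>\<omega>. \<phi> (net \<sigma> N n (\<Theta> N t \<omega>) x))) \<longlonglongrightarrow> expectation (\<lambda>\<omega>. \<phi> (fl_g \<sigma> n (\<gamma> t \<omega>) x))"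
proof -
  have [measurable]: "\<phi> \<in> borel_measurable borel" by (rule borel_measurable_continuous_onI[OF \<phi>(1)])
  note [measurable] = trunc_limit_measurable fl_g_measurable
  have "(\<lambda>N. expectation (\<lambda>\<omega>. \<phi> (trunc_g (empirical N n (\<Theta> N t \<omega>))))) \<longlonglongrightarrow> expectation (\<lambda>\<omega>. \<phi> (trunc_g (\<gamma> t \<omega>)))"
  proof (rule functional_limit)
    show "bounded (range (\<lambda>p. \<phi> (trunc_g p)))" using \<phi>(2) by (auto simp: bounded_iff)
    fix p and ps :: "nat \<Rightarrow> 'a point measure" assume "weakly_converges n ps p"
    then have "(\<lambda>k. trunc_g (ps k)) \<longlonglongrightarrow> trunc_g p"
      unfolding trunc_g_def avg_real
      by (intro tendsto_intros mean_continuous continuous_on_tendsto_compose[OF \<sigma>_cont]) auto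
    then show "(\<lambda>k. \<phi> (trunc_g (ps k))) \<longlonglongrightarrow> \<phi> (trunc_g p)"
      by (intro continuous_on_tendsto_compose[OF \<phi>(1)]) auto
  qed
  also have "expectation (\<lambda>\<omega>. \<phi> (trunc_g (\<gamma> t \<omega>))) = expectation (\<lambda>\<omega>. \<phi> (fl_g \<sigma> n (\<gamma> t \<omega>) x))"
    using trunc_limit_AE by (intro integral_cong_AE) (auto elim!: eventually_mono)
  finally have lim: "(\<lambda>N. expectation (\<lambda>\<omega>. \<phi> (trunc_g (empirical N n (\<Theta> N t \<omega>))))) \<longlonglongrightarrow>
    expectation (\<lambda>\<omega>. \<phi> (fl_g \<sigma> n (\<gamma> t \<omega>) x))" .
  have eq: "expectation (\<lambda>\<omega>. \<phi> (trunc_g (empirical N n (\<Theta> N t \<omega>)))) = expectation (\<lambda>\<omega>. \<phi> (net \<sigma> N n (\<Theta> N t \<omega>) x))"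
    if N: "0 < N" for N
  proof (rule integral_cong_AE)
    note [measurable] = \<Theta>_meas[OF N]
    show "(\<lambda>\<omega>. \<phi> (trunc_g (empirical N n (\<Theta> N t \<omega>)))) \<in> borel_measurable M"
      unfolding trunc_empirical[OF N] avg_def by measurable
    show "(\<lambda>\<omega>. \<phi> (net \<sigma> N n (\<Theta> N t \<omega>) x)) \<in> borel_measurable M"
      unfolding net_avg Z2_avg avg_def by measurable
    show "AE \<omega> in M. \<phi> (trunc_g (empirical N n (\<Theta> N t \<omega>))) = \<phi> (net \<sigma> N n (\<Theta> N t \<omega>) x)"
      using \<Theta>_bound[OF N]
    proof eventually_elim
      case (elim \<omega>)
      then show ?case
        unfolding trunc_empirical[OF N] net_avg Z2_avg avg_real
        by (intro arg_cong[where f = \<phi>] arg_cong2[where f = "(*)"] refl sum.cong arg_cong[where f = \<sigma>])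
          (auto simp: clamp_real(2))
    qed
  qed
  show ?thesis
    by (rule Lim_transform_eventually[OF lim]) (use eq in \<open>auto intro!: eventually_mono[OF eventually_gt_at_top[of 0]]\<close>)
qed

end

section \<open>The limit theorem\<close>

lemma inverse_sqrt_tendsto: "(\<lambda>n. 1 / sqrt (real n)) \<longlonglongrightarrow> 0"
  by (intro tendsto_divide_0[OF tendsto_const] filterlim_at_top_imp_at_infinity
      filterlim_compose[OF sqrt_at_top filterlim_real_sequentially])

lemma C2b_bound:
  assumes "C2b \<sigma>"
  obtains S where "\<And>z. \<bar>\<sigma> z\<bar> \<le> S" "\<And>z. \<bar>deriv \<sigma> z\<bar> \<le> S"
    "\<And>z z'. \<bar>\<sigma> z - \<sigma> z'\<bar> \<le> S * \<bar>z - z'\<bar>" "\<And>z z'. \<bar>deriv \<sigma> z - deriv \<sigma> z'\<bar> \<le> S * \<bar>z - z'\<bar>"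
proof -
  obtain S0 S1 S2 where b: "\<And>z. \<bar>\<sigma> z\<bar> \<le> S0" "\<And>z. \<bar>deriv \<sigma> z\<bar> \<le> S1" "\<And>z. \<bar>deriv (deriv \<sigma>) z\<bar> \<le> S2"
    using assms by (auto simp: C2b_def bounded_iff)
  define S where "S = max S0 (max S1 S2)"
  have S: "\<bar>\<sigma> z\<bar> \<le> S" "\<bar>deriv \<sigma> z\<bar> \<le> S" "\<bar>deriv (deriv \<sigma>) z\<bar> \<le> S" for z
    using b[of z] by (auto simp: S_def)
  have lip: "\<bar>f z - f z'\<bar> \<le> S * \<bar>z - z'\<bar>"
    if "\<And>z. f differentiable at z" "\<And>z. \<bar>deriv f z\<bar> \<le> S" for f :: "real \<Rightarrow> real" and z z'
    using field_differentiable_bound[of UNIV f "deriv f" S z z'] that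
    by (auto simp: DERIV_deriv_iff_real_differentiable)
  show thesis using that[of S] S lip[of \<sigma>] lip[of "deriv \<sigma>"] assms by (auto simp: C2b_def)
qed

lemma (in mf_data) mf_solution_family:
  assumes sol: "mf_solution \<sigma> \<pi> mu_c mu_W1 mu_W2 CC WW1 WW2 C W1 W2"
    and ne: "CC \<noteq> {}" "WW1 \<noteq> {}" "WW2 \<noteq> {}"
  obtains B where "\<And>t R. t \<in> {0..1} \<Longrightarrow> B \<le> R \<Longrightarrow> family R (C t) (W1 t) (W2 t)"
proof -
  obtain B where B: "\<forall>t\<in>{0..1}. \<forall>c\<in>CC. \<forall>w\<in>WW1. \<forall>u\<in>WW2. \<bar>C t c\<bar> \<le> B \<and> norm (W1 t w) \<le> B \<and> \<bar>W2 t c w u\<bar> \<le> B"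
    using sol[unfolded mf_solution_def, THEN conjunct2, THEN conjunct1] by (rule exE)
  have meas: "\<forall>t\<in>{0..1}. C t \<in> borel_measurable borel \<and> W1 t \<in> borel_measurable borel \<and>
        (\<lambda>(c, w, u). W2 t c w u) \<in> borel_measurable borel"
    using sol[unfolded mf_solution_def, THEN conjunct1] .
  show thesis
  proof (rule that[of B])
    fix t R :: real assume t: "t \<in> {0..1}" and R: "B \<le> R"
    show "family R (C t) (W1 t) (W2 t)"
      unfolding family_def using meas[rule_format, OF t] B[rule_format, OF t] ne R
      by (meson ex_in_conv order_trans)
  qed
qed

lemma (in mf_data) mf_solution_output_eq:
  assumes sol: "mf_solution \<sigma> \<pi> mu_c mu_W1 mu_W2 CC WW1 WW2 C W1 W2"
    "mf_solution \<sigma> \<pi> mu_c mu_W1 mu_W2 CC WW1 WW2 C' W1' W2'"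
    and ne: "CC \<noteq> {}" "WW1 \<noteq> {}" "WW2 \<noteq> {}"
    and t: "t \<in> {0..1}" and x: "norm x \<le> Q"
  shows "gf (C t) (W1 t) (W2 t) x = gf (C' t) (W1' t) (W2' t) x"
proof -
  obtain B where B: "\<And>t R. t \<in> {0..1} \<Longrightarrow> B \<le> R \<Longrightarrow> family R (C t) (W1 t) (W2 t)"
    using mf_solution_family[OF sol(1) ne] by metis
  obtain B' where B': "\<And>t R. t \<in> {0..1} \<Longrightarrow> B' \<le> R \<Longrightarrow> family R (C' t) (W1' t) (W2' t)"
    using mf_solution_family[OF sol(2) ne] by metis
  have "lip 0 (max B B' * S) (L_g (max B B')) (gf (C t) (W1 t) (W2 t) x) (gf (C' t) (W1' t) (W2' t) x)"
    using B[OF t] B'[OF t] mf_solution_unique[OF sol ne t] by (intro lip_g x) auto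
  then show ?thesis by (simp add: lip_def)
qed

theorem theorem2p3:
  fixes M :: "'w measure"
    and \<sigma> :: "real \<Rightarrow> real"
    and XX :: "'a::euclidean_space set" and YY :: "real set"
    and CC :: "real set" and WW1 :: "'a set" and WW2 :: "real set"
    and \<pi> :: "('a \<times> real) measure"
    and mu_c :: "real measure" and mu_W1 :: "'a measure" and mu_W2 :: "real measure"
    and C0 :: "nat \<Rightarrow> 'w \<Rightarrow> real" and W20 :: "nat \<Rightarrow> nat \<Rightarrow> 'w \<Rightarrow> real" and W10 :: "nat \<Rightarrow> 'w \<Rightarrow> 'a"
    and XY :: "nat \<Rightarrow> 'w \<Rightarrow> 'a \<times> real"
  assumes "prob_space M"
    and "C2b \<sigma>"
    and "compact XX" and "compact YY" and "compact CC" and "compact WW1" and "compact WW2"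
    and "independent_sources M C0 W20 W10 XY"
    and "\<forall>k. distr M borel (XY k) = \<pi>" and "\<forall>k. AE \<omega> in M. XY k \<omega> \<in> XX \<times> YY"
    and "\<forall>i. distr M borel (C0 i) = mu_c" and "\<forall>i. AE \<omega> in M. C0 i \<omega> \<in> CC"
    and "\<forall>i j. distr M borel (W20 i j) = mu_W2" and "\<forall>i j. AE \<omega> in M. W20 i j \<omega> \<in> WW2"
    and "\<forall>j. distr M borel (W10 j) = mu_W1" and "\<forall>j. AE \<omega> in M. W10 j \<omega> \<in> WW1"
    and "has_continuous_density mu_c" and "has_continuous_density mu_W2"
    and "has_continuous_density mu_W1"
  shows
    "(\<exists>C W1 W2. mf_solution \<sigma> \<pi> mu_c mu_W1 mu_W2 CC WW1 WW2 C W1 W2 \<and>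
        (\<forall>C' W1' W2'. mf_solution \<sigma> \<pi> mu_c mu_W1 mu_W2 CC WW1 WW2 C' W1' W2' \<longrightarrow>
           (\<forall>t\<in>{0..1}. \<forall>c\<in>CC. \<forall>w\<in>WW1. \<forall>u\<in>WW2.
              C' t c = C t c \<and> W1' t w = W1 t w \<and> W2' t c w u = W2 t c w u))) \<and>
     (\<forall>C W1 W2. mf_solution \<sigma> \<pi> mu_c mu_W1 mu_W2 CC WW1 WW2 C W1 W2 \<longrightarrow>
        (let g = (\<lambda>t. mf_g \<sigma> mu_c mu_W1 mu_W2 (C t) (W1 t) (W2 t));
             gN = (\<lambda>N1 N2 t x \<omega>. net \<sigma> N1 N2 (sgd_at \<sigma> C0 W20 W10 XY N1 N2 t \<omega>) x)
         in
           (\<forall>t\<in>{0..1}. \<forall>x\<in>XX. \<forall>\<epsilon>>0.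
              (\<lambda>N2. limsup (\<lambda>N1. ereal (\<P>(\<omega> in M. \<bar>gN N1 N2 t x \<omega> - g t x\<bar> > \<epsilon>)))) \<longlonglongrightarrow> 0) \<and>
           (\<forall>\<gamma>. (\<forall>N2\<ge>1. first_layer_limit M \<sigma> \<pi> mu_W1 mu_W2 C0 W20 W10 XY N2 (\<gamma> N2)) \<longrightarrow>
              (\<forall>t\<in>{0..1}. \<forall>x\<in>XX. \<forall>\<epsilon>>0. \<forall>N2\<ge>1.
                 \<P>(\<omega> in M. \<bar>fl_g \<sigma> N2 (\<gamma> N2 t \<omega>) x - g t x\<bar> = \<epsilon>) = 0 \<longrightarrow>
                 (\<lambda>N1. \<P>(\<omega> in M. \<bar>gN N1 N2 t x \<omega> - g t x\<bar> > \<epsilon>)) \<longlonglongrightarrow>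
                 \<P>(\<omega> in M. \<bar>fl_g \<sigma> N2 (\<gamma> N2 t \<omega>) x - g t x\<bar> > \<epsilon>)) \<and>
              (\<exists>K::real. \<forall>t\<in>{0..1}. \<forall>N2\<ge>1.
                 (\<Squnion>x\<in>XX. \<integral>\<^sup>+\<omega>. ennreal \<bar>fl_g \<sigma> N2 (\<gamma> N2 t \<omega>) x - g t x\<bar> \<partial>M)
                   \<le> ennreal (K * real N2 powr (- 1 / 2))))))"
proof -
  interpret sources M \<pi> mu_c mu_W1 mu_W2 C0 W20 W10 XY
    using assms by (simp add: sources_def sources_axioms_def)
  obtain S where S: "\<And>z. \<bar>\<sigma> z\<bar> \<le> S" "\<And>z. \<bar>deriv \<sigma> z\<bar> \<le> S"
    "\<And>z z'. \<bar>\<sigma> z - \<sigma> z'\<bar> \<le> S * \<bar>z - z'\<bar>" "\<And>z z'. \<bar>deriv \<sigma> z - deriv \<sigma> z'\<bar> \<le> S * \<bar>z - z'\<bar>"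
    using C2b_bound[OF \<open>C2b \<sigma>\<close>] by metis
  have "bounded XX" "bounded YY" "bounded CC" "bounded WW1" "bounded WW2"
    using assms(3-7) by (simp_all add: compact_imp_bounded)
  then obtain q1 q2 m1 m2 m3 where q: "\<And>x. x \<in> XX \<Longrightarrow> norm x \<le> q1" "\<And>y. y \<in> YY \<Longrightarrow> \<bar>y\<bar> \<le> q2"
    "\<And>c. c \<in> CC \<Longrightarrow> \<bar>c\<bar> \<le> m1" "\<And>w. w \<in> WW1 \<Longrightarrow> norm w \<le> m2" "\<And>u. u \<in> WW2 \<Longrightarrow> \<bar>u\<bar> \<le> m3"
    unfolding bounded_iff real_norm_def by metis
  define Q where "Q = max 0 (max q1 q2)"
  define m where "m = max 0 (max m1 (max m2 m3))"
  have Q: "0 \<le> Q" "x \<in> XX \<Longrightarrow> norm x \<le> Q" "y \<in> YY \<Longrightarrow> \<bar>y\<bar> \<le> Q" for x y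
    using q(1)[of x] q(2)[of y] by (auto simp: Q_def)
  have m: "0 \<le> m" "c \<in> CC \<Longrightarrow> \<bar>c\<bar> \<le> m" "w \<in> WW1 \<Longrightarrow> norm w \<le> m" "u \<in> WW2 \<Longrightarrow> \<bar>u\<bar> \<le> m" for c w u
    using q(3)[of c] q(4)[of w] q(5)[of u] by (auto simp: m_def)
  have label_sets: "CC \<in> sets borel" "WW1 \<in> sets borel" "WW2 \<in> sets borel" "XX \<times> YY \<in> sets borel"
    using assms by (auto intro!: borel_compact compact_Times)
  have laws_AE: "AE c in mu_c. c \<in> CC" "AE w in mu_W1. w \<in> WW1" "AE u in mu_W2. u \<in> WW2" "AE p in \<pi>. p \<in> XX \<times> YY"
    using assms label_sets unfolding laws(1)[of 0, symmetric] laws(2)[of 0 0, symmetric] laws(3)[of 0, symmetric] laws(4)[of 0, symmetric]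
    by (simp_all add: AE_distr_iff)
  have ne: "CC \<noteq> {}" "WW1 \<noteq> {}" "WW2 \<noteq> {}"
    using assms(12,14,16) by (auto simp: prob_space.AE_False)
  have AE_pi: "AE (x, y) in \<pi>. norm x \<le> Q \<and> \<bar>y\<bar> \<le> Q"
    using laws_AE(4) Q by (auto elim!: eventually_mono)
  interpret L: mf_data \<sigma> \<pi> mu_c mu_W1 mu_W2 S Q CC WW1 WW2
    by (simp add: mf_data_def prob_space_laws sets_laws sets_pi laws_AE AE_pi S Q(1))
  interpret T: mf_data_total \<sigma> \<pi> mu_c mu_W1 mu_W2 S Q
    by (simp add: mf_data_total_def mf_data_def prob_space_laws sets_laws sets_pi AE_pi S Q(1))
  define \<iota> :: "real \<Rightarrow> real" where "\<iota> = closest_point (cball 0 m)"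
  define \<iota>w :: "'a \<Rightarrow> 'a" where "\<iota>w = closest_point (cball 0 m)"
  have \<iota>: "continuous_on UNIV \<iota>" "\<bar>\<iota> c\<bar> \<le> m" "\<bar>c\<bar> \<le> m \<Longrightarrow> \<iota> c = c" for c
    using closest_point_in_set[of "cball 0 m" c] m(1)
    by (auto simp: \<iota>_def intro!: continuous_on_closest_point closest_point_self)
  have \<iota>w: "continuous_on UNIV \<iota>w" "norm (\<iota>w w) \<le> m" "norm w \<le> m \<Longrightarrow> \<iota>w w = w" for w
    using closest_point_in_set[of "cball 0 m" w] m(1)
    by (auto simp: \<iota>w_def intro!: continuous_on_closest_point closest_point_self)
  obtain C W1 D R where sol:
    "continuous_on UNIV (\<lambda>(t, c). C t c)" "continuous_on UNIV (\<lambda>(t, w). W1 t w)"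
    "continuous_on UNIV (\<lambda>(t, c, w). D t c w)"
    "\<And>t c. \<bar>C t c\<bar> \<le> R" "\<And>t w. norm (W1 t w) \<le> R" "\<And>t c w u. \<bar>\<iota> u + D t c w\<bar> \<le> R"
    "\<And>c. C 0 c = \<iota> c" "\<And>w. W1 0 w = \<iota>w w" "\<And>c w. D 0 c w = 0"
    "\<And>t c. t \<in> {0..1} \<Longrightarrow> ((\<lambda>s. C s c) has_vector_derivative
       T.rhsC (C t) (W1 t) (\<lambda>c w u. \<iota> u + D t c w) c) (at t within {0..1})"
    "\<And>t w. t \<in> {0..1} \<Longrightarrow> ((\<lambda>s. W1 s w) has_vector_derivative
       T.rhsW1 (C t) (W1 t) (\<lambda>c w u. \<iota> u + D t c w) w) (at t within {0..1})"
    "\<And>t c w. t \<in> {0..1} \<Longrightarrow> ((\<lambda>s. D s c w) has_vector_derivative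
       T.rhsW2 (C t) (W1 t) (\<lambda>c w u. \<iota> u + D t c w) c w) (at t within {0..1})"
    by (rule T.total_solution_exists[OF \<iota>(1,2) \<iota>w(1,2) \<iota>(1,2)]) (rule that; assumption)
  define W2 where "W2 = (\<lambda>t c w u. \<iota> u + D t c w)"
  have W2_eq: "W2 t = (\<lambda>c w u. \<iota> u + D t c w)" for t by (simp add: W2_def)
  have coupling: "coupling \<sigma> \<pi> mu_c mu_W1 mu_W2 S Q M C0 W20 W10 XY C W1 D \<iota> R CC WW1 WW2 W2"
  proof
    show "W2 = (\<lambda>t c w u. \<iota> u + D t c w)" by (rule W2_def)
    show "continuous_on UNIV (\<lambda>(t, c). C t c)" "continuous_on UNIV (\<lambda>(t, w). W1 t w)"
      "continuous_on UNIV (\<lambda>(t, c, w). D t c w)" "continuous_on UNIV \<iota>"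
      by (rule sol(1-3) \<iota>(1))+
    show "\<bar>C t c\<bar> \<le> R" "norm (W1 t w) \<le> R" "\<bar>W2 t c w u\<bar> \<le> R" for t c w u
      unfolding W2_def by (rule sol(4-6))+
    show "C 0 c = c" if "c \<in> CC" for c using sol(7)[of c] \<iota>(3)[OF m(2)[OF that]] by simp
    show "W1 0 w = w" if "w \<in> WW1" for w using sol(8)[of w] \<iota>w(3)[OF m(3)[OF that]] by simp
    show "\<iota> u = u" if "u \<in> WW2" for u using \<iota>(3)[OF m(4)[OF that]] .
    show "D 0 c w = 0" for c w by (rule sol(9))
    show "((\<lambda>s. C s c) has_vector_derivative T.rhsC (C t) (W1 t) (W2 t) c) (at t within {0..1})"
      "((\<lambda>s. W1 s w) has_vector_derivative T.rhsW1 (C t) (W1 t) (W2 t) w) (at t within {0..1})"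
      "((\<lambda>s. D s c w) has_vector_derivative T.rhsW2 (C t) (W1 t) (W2 t) c w) (at t within {0..1})"
      if "t \<in> {0..1}" for t c w
      unfolding W2_eq by (rule sol(10-12)[OF that])+
    show "AE \<omega> in M. C0 i \<omega> \<in> CC" "AE \<omega> in M. W10 j \<omega> \<in> WW1" "AE \<omega> in M. W20 i j \<omega> \<in> WW2" for i j
      by (rule assms(12,14,16)[rule_format])+
  qed
  have solution: "mf_solution \<sigma> \<pi> mu_c mu_W1 mu_W2 CC WW1 WW2 C W1 W2"
    unfolding L.mf_solution_iff
  proof (intro conjI ballI exI[of _ R])
    fix t
    show "C t \<in> borel_measurable borel" "W1 t \<in> borel_measurable borel"
      "(\<lambda>(c, w, u). W2 t c w u) \<in> borel_measurable borel"
      using coupling.fam[OF coupling, of t] by (auto simp: T.family_def)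
    show "\<bar>C t c\<bar> \<le> R" "norm (W1 t w) \<le> R" "\<bar>W2 t c w u\<bar> \<le> R" for c w u
      unfolding W2_def by (rule sol(4-6))+
  next
    show "C 0 c = c" if "c \<in> CC" for c using sol(7)[of c] \<iota>(3)[OF m(2)[OF that]] by simp
    show "W1 0 w = w" if "w \<in> WW1" for w using sol(8)[of w] \<iota>w(3)[OF m(3)[OF that]] by simp
    show "W2 0 c w u = u" if "u \<in> WW2" for c w u by (simp add: W2_def sol(9) \<iota>(3)[OF m(4)[OF that]])
  qed (rule coupling.ode[OF coupling] coupling.W2_ode[OF coupling]; assumption)+
  have unique: "C' t c = C t c \<and> W1' t w = W1 t w \<and> W2' t c w u = W2 t c w u"
    if "mf_solution \<sigma> \<pi> mu_c mu_W1 mu_W2 CC WW1 WW2 C' W1' W2'" "t \<in> {0..1}" "c \<in> CC" "w \<in> WW1" "u \<in> WW2"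
    for C' W1' W2' t c w u
    using L.mf_solution_unique[OF that(1) solution ne that(2)] that by (simp add: L.close_fam_def)
  define g where "g t = mf_g \<sigma> mu_c mu_W1 mu_W2 (C t) (W1 t) (W2 t)" for t
  define gN where "gN N n t x \<omega> = net \<sigma> N n (sgd_at \<sigma> C0 W20 W10 XY N n t \<omega>) x" for N n t x \<omega>
  have g_eq: "mf_g \<sigma> mu_c mu_W1 mu_W2 (C' t) (W1' t) (W2' t) x = g t x"
    if "mf_solution \<sigma> \<pi> mu_c mu_W1 mu_W2 CC WW1 WW2 C' W1' W2'" "t \<in> {0..1}" "x \<in> XX" for C' W1' W2' t x
    unfolding g_def by (rule L.mf_solution_output_eq[OF that(1) solution ne that(2) Q(2)[OF that(3)]])
  define K where "K = \<bar>coupling.K_final S Q R\<bar>"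
  have mean: "integrable M (\<lambda>\<omega>. \<bar>gN N n t x \<omega> - g t x\<bar>)"
    "expectation (\<lambda>\<omega>. \<bar>gN N n t x \<omega> - g t x\<bar>) \<le> K * rate n N" "gN N n t x \<in> borel_measurable M"
    if "t \<in> {0..1}" "x \<in> XX" "0 < n" "0 < N" for N n t x
  proof -
    note e = coupling.net_expectation[OF coupling that(3,4,1) Q(2)[OF that(2)], folded g_def gN_def]
    have "coupling.K_final S Q R * rate n N \<le> K * rate n N"
      by (intro mult_right_mono) (auto simp: K_def rate_def)
    with e show "integrable M (\<lambda>\<omega>. \<bar>gN N n t x \<omega> - g t x\<bar>)"
      "expectation (\<lambda>\<omega>. \<bar>gN N n t x \<omega> - g t x\<bar>) \<le> K * rate n N" "gN N n t x \<in> borel_measurable M" by auto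
  qed
  have rate_lim: "(\<lambda>N. c * rate n N) \<longlonglongrightarrow> c / sqrt (real n)" for c n
  proof -
    have "(\<lambda>N. c * (1 / sqrt (real N) + 1 / sqrt (real n))) \<longlonglongrightarrow> c * (0 + 1 / sqrt (real n))"
      by (intro tendsto_intros inverse_sqrt_tendsto)
    then show ?thesis by (simp add: rate_def)
  qed
  have limit: "(\<lambda>n. limsup (\<lambda>N. ereal (\<P>(\<omega> in M. \<bar>gN N n t x \<omega> - g t x\<bar> > \<epsilon>)))) \<longlonglongrightarrow> 0"
    if t: "t \<in> {0..1}" and x: "x \<in> XX" and \<epsilon>: "0 < \<epsilon>" for t x \<epsilon>
  proof (rule tendsto_sandwich[where f = "\<lambda>_. 0" and h = "\<lambda>n. ereal (K / \<epsilon> / sqrt (real n))"])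
    show "\<forall>\<^sub>F n in sequentially. 0 \<le> limsup (\<lambda>N. ereal (\<P>(\<omega> in M. \<bar>gN N n t x \<omega> - g t x\<bar> > \<epsilon>)))"
      by (intro always_eventually allI le_Limsup) auto
    have "limsup (\<lambda>N. ereal (\<P>(\<omega> in M. \<bar>gN N n t x \<omega> - g t x\<bar> > \<epsilon>))) \<le> ereal (K / \<epsilon> / sqrt (real n))"
      if n: "0 < n" for n
    proof -
      have "\<P>(\<omega> in M. \<bar>gN N n t x \<omega> - g t x\<bar> > \<epsilon>) \<le> K / \<epsilon> * rate n N" if N: "0 < N" for N
      proof -
        note e = mean[OF t x n N]
        have "\<P>(\<omega> in M. \<bar>gN N n t x \<omega> - g t x\<bar> > \<epsilon>) \<le> \<P>(\<omega> in M. \<bar>gN N n t x \<omega> - g t x\<bar> \<ge> \<epsilon>)"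
          using e(3) by (intro finite_measure_mono) auto
        also have "\<dots> \<le> expectation (\<lambda>\<omega>. \<bar>gN N n t x \<omega> - g t x\<bar>) / \<epsilon>"
          using integral_Markov_inequality_measure[OF e(1), of "space M" \<epsilon>] \<epsilon> by simp
        also have "\<dots> \<le> K * rate n N / \<epsilon>" using e(2) \<epsilon> by (intro divide_right_mono) auto
        finally show ?thesis by simp
      qed
      then have "limsup (\<lambda>N. ereal (\<P>(\<omega> in M. \<bar>gN N n t x \<omega> - g t x\<bar> > \<epsilon>))) \<le> limsup (\<lambda>N. ereal (K / \<epsilon> * rate n N))"
        by (intro Limsup_mono eventually_mono[OF eventually_gt_at_top[of 0]]) simp
      also have "\<dots> = ereal (K / \<epsilon> / sqrt (real n))"
        by (rule lim_imp_Limsup[OF _ tendsto_ereal[OF rate_lim]]) simp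
      finally show ?thesis .
    qed
    then show "\<forall>\<^sub>F n in sequentially. limsup (\<lambda>N. ereal (\<P>(\<omega> in M. \<bar>gN N n t x \<omega> - g t x\<bar> > \<epsilon>)))
        \<le> ereal (K / \<epsilon> / sqrt (real n))"
      by (intro eventually_mono[OF eventually_gt_at_top[of 0]])
    have "(\<lambda>n. K / \<epsilon> * (1 / sqrt (real n))) \<longlonglongrightarrow> K / \<epsilon> * 0" by (intro tendsto_intros inverse_sqrt_tendsto)
    from tendsto_ereal[OF this] show "(\<lambda>n. ereal (K / \<epsilon> / sqrt (real n))) \<longlonglongrightarrow> 0"
      by (simp add: zero_ereal_def)
  qed simp
  have first: "first_layer M \<sigma> S (T.rc R) n (\<lambda>N. sgd_at \<sigma> C0 W20 W10 XY N n) \<gamma> t"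
    if lim: "first_layer_limit M \<sigma> \<pi> mu_W1 mu_W2 C0 W20 W10 XY n \<gamma>" and n: "0 < n" and t: "t \<in> {0..1}" for n \<gamma> t
  proof
    show "continuous_on UNIV \<sigma>" by (rule T.sigma_continuous)
    show "0 \<le> T.rc R" by (rule coupling.R_le_rc(2)[OF coupling zero_less_one zero_less_one])
    show "\<gamma> t \<in> measurable M (prob_algebra (phase n))"
      "process_converges_in_distribution M n (\<lambda>N t \<omega>. empirical N n (sgd_at \<sigma> C0 W20 W10 XY N n t \<omega>)) \<gamma>"
      using lim t by (auto simp: first_layer_limit_def)
    fix N :: nat assume N: "0 < N"
    note reg = coupling.sgd_at_regular[OF coupling n N t]
    show "(\<lambda>\<omega>. pC (sgd_at \<sigma> C0 W20 W10 XY N n t \<omega>) i) \<in> borel_measurable M"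
      "(\<lambda>\<omega>. pW1 (sgd_at \<sigma> C0 W20 W10 XY N n t \<omega>) j) \<in> borel_measurable M"
      "(\<lambda>\<omega>. pW2 (sgd_at \<sigma> C0 W20 W10 XY N n t \<omega>) i j) \<in> borel_measurable M" for i j
      by (rule reg(1-3))+
    show "AE \<omega> in M. \<forall>i<n. \<bar>pC (sgd_at \<sigma> C0 W20 W10 XY N n t \<omega>) i\<bar> \<le> T.rc R \<and>
        (\<forall>j<N. \<bar>pW2 (sgd_at \<sigma> C0 W20 W10 XY N n t \<omega>) i j\<bar> \<le> T.rc R)"
      by (rule reg(4))
  qed (use n t S in auto)
  have portmanteau: "(\<lambda>N. \<P>(\<omega> in M. \<bar>gN N n t x \<omega> - g t x\<bar> > \<epsilon>)) \<longlonglongrightarrow>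
      \<P>(\<omega> in M. \<bar>fl_g \<sigma> n (\<gamma> t \<omega>) x - g t x\<bar> > \<epsilon>)"
    if lim: "first_layer_limit M \<sigma> \<pi> mu_W1 mu_W2 C0 W20 W10 XY n \<gamma>" and n: "0 < n" and t: "t \<in> {0..1}" and x: "x \<in> XX"
      and null: "\<P>(\<omega> in M. \<bar>fl_g \<sigma> n (\<gamma> t \<omega>) x - g t x\<bar> = \<epsilon>) = 0" for n \<gamma> t x \<epsilon>
  proof -
    note F = first[OF lim n t]
    have "(\<lambda>N. \<P>(\<omega> in M. \<bar>gN (Suc N) n t x \<omega> - g t x\<bar> > \<epsilon>)) \<longlonglongrightarrow> \<P>(\<omega> in M. \<bar>fl_g \<sigma> n (\<gamma> t \<omega>) x - g t x\<bar> > \<epsilon>)"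
    proof (rule expectation_conv_imp_prob_conv)
      show "gN (Suc N) n t x \<in> borel_measurable M" for N by (rule mean(3)[OF t x n]) simp
      show "(\<lambda>\<omega>. fl_g \<sigma> n (\<gamma> t \<omega>) x) \<in> borel_measurable M" by (rule first_layer.fl_g_measurable[OF F])
      show "(\<lambda>N. expectation (\<lambda>\<omega>. f (gN (Suc N) n t x \<omega>))) \<longlonglongrightarrow> expectation (\<lambda>\<omega>. f (fl_g \<sigma> n (\<gamma> t \<omega>) x))"
        if "continuous_on UNIV f" "\<And>z. \<bar>f z\<bar> \<le> 1" for f :: "real \<Rightarrow> real"
        using LIMSEQ_Suc[OF first_layer.expectation_convergence[OF F that]] by (simp add: gN_def)
    qed (rule null)
    then show ?thesis by (rule LIMSEQ_imp_Suc)
  qed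
  have rate_bound: "(\<integral>\<^sup>+\<omega>. ennreal \<bar>fl_g \<sigma> n (\<gamma> t \<omega>) x - g t x\<bar> \<partial>M) \<le> ennreal (K * real n powr (- 1 / 2))"
    if lim: "first_layer_limit M \<sigma> \<pi> mu_W1 mu_W2 C0 W20 W10 XY n \<gamma>" and n: "0 < n" and t: "t \<in> {0..1}" and x: "x \<in> XX"
    for n \<gamma> t x
  proof -
    note F = first[OF lim n t]
    define b where "b = T.rc R * S + \<bar>g t x\<bar>"
    have b: "0 \<le> b" using coupling.R_le_rc(2)[OF coupling zero_less_one zero_less_one] T.S_nonneg by (simp add: b_def)
    define \<phi> where "\<phi> z = min \<bar>z - g t x\<bar> b" for z
    have \<phi>: "continuous_on UNIV \<phi>" "\<bar>\<phi> z\<bar> \<le> b" for z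
      using b by (auto simp: \<phi>_def[abs_def] intro!: continuous_intros)
    have Y_meas: "(\<lambda>\<omega>. fl_g \<sigma> n (\<gamma> t \<omega>) x) \<in> borel_measurable M" by (rule first_layer.fl_g_measurable[OF F])
    have AE_eq: "AE \<omega> in M. \<phi> (fl_g \<sigma> n (\<gamma> t \<omega>) x) = \<bar>fl_g \<sigma> n (\<gamma> t \<omega>) x - g t x\<bar>"
      using first_layer.trunc_limit_AE[OF F, of x] by eventually_elim (auto simp: \<phi>_def b_def)
    have \<phi>_meas: "\<phi> \<in> borel_measurable borel" by (rule borel_measurable_continuous_onI[OF \<phi>(1)])
    have int: "integrable M (\<lambda>\<omega>. \<phi> (fl_g \<sigma> n (\<gamma> t \<omega>) x))"
      using measurable_compose[OF Y_meas \<phi>_meas] \<phi>(2) by (intro integrable_const_bound[where B = b]) auto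
    have conv: "(\<lambda>N. expectation (\<lambda>\<omega>. \<phi> (gN N n t x \<omega>))) \<longlonglongrightarrow> expectation (\<lambda>\<omega>. \<phi> (fl_g \<sigma> n (\<gamma> t \<omega>) x))"
      using first_layer.expectation_convergence[OF F \<phi>] by (simp add: gN_def)
    have le: "expectation (\<lambda>\<omega>. \<phi> (gN N n t x \<omega>)) \<le> K * rate n N" if N: "0 < N" for N
    proof -
      note e = mean[OF t x n N]
      have "expectation (\<lambda>\<omega>. \<phi> (gN N n t x \<omega>)) \<le> expectation (\<lambda>\<omega>. \<bar>gN N n t x \<omega> - g t x\<bar>)"
        using measurable_compose[OF e(3) \<phi>_meas] \<phi>(2)
        by (intro integral_mono e integrable_const_bound[where B = b]) (auto simp: \<phi>_def)
      with e(2) show ?thesis by linarith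
    qed
    have "expectation (\<lambda>\<omega>. \<phi> (fl_g \<sigma> n (\<gamma> t \<omega>) x)) \<le> K / sqrt (real n)"
      by (rule LIMSEQ_le[OF conv rate_lim]) (use le in \<open>auto intro!: exI[of _ 1]\<close>)
    also have "\<dots> = K * real n powr (- 1 / 2)"
      using powr_minus_divide[of "real n" "1 / 2"] powr_half_sqrt[of "real n"] by simp
    finally have "expectation (\<lambda>\<omega>. \<phi> (fl_g \<sigma> n (\<gamma> t \<omega>) x)) \<le> K * real n powr (- 1 / 2)" .
    moreover have "(\<integral>\<^sup>+\<omega>. ennreal \<bar>fl_g \<sigma> n (\<gamma> t \<omega>) x - g t x\<bar> \<partial>M) = (\<integral>\<^sup>+\<omega>. ennreal (\<phi> (fl_g \<sigma> n (\<gamma> t \<omega>) x)) \<partial>M)"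
      using AE_eq by (intro nn_integral_cong_AE) (auto elim!: eventually_mono)
    moreover have "\<dots> = ennreal (expectation (\<lambda>\<omega>. \<phi> (fl_g \<sigma> n (\<gamma> t \<omega>) x)))"
      using b by (intro nn_integral_eq_integral int) (auto simp: \<phi>_def)
    ultimately show ?thesis by (simp add: ennreal_leI)
  qed
  have "\<exists>C W1 W2. mf_solution \<sigma> \<pi> mu_c mu_W1 mu_W2 CC WW1 WW2 C W1 W2 \<and>
      (\<forall>C' W1' W2'. mf_solution \<sigma> \<pi> mu_c mu_W1 mu_W2 CC WW1 WW2 C' W1' W2' \<longrightarrow>
         (\<forall>t\<in>{0..1}. \<forall>c\<in>CC. \<forall>w\<in>WW1. \<forall>u\<in>WW2.
            C' t c = C t c \<and> W1' t w = W1 t w \<and> W2' t c w u = W2 t c w u))"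
    by (rule exI[of _ C], rule exI[of _ W1], rule exI[of _ W2], rule conjI[OF solution],
      intro allI impI ballI, rule unique)
  then show ?thesis
    unfolding Let_def
  proof (rule conjI, intro conjI allI impI ballI exI[of _ K])
    fix C' W1' W2' and t \<epsilon> :: real and x
    assume sol': "mf_solution \<sigma> \<pi> mu_c mu_W1 mu_W2 CC WW1 WW2 C' W1' W2'"
    assume "t \<in> {0..1}" "x \<in> XX" "0 < \<epsilon>"
    then show "(\<lambda>n. limsup (\<lambda>N. ereal (\<P>(\<omega> in M. \<bar>net \<sigma> N n (sgd_at \<sigma> C0 W20 W10 XY N n t \<omega>) x
        - mf_g \<sigma> mu_c mu_W1 mu_W2 (C' t) (W1' t) (W2' t) x\<bar> > \<epsilon>)))) \<longlonglongrightarrow> 0"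
      using limit[of t x \<epsilon>] by (simp add: g_eq[OF sol'] gN_def)
  next
    fix C' W1' W2' \<gamma> and t \<epsilon> :: real and x and n :: nat
    assume sol': "mf_solution \<sigma> \<pi> mu_c mu_W1 mu_W2 CC WW1 WW2 C' W1' W2'"
    assume \<gamma>: "\<forall>n\<ge>1. first_layer_limit M \<sigma> \<pi> mu_W1 mu_W2 C0 W20 W10 XY n (\<gamma> n)"
      and t: "t \<in> {0..1}" and x: "x \<in> XX" and "0 < \<epsilon>" and n: "1 \<le> n"
      and null: "\<P>(\<omega> in M. \<bar>fl_g \<sigma> n (\<gamma> n t \<omega>) x - mf_g \<sigma> mu_c mu_W1 mu_W2 (C' t) (W1' t) (W2' t) x\<bar> = \<epsilon>) = 0"
    have "first_layer_limit M \<sigma> \<pi> mu_W1 mu_W2 C0 W20 W10 XY n (\<gamma> n)" "0 < n" using \<gamma> n by auto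
    from portmanteau[OF this t x, of \<epsilon>] null
    show "(\<lambda>N. \<P>(\<omega> in M. \<bar>net \<sigma> N n (sgd_at \<sigma> C0 W20 W10 XY N n t \<omega>) x
          - mf_g \<sigma> mu_c mu_W1 mu_W2 (C' t) (W1' t) (W2' t) x\<bar> > \<epsilon>)) \<longlonglongrightarrow>
        \<P>(\<omega> in M. \<bar>fl_g \<sigma> n (\<gamma> n t \<omega>) x - mf_g \<sigma> mu_c mu_W1 mu_W2 (C' t) (W1' t) (W2' t) x\<bar> > \<epsilon>)"
      by (simp add: g_eq[OF sol' t x] gN_def)
  next
    fix C' W1' W2' \<gamma> and t :: real and n :: nat
    assume sol': "mf_solution \<sigma> \<pi> mu_c mu_W1 mu_W2 CC WW1 WW2 C' W1' W2'"
    assume \<gamma>: "\<forall>n\<ge>1. first_layer_limit M \<sigma> \<pi> mu_W1 mu_W2 C0 W20 W10 XY n (\<gamma> n)"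
      and t: "t \<in> {0..1}" and n: "1 \<le> n"
    have F: "first_layer_limit M \<sigma> \<pi> mu_W1 mu_W2 C0 W20 W10 XY n (\<gamma> n)" "0 < n" using \<gamma> n by auto
    show "(\<Squnion>x\<in>XX. \<integral>\<^sup>+\<omega>. ennreal \<bar>fl_g \<sigma> n (\<gamma> n t \<omega>) x - mf_g \<sigma> mu_c mu_W1 mu_W2 (C' t) (W1' t) (W2' t) x\<bar> \<partial>M)
        \<le> ennreal (K * real n powr (- 1 / 2))"
      by (rule SUP_least) (use rate_bound[OF F t] in \<open>simp add: g_eq[OF sol' t]\<close>)
  qed
qed

end
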